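(* Let $F$ be a finitely generated group that is virtually non-abelian free, and let $H \le F$ be a subgroup of finite index $n$. Then the map $i\colon \mathscr{PT}(F) \to \mathscr{PT}(H)$, $\Gamma \mapsto \frac{1}{n}\Gamma$ (restrict the $F$-action to $H$ and multiply all lengths by $\frac1n$), is an isometry (i.e. distance-preserving map) with respect to the Lipschitz metrics: $d_{\mathscr{PT}(H)}(i(\Gamma),i(\Gamma')) = d_{\mathscr{PT}(F)}(\Gamma,\Gamma')$ for all $\Gamma,\Gamma' \in \mathscr{PT}(F)$. Moreover, $i$ maps folding paths in $\mathscr{PT}(F)$ to folding paths in $\mathscr{PT}(H)$.
   Context: Let $F$ be a finitely generated virtually non-abelian free group. The unprojectivized Outer Space $\mathscr{T}(F)$ is the set of minimal isometric actions of $F$ on simplicial $\mathbb{R}$-trees $\Gamma$ with all stabilizers finite, up to $F$-equivariant isometry. Volume. After subdividing at midpoints of inverted edges, $F$ acts on $\Gamma$ without inversions. Set $\mathrm{vol}(\Gamma) = \sum_e \ell(e)/|\mathcal{G}_e|$, where the sum runs over the edges $e$ of the quotient graph $F\backslash\Gamma$ (equivalently over representatives of $F$-orbits of edges of $\Gamma$), $\ell(e)$ is the length of $e$ and $\mathcal{G}_e$ is the (finite) stabilizer in $F$ of a lift of $e$. The Outer Space $\mathscr{PT}(F)$ is the set of $\Gamma\in\mathscr{T}(F)$ with $\mathrm{vol}(\Gamma)=1$. If $H\le F$ has index $n$, then restricting the action makes each $\Gamma\in\mathscr{T}(F)$ an element of $\mathscr{T}(H)$, whose volume as an $H$-tree is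 $n$ times its volume as an $F$-tree; so $\frac1n\Gamma \in \mathscr{PT}(H)$ when $\Gamma\in\mathscr{PT}(F)$. Lipschitz metric. For $\Gamma,\Gamma'\in\mathscr{T}(F)$, $\mathrm{Lip}(\Gamma,\Gamma')$ is the infimum of the Lipschitz constants $\mathrm{Lip}(f)$ over all $F$-equivariant Lipschitz maps $f\colon\Gamma\to\Gamma'$. The (asymmetric) Lipschitz metric on $\mathscr{PT}(F)$ is $d(\Gamma,\Gamma')=\log\mathrm{Lip}(\Gamma,\Gamma')$. Optimal maps. An $F$-equivariant map $f\colon\Gamma\to\Gamma'$ is piecewise linear if on each edge it is constant or linear of constant slope. Its tension forest $\Delta(f)$ is the union of the closed edges on which $f$ attains its maximal slope. A direction at a point $x$ is a germ of geodesics starting at $x$. Declare two directions of $\Delta(f)$ at the same point equivalent if $f$ sends them to the same direction of $\Gamma'$; the equivalence classes are called gates. The map $f$ is optimal if $\mathrm{Lip}(f)=\mathrm{Lip}(\Gamma,\Gamma')$ and there are at least two gates at every point of $\Delta(f)$ (i.e. the equivalence relation is a train track structure on $\Delta(f)$). An optimal map is a folding map if $\Delta(f)=\Gamma$. Folding paths. Let $\Gamma,\Gamma'\in\mathscr{PT}(F)$ and let $f\colon\Gamma\to\Gamma'$ be a folding map. Rescale the metric on $\Gamma'$ so that $f$ has slope $1$ on every edge. "Folding all illegal turns at speed $1$" produces the family of trees $\Gamma_t$, $t\ge 0$, where $\Gamma_t$ is the quotient of $\Gamma$ by the relation $x\sim_t y$ iff $f(x)=f(y)$ and $f([x,y])$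 is contained in the closed ball of radius $t$ about $f(x)$, with the quotient length metric and induced $F$-action. Thus $\Gamma_0=\Gamma$, $\Gamma_t$ is the rescaled $\Gamma'$ for $t$ large, and there are induced folding maps $f_{st}\colon\Gamma_s\to\Gamma_t$ for $s\le t$ with $f_{ss}=\mathrm{Id}$, $f_{rt}=f_{st}f_{rs}$, and $f_{0t}=f$ for $t$ large. Rescaling each $\Gamma_t$ to have volume $1$ gives a path in $\mathscr{PT}(F)$ from $\Gamma$ to $\Gamma'$ which, after reparametrization by arc length, is a path $[0,d(\Gamma,\Gamma')]\to\mathscr{PT}(F)$, $t\mapsto\Gamma_t$, with $d(\Gamma_s,\Gamma_t)=t-s$ for $s\le t$. Such a path is called a folding path in $\mathscr{PT}(F)$. All of these definitions apply equally to $H$. *)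

theory Defs
  imports "HOL-Analysis.Analysis" "HOL-Algebra.Generated_Groups" "HOL-Algebra.Group_Action"
begin

section \<open>Virtually free groups\<close>

definition finitely_generated_group :: "('g, 'b) monoid_scheme \<Rightarrow> bool" where
  "finitely_generated_group G \<longleftrightarrow>
     (\<exists>S. finite S \<and> S \<subseteq> carrier G \<and> generate G S = carrier G)"

text \<open>Words in a generating set and its formal inverses: the letter \<open>(x, True)\<close> stands for
  \<open>x\<close>, the letter \<open>(x, False)\<close> for its inverse.\<close>

definition reduced_words :: "'g set \<Rightarrow> ('g \<times> bool) list set" where
  "reduced_words X =
     {w \<in> lists (X \<times> UNIV). successively (\<lambda>(x, a) (y, b). x \<noteq> y \<or> a = b) w}"

definition word_eval :: "('g, 'b) monoid_scheme \<Rightarrow> ('g \<times> bool) list \<Rightarrow> 'g" where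
  "word_eval G w = foldr (\<lambda>(x, a) g. (if a then x else inv\<^bsub>G\<^esub> x) \<otimes>\<^bsub>G\<^esub> g) w \<one>\<^bsub>G\<^esub>"

definition free_basis :: "('g, 'b) monoid_scheme \<Rightarrow> 'g set \<Rightarrow> bool" where
  "free_basis G X \<longleftrightarrow>
     X \<subseteq> carrier G \<and> bij_betw (word_eval G) (reduced_words X) (carrier G)"

definition virtually_nonabelian_free :: "('g, 'b) monoid_scheme \<Rightarrow> bool" where
  "virtually_nonabelian_free G \<longleftrightarrow>
     (\<exists>K. subgroup K G \<and> finite (rcosets\<^bsub>G\<^esub> K) \<and>
          (\<exists>X. free_basis (G\<lparr>carrier := K\<rparr>) X) \<and> \<not> comm_group (G\<lparr>carrier := K\<rparr>))"


section \<open>Simplicial real trees\<close>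

definition geodesic_segment :: "'a metric \<Rightarrow> 'a set \<Rightarrow> 'a \<Rightarrow> 'a \<Rightarrow> bool" where
  "geodesic_segment m S x y \<longleftrightarrow>
     (\<exists>c. c 0 = x \<and> c (mdist m x y) = y \<and> S = c ` {0..mdist m x y} \<and> S \<subseteq> mspace m \<and>
          (\<forall>s\<in>{0..mdist m x y}. \<forall>t\<in>{0..mdist m x y}. mdist m (c s) (c t) = \<bar>s - t\<bar>))"

definition real_tree :: "'a metric \<Rightarrow> bool" where
  "real_tree m \<longleftrightarrow>
     (\<forall>x\<in>mspace m. \<forall>y\<in>mspace m. \<exists>!S. geodesic_segment m S x y) \<and>
     (\<forall>x y z S S'. geodesic_segment m S y x \<longrightarrow> geodesic_segment m S' x z \<longrightarrow> S \<inter> S' = {x}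
        \<longrightarrow> x \<in> mspace m \<longrightarrow> y \<in> mspace m \<longrightarrow> z \<in> mspace m
        \<longrightarrow> geodesic_segment m (S \<union> S') y z)"

text \<open>In a real tree \<open>seg m x y\<close> is the unique geodesic segment from \<open>x\<close> to \<open>y\<close>.\<close>

definition seg :: "'a metric \<Rightarrow> 'a \<Rightarrow> 'a \<Rightarrow> 'a set" where
  "seg m x y = {z \<in> mspace m. mdist m x z + mdist m z y = mdist m x y}"

definition edges :: "'a metric \<Rightarrow> 'a set \<Rightarrow> 'a set set" where
  "edges m V = {seg m u v | u v. u \<in> V \<and> v \<in> V \<and> u \<noteq> v \<and> seg m u v \<inter> V = {u, v}}"

text \<open>\<open>V\<close> is the vertex set of a structure of metric simplicial tree on \<open>m\<close>. Finiteness on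
  segments says that the distance is the path metric of the resulting graph.\<close>

definition simplicial_structure :: "'a metric \<Rightarrow> 'a set \<Rightarrow> bool" where
  "simplicial_structure m V \<longleftrightarrow>
     V \<subseteq> mspace m \<and>
     mspace m = V \<union> \<Union> (edges m V) \<and>
     (\<forall>e\<in>edges m V. \<forall>e'\<in>edges m V. e \<noteq> e' \<longrightarrow> e \<inter> e' \<subseteq> V) \<and>
     (\<forall>x\<in>mspace m. \<forall>y\<in>mspace m. finite (V \<inter> seg m x y))"

definition simplicial_tree :: "'a metric \<Rightarrow> bool" where
  "simplicial_tree m \<longleftrightarrow>
     mspace m \<noteq> {} \<and> real_tree m \<and> (\<exists>V. simplicial_structure m V)"


section \<open>Trees with a group action\<close>

text \<open>Only the values of \<open>act\<close> on the carrier of the acting group are relevant, so a \<open>G\<close>-tree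
  is also an \<open>H\<close>-tree, without any change, for each subgroup \<open>H\<close>.\<close>

record ('g, 'a) gtree =
  metr :: "'a metric"
  act :: "'g \<Rightarrow> 'a \<Rightarrow> 'a"

abbreviation points :: "('g, 'a) gtree \<Rightarrow> 'a set" where
  "points T \<equiv> mspace (metr T)"

definition isometric_action :: "('g, 'b) monoid_scheme \<Rightarrow> ('g, 'a) gtree \<Rightarrow> bool" where
  "isometric_action G T \<longleftrightarrow>
     group_action G (points T) (act T) \<and>
     (\<forall>g\<in>carrier G. \<forall>x\<in>points T. \<forall>y\<in>points T.
        mdist (metr T) (act T g x) (act T g y) = mdist (metr T) x y)"

definition minimal_action :: "('g, 'b) monoid_scheme \<Rightarrow> ('g, 'a) gtree \<Rightarrow> bool" where
  "minimal_action G T \<longleftrightarrow>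
     (\<forall>S. S \<subseteq> points T \<and> S \<noteq> {} \<and>
          (\<forall>x\<in>S. \<forall>y\<in>S. seg (metr T) x y \<subseteq> S) \<and>
          (\<forall>g\<in>carrier G. act T g ` S \<subseteq> S) \<longrightarrow> S = points T)"

definition outer_tree :: "('g, 'b) monoid_scheme \<Rightarrow> ('g, 'a) gtree \<Rightarrow> bool" where
  "outer_tree G T \<longleftrightarrow>
     simplicial_tree (metr T) \<and> isometric_action G T \<and> minimal_action G T \<and>
     (\<forall>x\<in>points T. finite (stabilizer G (act T) x))"

definition equivariant ::
    "('g, 'b) monoid_scheme \<Rightarrow> ('g, 'a) gtree \<Rightarrow> ('g, 'c) gtree \<Rightarrow> ('a \<Rightarrow> 'c) \<Rightarrow> bool" where
  "equivariant G T T' f \<longleftrightarrow>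
     f \<in> points T \<rightarrow> points T' \<and>
     (\<forall>g\<in>carrier G. \<forall>x\<in>points T. f (act T g x) = act T' g (f x))"

definition equivariantly_isometric ::
    "('g, 'b) monoid_scheme \<Rightarrow> ('g, 'a) gtree \<Rightarrow> ('g, 'c) gtree \<Rightarrow> bool" where
  "equivariantly_isometric G T T' \<longleftrightarrow>
     (\<exists>h. equivariant G T T' h \<and> bij_betw h (points T) (points T') \<and>
          (\<forall>x\<in>points T. \<forall>y\<in>points T. mdist (metr T') (h x) (h y) = mdist (metr T) x y))"

definition gscale :: "real \<Rightarrow> ('g, 'a) gtree \<Rightarrow> ('g, 'a) gtree" where
  "gscale c T = T\<lparr>metr := metric (points T, \<lambda>x y. c * mdist (metr T) x y)\<rparr>"


section \<open>Volume and Outer Space\<close>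

text \<open>An invariant simplicial structure, subdivided so that no edge is inverted.\<close>

definition invariant_structure ::
    "('g, 'b) monoid_scheme \<Rightarrow> ('g, 'a) gtree \<Rightarrow> 'a set \<Rightarrow> bool" where
  "invariant_structure G T V \<longleftrightarrow>
     simplicial_structure (metr T) V \<and>
     (\<forall>g\<in>carrier G. act T g ` V = V) \<and>
     \<not> (\<exists>g\<in>carrier G. \<exists>u\<in>V. \<exists>v\<in>V. u \<noteq> v \<and> seg (metr T) u v \<in> edges (metr T) V \<and>
          act T g u = v \<and> act T g v = u)"

definition edge_length :: "'a metric \<Rightarrow> 'a set \<Rightarrow> real" where
  "edge_length m e = Sup {mdist m x y | x y. x \<in> e \<and> y \<in> e}"

definition structure_volume ::
    "('g, 'b) monoid_scheme \<Rightarrow> ('g, 'a) gtree \<Rightarrow> 'a set \<Rightarrow> real" where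
  "structure_volume G T V =
     (\<Sum>E\<in>orbits G (edges (metr T) V) (\<lambda>g e. act T g ` e).
        let e = (SOME e. e \<in> E)
        in edge_length (metr T) e / real (card (stabilizer G (\<lambda>g e. act T g ` e) e)))"

text \<open>The value does not depend on the choice of the invariant structure.\<close>

definition vol :: "('g, 'b) monoid_scheme \<Rightarrow> ('g, 'a) gtree \<Rightarrow> real" where
  "vol G T = structure_volume G T (SOME V. invariant_structure G T V)"

definition unit_trees :: "('g, 'b) monoid_scheme \<Rightarrow> ('g, 'a) gtree set" where
  "unit_trees G = {T. outer_tree G T \<and> vol G T = 1}"

definition isometry_rel ::
    "('g, 'b) monoid_scheme \<Rightarrow> (('g, 'a) gtree \<times> ('g, 'a) gtree) set" where
  "isometry_rel G =
     {(T, T'). T \<in> unit_trees G \<and> T' \<in> unit_trees G \<and> equivariantly_isometric G T T'}"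

definition outer_space :: "('g, 'b) monoid_scheme \<Rightarrow> ('g, 'a) gtree set set" where
  "outer_space G = unit_trees G // isometry_rel G"


section \<open>The Lipschitz metric\<close>

definition lip_const :: "'a metric \<Rightarrow> 'c metric \<Rightarrow> ('a \<Rightarrow> 'c) \<Rightarrow> real" where
  "lip_const m m' f =
     Inf {L. 0 \<le> L \<and> (\<forall>x\<in>mspace m. \<forall>y\<in>mspace m. mdist m' (f x) (f y) \<le> L * mdist m x y)}"

definition Lip ::
    "('g, 'b) monoid_scheme \<Rightarrow> ('g, 'a) gtree \<Rightarrow> ('g, 'c) gtree \<Rightarrow> real" where
  "Lip G T T' =
     Inf {lip_const (metr T) (metr T') f | f.
            equivariant G T T' f \<and> Lipschitz_continuous_map (metr T) (metr T') f}"

text \<open>The common value over all representatives of the two isometry classes.\<close>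

definition outer_dist ::
    "('g, 'b) monoid_scheme \<Rightarrow> ('g, 'a) gtree set \<Rightarrow> ('g, 'a) gtree set \<Rightarrow> real" where
  "outer_dist G X Y = (THE r. \<exists>T\<in>X. \<exists>T'\<in>Y. r = ln (Lip G T T'))"


section \<open>Optimal maps and folding maps\<close>

definition piecewise_linear :: "'a metric \<Rightarrow> 'a set \<Rightarrow> 'c metric \<Rightarrow> ('a \<Rightarrow> 'c) \<Rightarrow> bool" where
  "piecewise_linear m V m' f \<longleftrightarrow>
     (\<forall>e\<in>edges m V. \<exists>r\<ge>0. \<forall>x\<in>e. \<forall>y\<in>e. mdist m' (f x) (f y) = r * mdist m x y)"

definition slope :: "'a metric \<Rightarrow> 'c metric \<Rightarrow> ('a \<Rightarrow> 'c) \<Rightarrow> 'a set \<Rightarrow> real" where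
  "slope m m' f e = (THE r. \<forall>x\<in>e. \<forall>y\<in>e. mdist m' (f x) (f y) = r * mdist m x y)"

definition tension_forest :: "'a metric \<Rightarrow> 'a set \<Rightarrow> 'c metric \<Rightarrow> ('a \<Rightarrow> 'c) \<Rightarrow> 'a set" where
  "tension_forest m V m' f =
     \<Union> {e \<in> edges m V. \<forall>e'\<in>edges m V. slope m m' f e' \<le> slope m m' f e}"

text \<open>A direction at \<open>x\<close> is encoded as the set of endpoints of the nondegenerate geodesics
  starting at \<open>x\<close> that represent the germ.\<close>

definition direction :: "'a metric \<Rightarrow> 'a \<Rightarrow> 'a \<Rightarrow> 'a set" where
  "direction m x y = {z \<in> mspace m - {x}. seg m x y \<inter> seg m x z \<noteq> {x}}"

definition directions_in :: "'a metric \<Rightarrow> 'a set \<Rightarrow> 'a \<Rightarrow> 'a set set" where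
  "directions_in m D x = {direction m x y | y. y \<in> mspace m - {x} \<and> seg m x y \<subseteq> D}"

definition sends_direction ::
    "'a metric \<Rightarrow> 'c metric \<Rightarrow> ('a \<Rightarrow> 'c) \<Rightarrow> 'a \<Rightarrow> 'a set \<Rightarrow> 'c set \<Rightarrow> bool" where
  "sends_direction m m' f x d d' \<longleftrightarrow>
     d' \<in> directions_in m' (mspace m') (f x) \<and> (\<exists>y\<in>d. \<forall>w\<in>seg m x y - {x}. f w \<in> d')"

definition gates ::
    "'a metric \<Rightarrow> 'a set \<Rightarrow> 'c metric \<Rightarrow> ('a \<Rightarrow> 'c) \<Rightarrow> 'a \<Rightarrow> 'a set set set" where
  "gates m D m' f x =
     directions_in m D x //
       {(d1, d2). d1 \<in> directions_in m D x \<and> d2 \<in> directions_in m D x \<and>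
          (\<exists>d'. sends_direction m m' f x d1 d' \<and> sends_direction m m' f x d2 d')}"

definition optimal_map ::
    "('g, 'b) monoid_scheme \<Rightarrow> ('g, 'a) gtree \<Rightarrow> 'a set \<Rightarrow> ('g, 'c) gtree \<Rightarrow> ('a \<Rightarrow> 'c) \<Rightarrow> bool"
  where
  "optimal_map G T V T' f \<longleftrightarrow>
     invariant_structure G T V \<and> equivariant G T T' f \<and>
     piecewise_linear (metr T) V (metr T') f \<and>
     Lipschitz_continuous_map (metr T) (metr T') f \<and>
     lip_const (metr T) (metr T') f = Lip G T T' \<and>
     (let D = tension_forest (metr T) V (metr T') f
      in \<forall>x\<in>D. \<exists>A\<in>gates (metr T) D (metr T') f x. \<exists>B\<in>gates (metr T) D (metr T') f x. A \<noteq> B)"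

text \<open>The choice of \<open>V\<close> is immaterial: at a point that is not a branch point, two gates force
  the map to be locally injective, so it has constant slope across points of valence two.\<close>

definition folding_map ::
    "('g, 'b) monoid_scheme \<Rightarrow> ('g, 'a) gtree \<Rightarrow> ('g, 'c) gtree \<Rightarrow> ('a \<Rightarrow> 'c) \<Rightarrow> bool" where
  "folding_map G T T' f \<longleftrightarrow>
     (\<exists>V. optimal_map G T V T' f \<and> tension_forest (metr T) V (metr T') f = points T)"


section \<open>Folding paths\<close>

definition fold_rel :: "'a metric \<Rightarrow> 'c metric \<Rightarrow> ('a \<Rightarrow> 'c) \<Rightarrow> real \<Rightarrow> ('a \<times> 'a) set" where
  "fold_rel m m' f t =
     {(x, y). x \<in> mspace m \<and> y \<in> mspace m \<and> f x = f y \<and> f ` seg m x y \<subseteq> mcball_of m' (f x) t}"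

text \<open>The quotient metric, as an infimum over chains in which consecutive segments are joined by
  identified points; for a quotient of a tree this is the quotient length metric. The value
  outside the quotient set is irrelevant.\<close>

definition quotient_dist :: "'a metric \<Rightarrow> ('a \<times> 'a) set \<Rightarrow> 'a set \<Rightarrow> 'a set \<Rightarrow> real" where
  "quotient_dist m R A B =
     (if A \<in> mspace m // R \<and> B \<in> mspace m // R
      then Inf {sum_list (map (\<lambda>(p, q). mdist m p q) ps) | ps.
                  ps \<noteq> [] \<and> set ps \<subseteq> mspace m \<times> mspace m \<and>
                  fst (hd ps) \<in> A \<and> snd (last ps) \<in> B \<and>
                  successively (\<lambda>(p, q) (p', q'). (q, p') \<in> R) ps}
      else 0)"

definition quotient_tree :: "('g, 'a) gtree \<Rightarrow> ('a \<times> 'a) set \<Rightarrow> ('g, 'a set) gtree" where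
  "quotient_tree T R =
     \<lparr>metr = metric (points T // R, quotient_dist (metr T) R),
      act = (\<lambda>g. \<lambda>C \<in> points T // R. act T g ` C)\<rparr>"

text \<open>The target is rescaled by the reciprocal of the constant slope of the folding map \<open>f\<close>,
  which is its Lipschitz constant.\<close>

definition fold_tree ::
    "('g, 'a) gtree \<Rightarrow> ('g, 'c) gtree \<Rightarrow> ('a \<Rightarrow> 'c) \<Rightarrow> real \<Rightarrow> ('g, 'a set) gtree" where
  "fold_tree T T' f t =
     (let T'' = gscale (1 / lip_const (metr T) (metr T') f) T'
      in quotient_tree T (fold_rel (metr T) (metr T'') f t))"

text \<open>\<open>\<gamma>\<close> on \<open>[0, L]\<close> is the reparametrization by arc length of the path of folded trees rescaled
  to volume one; \<open>u t\<close> is the arc length parameter of the tree folded up to time \<open>t\<close>. Since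
  \<open>\<gamma> (u t)\<close> consists of trees of volume one, \<open>c\<close> is the rescaling factor that normalizes the
  volume.\<close>

definition folding_path ::
    "('g, 'b) monoid_scheme \<Rightarrow> real \<Rightarrow> (real \<Rightarrow> ('g, 'a) gtree set) \<Rightarrow> bool" where
  "folding_path G L \<gamma> \<longleftrightarrow>
     (\<exists>T\<in>unit_trees G. \<exists>T'\<in>unit_trees G. \<exists>f u.
        folding_map G T T' f \<and>
        L = outer_dist G (isometry_rel G `` {T}) (isometry_rel G `` {T'}) \<and>
        \<gamma> \<in> {0..L} \<rightarrow> outer_space G \<and>
        \<gamma> 0 = isometry_rel G `` {T} \<and> \<gamma> L = isometry_rel G `` {T'} \<and>
        mono_on {0..} u \<and> u ` {0..} = {0..L} \<and>
        (\<forall>t\<ge>0. \<exists>c>0. \<forall>S\<in>\<gamma> (u t). equivariantly_isometric G S (gscale c (fold_tree T T' f t))) \<and>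
        (\<forall>s t. 0 \<le> s \<and> s \<le> t \<and> t \<le> L \<longrightarrow> outer_dist G (\<gamma> s) (\<gamma> t) = t - s))"


section \<open>Restriction to a subgroup of finite index\<close>

definition restrict_class ::
    "('g, 'b) monoid_scheme \<Rightarrow> 'g set \<Rightarrow> nat \<Rightarrow> ('g, 'a) gtree set \<Rightarrow> ('g, 'a) gtree set" where
  "restrict_class G H n X = isometry_rel (G\<lparr>carrier := H\<rparr>) `` (gscale (1 / real n) ` X)"

end

theory Submission
  imports Defs
begin

text \<open>An \<open>H\<close>-equivariant Lipschitz map \<open>f\<close> can be averaged over the cosets of \<open>H\<close>: replacing \<open>f x\<close> by
  the center of the finite set of all \<open>g\<^sup>-\<^sup>1 f (g x)\<close> gives an \<open>F\<close>-equivariant map, and the Lipschitz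
  constant does not grow because in a tree the center of a finite set is a 1-Lipschitz function of
  that set for the Hausdorff distance. So the infima that define the two Lipschitz distances agree.
  The restricted action remains minimal since an \<open>H\<close>-invariant subtree is coarsely dense, while
  every point of an unbounded minimal \<open>F\<close>-tree lies deep inside arbitrarily long segments. The
  volume is multiplied by the index by counting cosets orbit by orbit; it is independent of the
  invariant simplicial structure because any two have their union as common refinement. Scaling a
  tree by \<open>1/n\<close> scales its folded trees, so folding paths only have their time parameter changed.\<close>

section \<open>Geometry of real trees\<close>

text \<open>\<open>vol\<close> evaluates a structure picked by \<open>SOME\<close>, while a tree of
  \<open>outer_space\<close> is only assumed to carry some simplicial structure, perhaps not an
  invariant one; an invariant one has to be built. The canonical candidate is the set of branch
  points: it lies in every vertex set, so it is locally finite, and by minimality its segments cover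
  the tree unless it is empty. It is empty only if the tree embeds in the line. This is where the
  algebra enters: with finite stabilizers, a group acting on a line with more than one point has
  only finitely many commutators of squares. Midpoints of adjacent branch points are added because
  of inversions. A second obstacle is that \<open>metric\<close> is an abstract type: a folded tree
  can be rescaled by computation only after its quotient distance has been shown to be a metric. The
  tool used throughout is \<open>seg_through\<close>: a segment is covered by the segments joining
  its ends to any third point.\<close>

locale rtree =
  fixes m :: "'a metric"
  assumes real_tree: "real_tree m"
begin

abbreviation "M \<equiv> mspace m"
abbreviation "d \<equiv> mdist m"

lemma seg_le:
  assumes "z \<in> seg m x y" shows "d x z \<le> d x y" "d z y \<le> d x y"
proof -
  have "d x z + d z y = d x y" "0 \<le> d z y" "0 \<le> d x z" using assms by (auto simp: seg_def)
  then show "d x z \<le> d x y" "d z y \<le> d x y" by linarith+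
qed

text \<open>\<open>seg\<close> is the metric interval, defined without geodesics, and has to be
  matched with the unique geodesic. A point z of the interval lies on it because the geodesics from
  x to z and from z to y meet only in z, so the second axiom of \<open>real_tree\<close> joins them
  to a geodesic from x to y.\<close>

lemma seg_geodesic_param:
  assumes "x \<in> M" "y \<in> M"
  obtains c where "c 0 = x" "c (d x y) = y" "\<And>s. s \<in> {0..d x y} \<Longrightarrow> c s \<in> M"
    "\<And>s t. s \<in> {0..d x y} \<Longrightarrow> t \<in> {0..d x y} \<Longrightarrow> d (c s) (c t) = \<bar>s - t\<bar>"
    "seg m x y = c ` {0..d x y}"
proof -
  have ex: "\<exists>!S. geodesic_segment m S x y" if "x \<in> M" "y \<in> M" for x y
    using real_tree that by (auto simp: real_tree_def)
  obtain S where S: "geodesic_segment m S x y" using ex assms by blast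
  obtain c where c: "c 0 = x" "c (d x y) = y" "S = c ` {0..d x y}" "S \<subseteq> M"
     "\<forall>s\<in>{0..d x y}. \<forall>t\<in>{0..d x y}. d (c s) (c t) = \<bar>s - t\<bar>"
    using S unfolding geodesic_segment_def by blast
  have dist: "d a q + d q b = d a b" "q \<in> M" if g: "geodesic_segment m Q a b" "q \<in> Q" for Q a b q
  proof -
    obtain k where k: "k 0 = a" "k (d a b) = b" "Q = k ` {0..d a b}" "Q \<subseteq> M"
      "\<forall>s\<in>{0..d a b}. \<forall>t\<in>{0..d a b}. d (k s) (k t) = \<bar>s - t\<bar>"
      using g(1) unfolding geodesic_segment_def by (elim exE conjE)
    obtain s where s: "s \<in> {0..d a b}" "q = k s" using g(2) k(3) by blast
    have "d (k 0) (k s) = s" "d (k s) (k (d a b)) = d a b - s" using k(5) s by auto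
    then show "d a q + d q b = d a b" using k(1,2) s by simp
    show "q \<in> M" using g(2) k(4) by blast
  qed
  have ends: "a \<in> Q" "b \<in> Q" if "geodesic_segment m Q a b" for Q a b
    using that mdist_nonneg[of m a b] unfolding geodesic_segment_def
    by (metis atLeastAtMost_iff imageI order_refl)+
  have 1: "S \<subseteq> seg m x y" using dist[OF S] by (auto simp: seg_def)
  have 2: "z \<in> S" if z: "z \<in> seg m x y" for z
  proof -
    have zM: "z \<in> M" and zd: "d x z + d z y = d x y" using z by (auto simp: seg_def)
    obtain S1 where S1: "geodesic_segment m S1 x z" using ex assms zM by blast
    obtain S2 where S2: "geodesic_segment m S2 z y" using ex assms zM by blast
    have z1: "z \<in> S1" and z2: "z \<in> S2" using ends S1 S2 by blast+
    have "q = z" if q: "q \<in> S1" "q \<in> S2" for q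
    proof -
      note q1 = dist[OF S1 q(1)] and q2 = dist[OF S2 q(2)]
      \<comment> \<open>A common point q would be passed before z and again after it, a detour of
        twice d q z on a path whose length is only d x y.\<close>
      have "d q z + d z q \<le> 0"
        using q1(1) q2(1) zd mdist_triangle[OF assms(1) q1(2) assms(2)] by linarith
      then have "d q z = 0" using mdist_nonneg[of m q z] mdist_nonneg[of m z q] by linarith
      then show ?thesis using q1(2) zM by simp
    qed
    then have "S1 \<inter> S2 = {z}" using z1 z2 by blast
    then have "geodesic_segment m (S1 \<union> S2) x y"
      using real_tree S1 S2 zM assms unfolding real_tree_def by blast
    then have "S = S1 \<union> S2" using S ex[OF assms] by blast
    then show ?thesis using z1 by blast
  qed
  have "seg m x y = S" using 1 2 by blast
  moreover have "c s \<in> M" if "s \<in> {0..d x y}" for s using c(3,4) that by blast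
  ultimately show thesis using that[of c] c by presburger
qed

lemma geodesic_segment_seg: "x \<in> M \<Longrightarrow> y \<in> M \<Longrightarrow> geodesic_segment m (seg m x y) x y"
  by (rule seg_geodesic_param[of x y]) (auto simp: geodesic_segment_def)

lemma geodesic_segment_eq:
  assumes "x \<in> M" "y \<in> M" "geodesic_segment m S x y" shows "S = seg m x y"
  using real_tree geodesic_segment_seg[OF assms(1,2)] assms by (auto simp: real_tree_def)

lemma seg_point:
  assumes "x \<in> M" "y \<in> M" "0 \<le> t" "t \<le> d x y"
  obtains z where "z \<in> seg m x y" "d x z = t" "d z y = d x y - t"
proof -
  obtain c where c: "c 0 = x" "c (d x y) = y"
    "\<And>s t. s \<in> {0..d x y} \<Longrightarrow> t \<in> {0..d x y} \<Longrightarrow> d (c s) (c t) = \<bar>s - t\<bar>"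
    "seg m x y = c ` {0..d x y}"
    using seg_geodesic_param[OF assms(1,2)] by metis
  show thesis using that[of "c t"] c c(3)[of 0 t] c(3)[of t "d x y"] assms by auto
qed

lemma seg_dist:
  assumes "x \<in> M" "y \<in> M" "z \<in> seg m x y" "w \<in> seg m x y"
  shows "d z w = \<bar>d x z - d x w\<bar>"
proof -
  obtain c where c: "c 0 = x" "c (d x y) = y"
    "\<And>s t. s \<in> {0..d x y} \<Longrightarrow> t \<in> {0..d x y} \<Longrightarrow> d (c s) (c t) = \<bar>s - t\<bar>"
    "seg m x y = c ` {0..d x y}"
    using seg_geodesic_param[OF assms(1,2)] by metis
  obtain s t where "z = c s" "w = c t" "s \<in> {0..d x y}" "t \<in> {0..d x y}" using c assms by blast
  then show ?thesis using c(3)[of s t] c(3)[of 0 s] c(3)[of 0 t] c(1) by auto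
qed

lemma seg_subset: "seg m x y \<subseteq> M" by (auto simp: seg_def)

lemma seg_commute: "seg m x y = seg m y x"
  by (auto simp: seg_def mdist_commute add.commute)

text \<open>The geodesics from x to y and to z run together up to a last time \<open>t0\<close>, and
  p is the point at which they part. The two remaining pieces meet only in p, so they join to the
  geodesic from y to z.\<close>

lemma median_exists:
  assumes x: "x \<in> M" and y: "y \<in> M" and z: "z \<in> M"
  obtains p where "p \<in> seg m x y" "p \<in> seg m x z" "p \<in> seg m y z"
proof -
  obtain c1 where c1: "c1 0 = x" "c1 (d x y) = y" "\<And>s. s \<in> {0..d x y} \<Longrightarrow> c1 s \<in> M"
    "\<And>s t. s \<in> {0..d x y} \<Longrightarrow> t \<in> {0..d x y} \<Longrightarrow> d (c1 s) (c1 t) = \<bar>s - t\<bar>"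
    "seg m x y = c1 ` {0..d x y}"
    using seg_geodesic_param[OF x y] by metis
  obtain c2 where c2: "c2 0 = x" "c2 (d x z) = z" "\<And>s. s \<in> {0..d x z} \<Longrightarrow> c2 s \<in> M"
    "\<And>s t. s \<in> {0..d x z} \<Longrightarrow> t \<in> {0..d x z} \<Longrightarrow> d (c2 s) (c2 t) = \<bar>s - t\<bar>"
    "seg m x z = c2 ` {0..d x z}"
    using seg_geodesic_param[OF x z] by metis
  define T where "T = {t. 0 \<le> t \<and> t \<le> d x y \<and> t \<le> d x z \<and> c1 t = c2 t}"
  define t0 where "t0 = Sup T"
  have T0: "0 \<in> T" using c1 c2 by (simp add: T_def)
  have bdd: "bdd_above T" by (rule bdd_aboveI[of _ "d x y"]) (auto simp: T_def)
  have t0: "0 \<le> t0" "t0 \<le> d x y" "t0 \<le> d x z"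
    using T0 bdd cSup_upper[of 0 T] cSup_least[of T] unfolding t0_def T_def by fastforce+
  \<comment> \<open>The supremum is attained: both geodesics move at unit speed, so agreement at
    times arbitrarily close to \<open>t0\<close> forces agreement at \<open>t0\<close>.\<close>
  have "d (c1 t0) (c2 t0) \<le> e" if "e > 0" for e
  proof -
    obtain t where t: "t \<in> T" "t > t0 - e/2"
      using less_cSup_iff[of T "t0 - e/2"] T0 bdd \<open>e > 0\<close> unfolding t0_def by fastforce
    have "t \<le> t0" using t bdd cSup_upper unfolding t0_def by blast
    then have "d (c1 t0) (c1 t) = t0 - t" "d (c2 t) (c2 t0) = t0 - t"
      using c1(4)[of t0 t] c2(4)[of t t0] t0 t(1) by (auto simp: T_def)
    then show ?thesis using mdist_triangle[of "c1 t0" m "c1 t" "c2 t0"] c1(3)[of t0] c1(3)[of t] c2(3)[of t0] t0 t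
      by (auto simp: T_def)
  qed
  then have "d (c1 t0) (c2 t0) \<le> 0" by (metis field_le_epsilon add.left_neutral)
  then have eq: "c1 t0 = c2 t0" using mdist_nonneg[of m "c1 t0" "c2 t0"] mdist_zero[of "c1 t0" m "c2 t0"]
    c1(3)[of t0] c2(3)[of t0] t0 by auto
  define p where "p = c1 t0"
  have "p \<in> c1 ` {0..d x y}" using t0 by (simp add: p_def)
  moreover have "p \<in> c2 ` {0..d x z}" using t0 eq by (simp add: p_def)
  ultimately have p: "p \<in> seg m x y" "p \<in> seg m x z" using c1(5) c2(5) by auto
  have pM: "p \<in> M" using p seg_subset by blast
  have dxp: "d x p = t0" using c1(4)[of 0 t0] c1(1) t0 by (auto simp: p_def)
  have "seg m y p \<inter> seg m p z = {p}"
  proof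
    show "{p} \<subseteq> seg m y p \<inter> seg m p z" using pM by (auto simp: seg_def)
    show "seg m y p \<inter> seg m p z \<subseteq> {p}"
    proof
      fix q assume q: "q \<in> seg m y p \<inter> seg m p z"
      then have qM: "q \<in> M" by (auto simp: seg_def)
      have q1: "q \<in> seg m x y" "d x q = d x p + d p q"
        using q p mdist_triangle[of x m p q] mdist_triangle[of x m q y] x y pM qM
        by (auto simp: seg_def mdist_commute)
      have q2: "q \<in> seg m x z"
        using q p mdist_triangle[of x m p q] mdist_triangle[of x m q z] x z pM qM
        by (auto simp: seg_def mdist_commute)
      \<comment> \<open>A point of either geodesic is its value at the distance from x, so a common
        point beyond p would give a time of agreement later than \<open>t0\<close>.\<close>
      have "q = c1 (d x q)"
      proof -
        obtain s where "s \<in> {0..d x y}" "q = c1 s" using q1 c1(5) by blast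
        then show ?thesis using c1(4)[of 0 s] c1(1) by auto
      qed
      moreover have "q = c2 (d x q)"
      proof -
        obtain s where "s \<in> {0..d x z}" "q = c2 s" using q2 c2(5) by blast
        then show ?thesis using c2(4)[of 0 s] c2(1) by auto
      qed
      moreover have "d x q \<le> d x y" "d x q \<le> d x z"
        using seg_le(1) q1(1) q2 by blast+
      ultimately have "d x q \<in> T" by (simp add: T_def)
      then have "d x q \<le> t0" using bdd cSup_upper unfolding t0_def by blast
      then have "d p q = 0" using q1 dxp mdist_nonneg[of m p q] by linarith
      then show "q \<in> {p}" using pM qM by simp
    qed
  qed
  then have "geodesic_segment m (seg m y p \<union> seg m p z) y z"
    using real_tree geodesic_segment_seg[OF y pM] geodesic_segment_seg[OF pM z] pM y z
    unfolding real_tree_def by blast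
  then have "seg m y p \<union> seg m p z = seg m y z" using geodesic_segment_eq y z by blast
  moreover have "p \<in> seg m y p" using pM by (simp add: seg_def)
  ultimately have "p \<in> seg m y z" by blast
  with p show thesis using that by blast
qed

text \<open>A triangle is a tripod: z lies on the leg from the median to x or on the leg from the
  median to y, and that leg is part of the segment from w to the same end.\<close>

lemma seg_through:
  assumes x: "x \<in> M" and y: "y \<in> M" and w: "w \<in> M" and z: "z \<in> seg m x y"
  shows "z \<in> seg m x w \<or> z \<in> seg m w y"
proof -
  obtain p where p: "p \<in> seg m x y" "p \<in> seg m x w" "p \<in> seg m y w"
    using median_exists[OF x y w] .
  have M: "p \<in> M" "z \<in> M" using p z seg_subset by blast+
  have "d z p = \<bar>d x z - d x p\<bar>" using seg_dist[OF x y z p(1)] .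
  then show ?thesis
    using p z mdist_triangle[of z m p w] mdist_triangle[of x m z w] mdist_triangle[of w m z y]
      mdist_triangle[of w m p z] M x y w mdist_commute[of m]
    unfolding seg_def by (smt (verit) mem_Collect_eq)
qed

end

section \<open>Averaging equivariant maps\<close>

context rtree
begin

text \<open>The circumcenter, as the midpoint of a diametral pair. It is a relation because the pair
  is not unique; that the midpoint is unique follows from \<open>center_dist_le\<close> with equal
  sets and \<delta> = 0.\<close>

definition is_center :: "'a set \<Rightarrow> 'a \<Rightarrow> bool" where
  "is_center A c \<longleftrightarrow>
     (\<exists>a\<in>A. \<exists>b\<in>A. c \<in> seg m a b \<and> d a c = d c b \<and> (\<forall>x\<in>A. \<forall>y\<in>A. d x y \<le> d a b))"

lemma is_center_exists:
  assumes "finite A" "A \<noteq> {}" "A \<subseteq> M"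
  obtains c where "is_center A c"
proof -
  define D where "D = (\<lambda>(x, y). d x y) ` (A \<times> A)"
  have D: "finite D" "D \<noteq> {}" using assms by (auto simp: D_def)
  obtain a b where ab: "a \<in> A" "b \<in> A" "d a b = Max D"
    using Max_in[OF D] by (auto simp: D_def)
  have "\<forall>x\<in>A. \<forall>y\<in>A. d x y \<le> d a b"
  proof (intro ballI)
    fix x y assume "x \<in> A" "y \<in> A"
    then have "d x y \<in> D" unfolding D_def by force
    then show "d x y \<le> d a b" using D ab by simp
  qed
  moreover have "a \<in> M" "b \<in> M" "d a b / 2 \<le> d a b" "0 \<le> d a b / 2"
    using ab(1,2) assms mdist_nonneg[of m a b] by (auto simp del: mdist_nonneg)
  then obtain c where "c \<in> seg m a b" "d a c = d a b / 2" "d c b = d a b - d a b / 2"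
    using seg_point[of a b "d a b / 2"] by blast
  ultimately show thesis using that[of c] ab unfolding is_center_def by force
qed

text \<open>With r half the diameter of A, the largest distance from a point p to A is exactly r + d
  c p: a diametral segment runs through c, so one of its ends lies beyond c as seen from p.
  Comparing the farthest distances of A and B at p = c' and at p = c gives r + d c c' \<le> r' +
  \<delta> and the same with r and r' exchanged; in the sum r and r' cancel.\<close>

lemma center_dist_le:
  assumes A: "A \<subseteq> M" and B: "B \<subseteq> M" and c: "is_center A c" and c': "is_center B c'"
    and AB: "\<And>a. a \<in> A \<Longrightarrow> \<exists>b\<in>B. d a b \<le> \<delta>"
    and BA: "\<And>b. b \<in> B \<Longrightarrow> \<exists>a\<in>A. d a b \<le> \<delta>"
  shows "d c c' \<le> \<delta>"
proof -
  have radius: "\<exists>r. (\<forall>x\<in>A. d x c \<le> r) \<and> (\<forall>p\<in>M. \<exists>x\<in>A. d x p = r + d c p)"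
    if A: "A \<subseteq> M" and c: "is_center A c" for A c
  proof -
    obtain a b where ab: "a \<in> A" "b \<in> A" "c \<in> seg m a b" "d a c = d c b"
      "\<forall>x\<in>A. \<forall>y\<in>A. d x y \<le> d a b"
      using c unfolding is_center_def by blast
    have M: "a \<in> M" "b \<in> M" "c \<in> M" using ab A by (auto simp: seg_def)
    have h: "d a b = d a c + d c b" using ab by (simp add: seg_def)
    \<comment> \<open>One end of the diametral segment lies beyond c as seen from x. Its distance to
      x is at most the diameter, and half of the diameter is used up between c and that end.\<close>
    have "d x c \<le> d a c" if x: "x \<in> A" for x
    proof -
      have "c \<in> seg m a x \<or> c \<in> seg m x b" using seg_through M x A ab by blast
      moreover have "d a x \<le> d a b" "d x b \<le> d a b" using ab x by auto
      ultimately show ?thesis using h ab(4) mdist_commute[of m] by (auto simp: seg_def)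
    qed
    moreover have "\<exists>x\<in>A. d x p = d a c + d c p" if p: "p \<in> M" for p
    proof -
      have "c \<in> seg m a p \<or> c \<in> seg m p b" using seg_through M p ab by blast
      then show ?thesis
      proof
        assume "c \<in> seg m a p" then show ?thesis using ab by (force simp: seg_def)
      next
        assume "c \<in> seg m p b"
        then have "d b p = d a c + d c p"
          using ab(4) by (simp add: seg_def mdist_commute)
        then show ?thesis using ab by blast
      qed
    qed
    ultimately show ?thesis by blast
  qed
  obtain r where r: "\<forall>x\<in>A. d x c \<le> r" "\<forall>p\<in>M. \<exists>x\<in>A. d x p = r + d c p"
    using radius[OF A c] by blast
  obtain r' where r': "\<forall>x\<in>B. d x c' \<le> r'" "\<forall>p\<in>M. \<exists>x\<in>B. d x p = r' + d c' p"
    using radius[OF B c'] by blast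
  have M: "c \<in> M" "c' \<in> M" using c c' seg_subset unfolding is_center_def by blast+
  obtain a where a: "a \<in> A" "d a c' = r + d c c'" using r M by blast
  obtain b where b: "b \<in> B" "d a b \<le> \<delta>" using AB a by blast
  have 1: "r + d c c' \<le> \<delta> + r'"
    using mdist_triangle[of a m b c'] a b A B M r' by force
  obtain b' where b': "b' \<in> B" "d b' c = r' + d c' c" using r' M by blast
  obtain a' where a': "a' \<in> A" "d a' b' \<le> \<delta>" using BA b' by blast
  have "d b' c \<le> d b' a' + d a' c" using mdist_triangle[of b' m a' c] a' b' A B M by blast
  then have "r' + d c c' \<le> \<delta> + r"
    using b' a' r mdist_commute[of m] by (metis add_mono order_trans)
  with 1 show ?thesis by linarith
qed

end

lemma isometric_action_group: "isometric_action G T \<Longrightarrow> group G"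
  unfolding isometric_action_def group_action_def group_hom_def by blast

lemma isometric_action_restrict:
  assumes "isometric_action G T" "subgroup H G"
  shows "isometric_action (G\<lparr>carrier := H\<rparr>) T"
proof -
  interpret group_action G "points T" "act T" using assms by (simp add: isometric_action_def)
  interpret group_hom G "BijGroup (points T)" "act T" by (rule group_hom)
  have "group_hom (G\<lparr>carrier := H\<rparr>) (BijGroup (points T)) (act T)"
    using G.subgroup_imp_group[OF assms(2)] homh subgroup.subset[OF assms(2)]
    by (intro group_hom.intro group_hom_axioms.intro) (auto simp: hom_def Pi_iff subset_iff)
  then show ?thesis using assms subgroup.subset[OF assms(2)]
    by (auto simp: isometric_action_def group_action_def)
qed

locale tree_action = rtree "metr T" for T :: "('g, 'a) gtree" +
  fixes G :: "('g, 'b) monoid_scheme" (structure)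
  assumes isometric: "isometric_action G T"
begin

sublocale action: group_action G M "act T"
  using isometric by (simp add: isometric_action_def)

sublocale group G using isometric isometric_action_group by blast

lemma act_closed [simp]: "g \<in> carrier G \<Longrightarrow> x \<in> M \<Longrightarrow> act T g x \<in> M"
  by (rule action.element_image) auto

lemma act_dist [simp]:
  "g \<in> carrier G \<Longrightarrow> x \<in> M \<Longrightarrow> y \<in> M \<Longrightarrow> d (act T g x) (act T g y) = d x y"
  using isometric by (auto simp: isometric_action_def)

lemma act_mult: "g \<in> carrier G \<Longrightarrow> h \<in> carrier G \<Longrightarrow> x \<in> M \<Longrightarrow> act T (g \<otimes> h) x = act T g (act T h x)"
  by (rule action.composition_rule)

lemma act_one [simp]: "x \<in> M \<Longrightarrow> act T \<one> x = x"
  using action.id_eq_one by (metis restrict_apply')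

lemma act_inv [simp]: "g \<in> carrier G \<Longrightarrow> x \<in> M \<Longrightarrow> act T (inv g) (act T g x) = x"
  by (metis act_mult act_one inv_closed l_inv)

lemma act_inv' [simp]: "g \<in> carrier G \<Longrightarrow> x \<in> M \<Longrightarrow> act T g (act T (inv g) x) = x"
  by (metis act_mult act_one inv_closed r_inv)

lemma act_inj: "g \<in> carrier G \<Longrightarrow> x \<in> M \<Longrightarrow> y \<in> M \<Longrightarrow> act T g x = act T g y \<longleftrightarrow> x = y"
  by (metis act_inv)

lemma act_seg:
  assumes g: "g \<in> carrier G" and "x \<in> M" "y \<in> M"
  shows "act T g ` seg (metr T) x y = seg (metr T) (act T g x) (act T g y)"
proof
  show "act T g ` seg (metr T) x y \<subseteq> seg (metr T) (act T g x) (act T g y)"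
    using assms by (auto simp: seg_def)
  show "seg (metr T) (act T g x) (act T g y) \<subseteq> act T g ` seg (metr T) x y"
  proof
    fix z assume z: "z \<in> seg (metr T) (act T g x) (act T g y)"
    then have zM: "z \<in> M" by (auto simp: seg_def)
    define w where "w = act T (inv g) z"
    have w: "w \<in> M" "z = act T g w" using g zM by (auto simp: w_def)
    then have "w \<in> seg (metr T) x y" using z assms by (auto simp: seg_def)
    with w show "z \<in> act T g ` seg (metr T) x y" by blast
  qed
qed

end

lemma equivariant_average:
  fixes G :: "('g, 'b) monoid_scheme" (structure)
  assumes T: "tree_action T G" and T': "tree_action T' G"
    and H: "subgroup H G" "finite (rcosets H)"
    and f: "equivariant (G\<lparr>carrier := H\<rparr>) T T' f"
    and L: "\<And>x y. x \<in> points T \<Longrightarrow> y \<in> points T \<Longrightarrow>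
              mdist (metr T') (f x) (f y) \<le> L * mdist (metr T) x y"
  obtains f' where "equivariant G T T' f'"
    "\<And>x y. x \<in> points T \<Longrightarrow> y \<in> points T \<Longrightarrow>
       mdist (metr T') (f' x) (f' y) \<le> L * mdist (metr T) x y"
proof -
  interpret T: tree_action T G by fact
  interpret T': tree_action T' G by fact
  interpret H: subgroup H G by fact
  define a where "a x g = act T' (inv g) (f (act T g x))" for x g
  define A where "A x = a x ` carrier G" for x
  have fM: "f x \<in> T'.M" if "x \<in> T.M" for x using f that by (auto simp: equivariant_def)
  have fH: "f (act T h x) = act T' h (f x)" if "h \<in> H" "x \<in> T.M" for h x
    using f that by (auto simp: equivariant_def)
  have aM: "a x g \<in> T'.M" if "x \<in> T.M" "g \<in> carrier G" for x g
    using that fM by (simp add: a_def)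
  have AM: "A x \<subseteq> T'.M" "A x \<noteq> {}" if "x \<in> T.M" for x
    using that aM by (auto simp: A_def)
  \<comment> \<open>H-equivariance of f makes \<open>a x\<close> constant on each right coset of H;
    this is why only finitely many points are averaged.\<close>
  have coset: "a x (h \<otimes> g) = a x g" if "x \<in> T.M" "g \<in> carrier G" "h \<in> H" for x g h
  proof -
    have h: "h \<in> carrier G" using that H.subset by blast
    have "a x (h \<otimes> g) = act T' (inv g \<otimes> inv h) (act T' h (f (act T g x)))"
      using that h fH by (simp add: a_def T.act_mult T.inv_mult_group)
    also have "\<dots> = act T' (inv g) (f (act T g x))"
      using that h fM by (simp add: T'.act_mult)
    finally show ?thesis by (simp add: a_def)
  qed
  have fin: "finite (A x)" if x: "x \<in> T.M" for x
  proof -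
    have "A x = (\<Union>C\<in>rcosets H. a x ` C)"
      using T.rcosets_part_G[OF H(1)] unfolding A_def by blast
    moreover have "finite (a x ` C)" if C: "C \<in> rcosets H" for C
    proof -
      obtain g where g: "g \<in> carrier G" "C = H #> g" using C by (auto simp: RCOSETS_def)
      then have "a x ` C \<subseteq> {a x g}" using coset[OF x] by (auto simp: r_coset_def)
      then show ?thesis by (rule finite_subset) simp
    qed
    ultimately show ?thesis using H by simp
  qed
  define f' where "f' x = (SOME c. T'.is_center (A x) c)" for x
  have center: "T'.is_center (A x) (f' x)" if "x \<in> T.M" for x
    unfolding f'_def using T'.is_center_exists[OF fin AM(2) AM(1)] that by (metis someI)
  have f'M: "f' x \<in> T'.M" if "x \<in> T.M" for x
    using center[OF that] T'.seg_subset unfolding T'.is_center_def by blast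
  show thesis
  proof (rule that)
    fix x y assume xy: "x \<in> T.M" "y \<in> T.M"
    have le: "T'.d (a x g) (a y g) \<le> L * T.d x y" if "g \<in> carrier G" for g
      using that xy fM L[of "act T g x" "act T g y"] by (simp add: a_def)
    show "T'.d (f' x) (f' y) \<le> L * T.d x y"
      by (rule T'.center_dist_le[OF AM(1) AM(1) center center])
        (use xy le in \<open>auto simp: A_def\<close>)
  next
    have "f' (act T k x) = act T' k (f' x)" if k: "k \<in> carrier G" and x: "x \<in> T.M" for k x
    proof -
      have kx: "act T k x \<in> T.M" using k x by simp
      \<comment> \<open>Replacing x by its image under k moves the averaged set by k; the right
        translation by k merely permutes the indices.\<close>
      have 1: "a (act T k x) g = act T' k (a x (g \<otimes> k))" if g: "g \<in> carrier G" for g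
      proof -
        have "act T' k (a x (g \<otimes> k)) = act T' (k \<otimes> (inv k \<otimes> inv g)) (f (act T (g \<otimes> k) x))"
          using g k x fM by (simp add: a_def T.inv_mult_group T'.act_mult)
        also have "k \<otimes> (inv k \<otimes> inv g) = inv g"
          using g k by (metis T.inv_closed T.inv_solve_left' T.m_closed)
        finally show ?thesis using g k x by (simp add: a_def T.act_mult)
      qed
      have "(\<lambda>g. g \<otimes> k) ` carrier G = carrier G"
      proof
        show "(\<lambda>g. g \<otimes> k) ` carrier G \<subseteq> carrier G" using k by auto
        show "carrier G \<subseteq> (\<lambda>g. g \<otimes> k) ` carrier G"
        proof
          fix g assume "g \<in> carrier G"
          then have "g = (g \<otimes> inv k) \<otimes> k" "g \<otimes> inv k \<in> carrier G"
            using k by (simp_all add: T.m_assoc)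
          then show "g \<in> (\<lambda>g. g \<otimes> k) ` carrier G" by blast
        qed
      qed
      then have "A x = (\<lambda>g. a x (g \<otimes> k)) ` carrier G"
        unfolding A_def by (metis image_image)
      moreover have "A (act T k x) = (\<lambda>g. act T' k (a x (g \<otimes> k))) ` carrier G"
        unfolding A_def using 1 by (intro image_cong) auto
      ultimately have "A (act T k x) = act T' k ` A x" by (simp add: image_image)
      moreover have "T'.is_center (act T' k ` A x) (act T' k (f' x))"
      proof -
        obtain p q where pq: "p \<in> A x" "q \<in> A x" "f' x \<in> seg (metr T') p q"
          "T'.d p (f' x) = T'.d (f' x) q" "\<forall>u\<in>A x. \<forall>v\<in>A x. T'.d u v \<le> T'.d p q"
          using center[OF x] unfolding T'.is_center_def by blast
        have AxM: "u \<in> T'.M" if "u \<in> A x" for u using AM[OF x] that by blast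
        have "act T' k (f' x) \<in> seg (metr T') (act T' k p) (act T' k q)"
          using T'.act_seg[OF k, of p q] pq AxM by blast
        then show ?thesis unfolding T'.is_center_def
          using pq k AxM f'M[OF x] by (intro bexI[of _ "act T' k p"] bexI[of _ "act T' k q"]) auto
      qed
      \<comment> \<open>\<open>f'\<close> is picked by \<open>SOME\<close>, so its equivariance
        rests on the uniqueness of centers: both points are centers of one and the same set.\<close>
      ultimately have "T'.d (f' (act T k x)) (act T' k (f' x)) \<le> 0"
        using AM(1)[OF kx] center[OF kx]
        by (intro T'.center_dist_le[of "A (act T k x)" "A (act T k x)"])
          (metis mdist_zero order_refl subsetD)+
      then show ?thesis using f'M x k kx
        by (metis T'.act_closed mdist_nonneg mdist_zero order_antisym)
    qed
    then show "equivariant G T T' f'" using f'M by (auto simp: equivariant_def)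
  qed
qed

section \<open>Minimality under finite index subgroups\<close>

context rtree
begin

lemma mdist_self [simp]: "x \<in> M \<Longrightarrow> d x x = 0"
  by simp

lemma mdist_pos: "x \<in> M \<Longrightarrow> y \<in> M \<Longrightarrow> x \<noteq> y \<Longrightarrow> 0 < d x y"
  using mdist_zero[of x m y] mdist_nonneg[of m x y] by linarith

lemma seg_ends [simp]: "x \<in> M \<Longrightarrow> y \<in> M \<Longrightarrow> x \<in> seg m x y" "x \<in> M \<Longrightarrow> y \<in> M \<Longrightarrow> y \<in> seg m x y"
  by (auto simp: seg_def)

lemma seg_refl [simp]: "x \<in> M \<Longrightarrow> seg m x x = {x}"
  by (auto simp: seg_def mdist_commute)

lemma seg_add: "z \<in> seg m x y \<Longrightarrow> d x y = d x z + d z y"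
  by (auto simp: seg_def)

lemma seg_antisym:
  assumes "z \<in> seg m x y" "y \<in> seg m x z" shows "z = y"
proof -
  have "d x z + d z y = d x y" "d x y + d y z = d x z" "z \<in> M" "y \<in> M" "d z y = d y z"
    using assms by (auto simp: seg_def mdist_commute)
  then have "d z y = 0" using mdist_nonneg[of m z y] by linarith
  with \<open>z \<in> M\<close> \<open>y \<in> M\<close> show ?thesis by simp
qed

lemma seg_trans:
  assumes "w \<in> seg m z y" "z \<in> seg m x y" "x \<in> M" "y \<in> M"
  shows "w \<in> seg m x y" "z \<in> seg m x w"
proof -
  have M: "w \<in> M" "z \<in> M" using assms by (auto simp: seg_def)
  have "d z w + d w y = d z y" "d x z + d z y = d x y" using assms by (auto simp: seg_def)
  moreover have "d x w \<le> d x z + d z w" "d x y \<le> d x w + d w y"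
    using mdist_triangle[of x m z w] mdist_triangle[of x m w y] M assms by auto
  ultimately have "d x w + d w y = d x y" "d x z + d z w = d x w" by linarith+
  then show "w \<in> seg m x y" "z \<in> seg m x w" using M by (auto simp: seg_def)
qed

lemma seg_trans':
  assumes "w \<in> seg m x z" "z \<in> seg m x y" "x \<in> M" "y \<in> M"
  shows "w \<in> seg m x y" "z \<in> seg m w y"
  using seg_trans[of w z x y] assms by (simp_all add: seg_commute)

lemma seg_convex:
  assumes "x \<in> M" "y \<in> M" "z \<in> seg m x y" "w \<in> seg m x y"
  shows "seg m z w \<subseteq> seg m x y"
proof
  fix p assume p: "p \<in> seg m z w"
  have M: "z \<in> M" "w \<in> M" using assms by (auto simp: seg_def)
  have "z \<in> seg m x w \<or> z \<in> seg m w y" using seg_through assms M by blast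
  then show "p \<in> seg m x y"
  proof
    assume "z \<in> seg m x w"
    then have "p \<in> seg m x w" by (rule seg_trans(1)[OF p]) fact+
    then show ?thesis by (rule seg_trans'(1)) fact+
  next
    assume "z \<in> seg m w y"
    moreover have "p \<in> seg m w z" using p by (simp add: seg_commute)
    ultimately have "p \<in> seg m w y" using seg_trans'(1) assms(2) M(2) by blast
    then show ?thesis by (rule seg_trans(1)) fact+
  qed
qed

definition seg_hull :: "'a set \<Rightarrow> 'a set" where
  "seg_hull U = (\<Union>x\<in>U. \<Union>y\<in>U. seg m x y)"

text \<open>Adding segments once suffices in a tree. The segment of U that contains x allows the
  segment from y to x to be prolonged beyond x up to a point of U, and likewise beyond y; the
  prolonged segment still contains w.\<close>

lemma seg_hull_convex:
  assumes U: "U \<subseteq> M" and x: "x \<in> seg_hull U" and y: "y \<in> seg_hull U"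
  shows "seg m x y \<subseteq> seg_hull U"
proof
  fix w assume w: "w \<in> seg m x y"
  obtain a b where ab: "a \<in> U" "b \<in> U" "x \<in> seg m a b" using x by (auto simp: seg_hull_def)
  obtain a' b' where ab': "a' \<in> U" "b' \<in> U" "y \<in> seg m a' b'" using y by (auto simp: seg_hull_def)
  have M: "x \<in> M" "y \<in> M" using ab ab' by (auto simp: seg_def)
  have "x \<in> seg m a y \<or> x \<in> seg m b y"
    using seg_through[of a b y x] ab M U seg_commute by blast
  then obtain p where p: "p \<in> U" "x \<in> seg m p y" using ab by blast
  then have w1: "w \<in> seg m p y" using seg_trans(1)[OF w] M U by blast
  have "y \<in> seg m a' p \<or> y \<in> seg m b' p"
    using seg_through[of a' b' p y] ab' p M U seg_commute by blast
  then obtain q where q: "q \<in> U" "y \<in> seg m q p" using ab' by blast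
  then have "w \<in> seg m q p" using seg_trans(1)[of w y p q] w1 p U seg_commute by blast
  then show "w \<in> seg_hull U" using p q by (auto simp: seg_hull_def)
qed

end

context tree_action
begin

lemma minimalD:
  assumes "minimal_action G T" "S \<subseteq> M" "S \<noteq> {}"
    "\<And>x y. x \<in> S \<Longrightarrow> y \<in> S \<Longrightarrow> seg (metr T) x y \<subseteq> S"
    "\<And>g x. g \<in> carrier G \<Longrightarrow> x \<in> S \<Longrightarrow> act T g x \<in> S"
  shows "S = M"
  using assms unfolding minimal_action_def by (metis image_subsetI)

lemma seg_hull_invariant_eq:
  assumes min: "minimal_action G T" and U: "U \<subseteq> M" "U \<noteq> {}"
    and inv: "\<And>g x. g \<in> carrier G \<Longrightarrow> x \<in> U \<Longrightarrow> act T g x \<in> U"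
  shows "seg_hull U = M"
proof (rule minimalD[OF min])
  show "seg_hull U \<subseteq> M" by (auto simp: seg_hull_def seg_def)
  obtain u where "u \<in> U" using U by blast
  then have "u \<in> seg_hull U" using U unfolding seg_hull_def by (auto intro: seg_ends)
  then show "seg_hull U \<noteq> {}" by blast
  show "seg (metr T) x y \<subseteq> seg_hull U" if "x \<in> seg_hull U" "y \<in> seg_hull U" for x y
    using seg_hull_convex U that by blast
  fix g x assume g: "g \<in> carrier G" and x: "x \<in> seg_hull U"
  then obtain a b where ab: "a \<in> U" "b \<in> U" "x \<in> seg (metr T) a b" by (auto simp: seg_hull_def)
  then have "act T g x \<in> seg (metr T) (act T g a) (act T g b)" using act_seg[OF g, of a b] U by blast
  then show "act T g x \<in> seg_hull U" using inv[OF g] ab by (auto simp: seg_hull_def)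
qed

text \<open>Being convex and invariant, this set is empty or everything when the action is minimal.
  So a single long segment yields long segments around every point.\<close>

definition deep :: "real \<Rightarrow> 'a set" where
  "deep R = {x \<in> M. \<exists>p\<in>M. \<exists>q\<in>M. x \<in> seg (metr T) p q \<and> R \<le> d p x \<and> R \<le> d x q}"

text \<open>As with \<open>seg_hull\<close>, a segment between two points of the set is prolonged at
  both ends, here by at least R, which gives its inner points the same room.\<close>

lemma deep_eq:
  assumes min: "minimal_action G T" and ne: "deep R \<noteq> {}"
  shows "deep R = M"
proof (rule minimalD[OF min _ ne])
  show "deep R \<subseteq> M" by (auto simp: deep_def)
next
  fix x y assume x: "x \<in> deep R" and y: "y \<in> deep R"
  show "seg (metr T) x y \<subseteq> deep R"
  proof
    fix w assume w: "w \<in> seg (metr T) x y"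
    obtain a b where ab: "a \<in> M" "b \<in> M" "x \<in> seg (metr T) a b" "R \<le> d a x" "R \<le> d b x"
      using x by (auto simp: deep_def mdist_commute)
    obtain a' b' where ab': "a' \<in> M" "b' \<in> M" "y \<in> seg (metr T) a' b'" "R \<le> d a' y" "R \<le> d b' y"
      using y by (auto simp: deep_def mdist_commute)
    have M: "x \<in> M" "y \<in> M" "w \<in> M" using x y w by (auto simp: deep_def seg_def)
    have "x \<in> seg (metr T) a y \<or> x \<in> seg (metr T) b y"
      using seg_through[of a b y x] ab M seg_commute by blast
    then obtain p where p: "p \<in> M" "x \<in> seg (metr T) p y" "R \<le> d p x" using ab by blast
    then have w1: "w \<in> seg (metr T) p y" "x \<in> seg (metr T) p w" using seg_trans[OF w] M by blast+
    have "y \<in> seg (metr T) a' p \<or> y \<in> seg (metr T) b' p"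
      using seg_through[of a' b' p y] ab' p M seg_commute by blast
    then obtain q where q: "q \<in> M" "y \<in> seg (metr T) q p" "R \<le> d q y" using ab' by blast
    then have w2: "w \<in> seg (metr T) q p" "y \<in> seg (metr T) q w"
      using seg_trans[of w y p q] w1 p seg_commute by blast+
    have "R \<le> d p w" using seg_add[OF w1(2)] p mdist_nonneg[of "metr T" x w] by linarith
    moreover have "R \<le> d q w" using seg_add[OF w2(2)] q mdist_nonneg[of "metr T" y w] by linarith
    ultimately show "w \<in> deep R"
      unfolding deep_def using w2 p q M by (auto simp: mdist_commute)
  qed
next
  fix g x assume g: "g \<in> carrier G" and x: "x \<in> deep R"
  then obtain p q where pq: "p \<in> M" "q \<in> M" "x \<in> seg (metr T) p q" "R \<le> d p x" "R \<le> d x q" "x \<in> M"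
    by (auto simp: deep_def)
  then have "act T g x \<in> seg (metr T) (act T g p) (act T g q)" using act_seg[OF g] by blast
  then show "act T g x \<in> deep R" unfolding deep_def
    using pq g act_dist[OF g, of p x] act_dist[OF g, of x q] act_closed[OF g] by fastforce
qed

lemma deep_nonempty:
  assumes "x \<in> M" "y \<in> M" "2 * R \<le> d x y" "0 \<le> R"
  shows "deep R \<noteq> {}"
proof -
  obtain z where "z \<in> seg (metr T) x y" "d x z = d x y / 2" "d z y = d x y - d x y / 2"
    using seg_point[of x y "d x y / 2"] assms by auto
  moreover have "R \<le> d x z" "R \<le> d z y" using assms calculation by auto
  moreover have "z \<in> M" using calculation(1) by (simp add: seg_def)
  ultimately have "z \<in> deep R" using assms unfolding deep_def by blast
  then show ?thesis by blast
qed

text \<open>If the diameter D were finite, a pair p, q at distance above 3D/4 would put its midpoint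
  into \<open>deep (D / 4)\<close>, hence by minimality also p. The segment from q to p could then
  be prolonged by D/4 beyond p, to a length above D.\<close>

lemma unbounded:
  assumes min: "minimal_action G T" and xy: "x \<in> M" "y \<in> M" "x \<noteq> y"
  shows "\<exists>p\<in>M. \<exists>q\<in>M. R < d p q"
proof (rule ccontr)
  assume "\<not> ?thesis"
  then have R: "\<And>p q. p \<in> M \<Longrightarrow> q \<in> M \<Longrightarrow> d p q \<le> R" by force
  define S where "S = {d p q | p q. p \<in> M \<and> q \<in> M}"
  have bdd: "bdd_above S" using R by (auto simp: S_def intro!: bdd_aboveI[of _ R])
  define D where "D = Sup S"
  have dS: "d p q \<in> S" if "p \<in> M" "q \<in> M" for p q unfolding S_def using that by blast
  have dD: "d p q \<le> D" if "p \<in> M" "q \<in> M" for p q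
    unfolding D_def using bdd dS[OF that] by (rule cSup_upper[rotated])
  have "0 < d x y" using xy mdist_pos by simp
  then have D: "0 < D" using dD xy by force
  have "\<exists>s\<in>S. D - D / 4 < s"
    using less_cSup_iff[of S "D - D/4"] bdd dS[OF xy(1,2)] D unfolding D_def[symmetric] by auto
  then obtain p q where pq: "p \<in> M" "q \<in> M" "D - D / 4 < d p q" by (auto simp: S_def)
  then have "deep (D / 4) = M" using deep_eq[OF min] deep_nonempty[of p q "D / 4"] D by auto
  then have "p \<in> deep (D / 4)" using pq by blast
  then obtain a b where ab: "a \<in> M" "b \<in> M" "p \<in> seg (metr T) a b" "D / 4 \<le> d a p" "D / 4 \<le> d b p"
    by (auto simp: deep_def mdist_commute)
  have "p \<in> seg (metr T) a q \<or> p \<in> seg (metr T) b q"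
    using seg_through[of a b q p] ab pq seg_commute by blast
  then obtain c where c: "c \<in> M" "p \<in> seg (metr T) c q" "D / 4 \<le> d c p" using ab by blast
  have "D < d c q" using seg_add[OF c(2)] c pq by linarith
  then show False using dD[of c q] c pq by simp
qed

lemma deep_everywhere:
  assumes min: "minimal_action G T" and xy: "x \<in> M" "y \<in> M" "x \<noteq> y" and z: "z \<in> M" and R: "0 \<le> R"
  obtains p q where "p \<in> M" "q \<in> M" "z \<in> seg (metr T) p q" "R \<le> d p z" "R \<le> d z q"
proof -
  obtain p q where "p \<in> M" "q \<in> M" "2 * R < d p q" using unbounded[OF min xy, of "2 * R"] by blast
  then have "deep R = M" using deep_eq[OF min] deep_nonempty[of p q R] R by auto
  then show thesis using z that by (auto simp: deep_def)
qed

lemma minimal_restrict: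
  assumes min: "minimal_action G T" and H: "subgroup H G" "finite (rcosets H)"
  shows "minimal_action (G\<lparr>carrier := H\<rparr>) T"
  unfolding minimal_action_def
proof (intro allI impI)
  fix S assume "S \<subseteq> M \<and> S \<noteq> {} \<and> (\<forall>x\<in>S. \<forall>y\<in>S. seg (metr T) x y \<subseteq> S) \<and>
    (\<forall>g\<in>carrier (G\<lparr>carrier := H\<rparr>). act T g ` S \<subseteq> S)"
  then have S: "S \<subseteq> M" "S \<noteq> {}" "\<And>x y. x \<in> S \<Longrightarrow> y \<in> S \<Longrightarrow> seg (metr T) x y \<subseteq> S"
    "\<And>h x. h \<in> H \<Longrightarrow> x \<in> S \<Longrightarrow> act T h x \<in> S" by (auto simp: image_subset_iff)
  interpret H: subgroup H G by fact
  obtain s0 where s0: "s0 \<in> S" using S(2) by blast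
  define rep where "rep C = (SOME r. r \<in> carrier G \<and> H #> r = C)" for C
  have rep: "rep C \<in> carrier G \<and> H #> rep C = C" if "C \<in> rcosets H" for C
    unfolding rep_def by (rule someI_ex, insert that) (auto simp: RCOSETS_def)
  \<comment> \<open>K bounds the distance from \<open>s0\<close> to its images under the coset
    representatives. If g = h r with h in H and r a representative, then g moves \<open>s0\<close>
    to within K of the image under h, which is in S.\<close>
  define K where "K = Max (insert 0 ((\<lambda>C. d (act T (rep C) s0) s0) ` (rcosets H)))"
  have K: "d (act T (rep C) s0) s0 \<le> K" if "C \<in> rcosets H" for C
    unfolding K_def using H that by auto
  have K0: "0 \<le> K" unfolding K_def using H by auto
  have near_orbit: "\<exists>s\<in>S. d (act T g s0) s \<le> K" if g: "g \<in> carrier G" for g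
  proof -
    define C where "C = H #> g"
    have C: "C \<in> rcosets H" using g by (auto simp: C_def RCOSETS_def)
    have "g \<in> C" using g by (simp add: C_def rcos_self H.subgroup_axioms)
    then have "g \<in> H #> rep C" using rep[OF C] by simp
    then obtain h where h: "h \<in> H" "g = h \<otimes> rep C" by (auto simp: r_coset_def)
    have hG: "h \<in> carrier G" using h H.subset by blast
    have s0M: "s0 \<in> M" using s0 S(1) by blast
    have "d (act T g s0) (act T h s0) = d (act T (rep C) s0) s0"
      using h(2) hG conjunct1[OF rep[OF C]] s0M by (simp add: act_mult)
    then show ?thesis using K[OF C] S(4)[OF h(1) s0] by (intro bexI[of _ "act T h s0"]) auto
  qed
  \<comment> \<open>The point x lies between two points of the orbit of \<open>s0\<close>, and each
    of these is within K of S. So x is on the segment between two points of S or on one of two end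
    pieces of length at most K.\<close>
  have near: "\<exists>s\<in>S. d x s \<le> K" if x: "x \<in> M" for x
  proof -
    define U where "U = (\<lambda>g. act T g s0) ` carrier G"
    have "seg_hull U = M"
    proof (rule seg_hull_invariant_eq[OF min])
      show "U \<subseteq> M" "U \<noteq> {}" using s0 S by (auto simp: U_def)
      fix g u assume g: "g \<in> carrier G" "u \<in> U"
      then obtain k where k: "k \<in> carrier G" "u = act T k s0" by (auto simp: U_def)
      then have "act T g u = act T (g \<otimes> k) s0" using g s0 S by (auto simp: act_mult)
      then show "act T g u \<in> U" using g k by (auto simp: U_def)
    qed
    then have "x \<in> seg_hull U" using x by simp
    then obtain a b where ab: "a \<in> U" "b \<in> U" "x \<in> seg (metr T) a b"
      unfolding seg_hull_def by blast
    have abM: "a \<in> M" "b \<in> M" using ab s0 S by (auto simp: U_def)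
    obtain s where s: "s \<in> S" "d a s \<le> K" using near_orbit ab by (auto simp: U_def)
    obtain s' where s': "s' \<in> S" "d b s' \<le> K" using near_orbit ab by (auto simp: U_def)
    have sM: "s \<in> M" "s' \<in> M" using s s' S by auto
    consider "x \<in> seg (metr T) a s" | "x \<in> seg (metr T) s s'" | "x \<in> seg (metr T) s' b"
      using seg_through ab(3) abM sM by blast
    then show ?thesis
    proof cases
      case 1 then show ?thesis using seg_le(2)[of x a s] s by force
    next
      case 2 then show ?thesis using S(3)[OF s(1) s'(1)] x K0 by (intro bexI[of _ x]) auto
    next
      case 3 then show ?thesis using seg_le(1)[of x s' b] s' mdist_commute[of "metr T"]
        by (intro bexI[of _ s']) (auto simp: mdist_commute)
    qed
  qed
  \<comment> \<open>The ends p, q are at distance at least K + 1 from x, so end pieces of length at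
    most K cannot reach x; it lies on the middle piece, between two points of S.\<close>
  have "x \<in> S" if x: "x \<in> M" for x
  proof (cases "x = s0")
    case True then show ?thesis using s0 by simp
  next
    case False
    then obtain p q where pq: "p \<in> M" "q \<in> M" "x \<in> seg (metr T) p q" "K + 1 \<le> d p x" "K + 1 \<le> d x q"
      using deep_everywhere[OF min x _ _ x, of s0 "K + 1"] s0 S K0 by (metis add_nonneg_nonneg subsetD zero_le_one)
    obtain s where s: "s \<in> S" "d p s \<le> K" using near pq by blast
    obtain s' where s': "s' \<in> S" "d q s' \<le> K" using near pq by blast
    have sM: "s \<in> M" "s' \<in> M" using s s' S by auto
    consider "x \<in> seg (metr T) p s" | "x \<in> seg (metr T) s s'" | "x \<in> seg (metr T) s' q"
      using seg_through pq sM by blast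
    then show ?thesis
    proof cases
      case 1 then show ?thesis using seg_le(1)[of x p s] s pq by linarith
    next
      case 2 then show ?thesis using S(3)[OF s(1) s'(1)] by blast
    next
      case 3 then show ?thesis
        using seg_le(2)[of x s' q] s' pq mdist_commute[of "metr T" q s'] by linarith
    qed
  qed
  then show "S = M" using S by blast
qed

end

section \<open>Commutators of squares in virtually free groups\<close>

lemma word_eval_simps [simp]:
  "word_eval G [] = \<one>\<^bsub>G\<^esub>"
  "word_eval G ((x, a) # w) = (if a then x else inv\<^bsub>G\<^esub> x) \<otimes>\<^bsub>G\<^esub> word_eval G w"
  by (auto simp: word_eval_def)

context group
begin

lemma word_eval_closed [simp]:
  "w \<in> lists (carrier G \<times> UNIV) \<Longrightarrow> word_eval G w \<in> carrier G"
  by (induction w) auto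

lemma word_eval_append:
  "v \<in> lists (carrier G \<times> UNIV) \<Longrightarrow> w \<in> lists (carrier G \<times> UNIV) \<Longrightarrow>
    word_eval G (v @ w) = word_eval G v \<otimes> word_eval G w"
proof (induction v)
  case (Cons l v)
  then have "word_eval G v \<in> carrier G" "word_eval G w \<in> carrier G" by auto
  with Cons show ?case by (cases l) (auto simp: m_assoc)
qed simp

lemma replicate_letter [simp]:
  "x \<in> carrier G \<Longrightarrow> replicate k (x, a) \<in> lists (carrier G \<times> UNIV)"
  by (induction k) auto

lemma word_eval_replicate_inverse:
  assumes x: "x \<in> carrier G"
  shows "word_eval G (replicate k (x, False)) = inv (word_eval G (replicate k (x, True)))"
proof (induction k)
  case (Suc k)
  have "word_eval G (replicate (Suc k) (x, True)) = word_eval G (replicate k (x, True) @ [(x, True)])"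
    by (simp add: replicate_append_same)
  then show ?case using x Suc by (simp add: word_eval_append inv_mult_group del: replicate_Suc) simp
qed simp

text \<open>If the basis had at most one element x, every word would evaluate to a power of x and
  the group would be commutative. For an empty basis the unit serves as x.\<close>

lemma free_basis_two_elements:
  assumes X: "free_basis G X" and nc: "\<not> comm_group G"
  obtains x y where "x \<in> X" "y \<in> X" "x \<noteq> y"
proof -
  have bij: "word_eval G ` reduced_words X = carrier G" and XG: "X \<subseteq> carrier G"
    using X by (auto simp: free_basis_def bij_betw_def)
  have "\<not> X \<subseteq> {x}" if x: "x \<in> carrier G" for x
  proof
    assume Xx: "X \<subseteq> {x}"
    have pow: "\<exists>i::int. word_eval G w = x [^] i" if "w \<in> lists (X \<times> UNIV)" for w
      using that
    proof (induction w)
      case Nil then show ?case by (intro exI[of _ 0]) simp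
    next
      case (Cons l w)
      then obtain i :: int and a where i: "word_eval G w = x [^] i" and l: "l = (x, a)"
        using Xx by auto
      have "x \<otimes> x [^] i = x [^] (1 + i)" "inv x \<otimes> x [^] i = x [^] (- 1 + i)"
        using x int_pow_mult[OF x, of 1 i] int_pow_mult[OF x, of "-1" i] by (simp_all add: int_pow_neg)
      then show ?case using i l by auto
    qed
    have "a \<otimes> b = b \<otimes> a" if "a \<in> carrier G" "b \<in> carrier G" for a b
    proof -
      have powc: "\<exists>i::int. c = x [^] i" if "c \<in> carrier G" for c
      proof -
        have "c \<in> word_eval G ` reduced_words X" unfolding bij by fact
        then obtain w where "w \<in> reduced_words X" "c = word_eval G w" by (rule imageE)
        then show ?thesis using pow[of w] by (simp add: reduced_words_def)
      qed
      obtain i :: int where "a = x [^] i" using powc[OF \<open>a \<in> carrier G\<close>] ..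
      moreover obtain j :: int where "b = x [^] j" using powc[OF \<open>b \<in> carrier G\<close>] ..
      ultimately show ?thesis using x by (simp add: int_pow_mult[symmetric] add.commute)
    qed
    then show False using nc group_comm_groupI by blast
  qed
  then show thesis using that XG one_closed by blast
qed

text \<open>For distinct basis elements x, y the commutators of x^(2k+2) with y^2 are the values of
  the reduced words \<open>W k\<close>, and these differ because their lengths 4k + 8 do.\<close>

lemma free_basis_infinite_commutators:
  assumes X: "free_basis G X" and nc: "\<not> comm_group G"
  shows "infinite {(u \<otimes> u) \<otimes> (v \<otimes> v) \<otimes> inv (u \<otimes> u) \<otimes> inv (v \<otimes> v) | u v.
    u \<in> carrier G \<and> v \<in> carrier G}" (is "infinite ?C")
proof -
  obtain x y where xy: "x \<in> X" "y \<in> X" "x \<noteq> y" using free_basis_two_elements[OF assms] .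
  have inj: "inj_on (word_eval G) (reduced_words X)" and XG: "X \<subseteq> carrier G"
    using X by (auto simp: free_basis_def bij_betw_def)
  have G: "x \<in> carrier G" "y \<in> carrier G" using xy XG by auto
  \<comment> \<open>\<open>Suc k\<close> keeps the powers of x nontrivial; without them the powers
    of y would be adjacent to their inverses and the word would not be reduced.\<close>
  define p where "p z k a = replicate (Suc k) (z, a)" for z :: 'a and k and a :: bool
  define W where "W k = (p x k True @ p x k True) @ (p y 0 True @ p y 0 True) @
    (p x k False @ p x k False) @ (p y 0 False @ p y 0 False)" for k
  have lw: "p z k a \<in> lists (carrier G \<times> UNIV)" if "z \<in> carrier G" for z k a
    using that replicate_letter[of z "Suc k" a] by (simp add: p_def)
  have ap: "u @ v \<in> lists (carrier G \<times> UNIV)"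
    if "u \<in> lists (carrier G \<times> UNIV)" "v \<in> lists (carrier G \<times> UNIV)" for u v :: "('a \<times> bool) list"
    using that by auto
  have eval: "word_eval G (W k) \<in> ?C" for k
  proof -
    define u where "u = word_eval G (p x k True)"
    define v where "v = word_eval G (p y 0 True)"
    have uv: "u \<in> carrier G" "v \<in> carrier G"
      unfolding u_def v_def by (rule word_eval_closed[OF lw[OF G(1)]], rule word_eval_closed[OF lw[OF G(2)]])
    have "word_eval G (p x k False) = inv u" "word_eval G (p y 0 False) = inv v"
      unfolding u_def v_def p_def
      by (rule word_eval_replicate_inverse[OF G(1)], rule word_eval_replicate_inverse[OF G(2)])
    then have "word_eval G (W k) = (u \<otimes> u) \<otimes> ((v \<otimes> v) \<otimes> ((inv u \<otimes> inv u) \<otimes> (inv v \<otimes> inv v)))"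
      unfolding W_def using lw[OF G(1)] lw[OF G(2)] ap
      by (simp add: word_eval_append u_def[symmetric] v_def[symmetric] del: append_assoc)
    also have "\<dots> = (u \<otimes> u) \<otimes> (v \<otimes> v) \<otimes> inv (u \<otimes> u) \<otimes> inv (v \<otimes> v)"
      using uv by (simp add: inv_mult_group m_assoc)
    finally show ?thesis using uv by blast
  qed
  have succ: "successively R (replicate k z @ w) \<longleftrightarrow> successively R w \<and> (k = 0 \<or> w = [] \<or> R z (hd w))"
    if "R z z" for R :: "'a \<times> bool \<Rightarrow> 'a \<times> bool \<Rightarrow> bool" and z w k
    using that by (induction k) (auto simp: successively_Cons hd_append)
  have succ0: "successively R (replicate k z)"
    if "R z z" for R :: "'a \<times> bool \<Rightarrow> 'a \<times> bool \<Rightarrow> bool" and z k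
    using succ[of R z k "[]"] that by simp
  have red: "W k \<in> reduced_words X" for k
    unfolding W_def reduced_words_def p_def using xy
    by (auto simp: succ succ0 hd_append simp del: replicate_Suc)
  have "inj (\<lambda>k. word_eval G (W k))"
  proof (rule injI)
    fix j k assume "word_eval G (W j) = word_eval G (W k)"
    then have "W j = W k" using inj red by (meson inj_onD)
    then have "length (W j) = length (W k)" by simp
    then show "j = k" by (simp add: W_def p_def)
  qed
  then have "infinite (range (\<lambda>k. word_eval G (W k)))" using finite_imageD by blast
  moreover have "range (\<lambda>k. word_eval G (W k)) \<subseteq> ?C" using eval by blast
  ultimately show ?thesis using finite_subset by blast
qed

text \<open>Squares are used because the square of an isometry of a line preserves its orientation,
  so that commutators of squares act trivially there. Those formed in K are among those of G, since
  inverses in K are inverses in G.\<close>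

lemma virtually_nonabelian_free_commutators:
  assumes "virtually_nonabelian_free G"
  shows "infinite {(u \<otimes> u) \<otimes> (v \<otimes> v) \<otimes> inv (u \<otimes> u) \<otimes> inv (v \<otimes> v) | u v.
    u \<in> carrier G \<and> v \<in> carrier G}"
proof -
  obtain K X where K: "subgroup K G" "free_basis (G\<lparr>carrier := K\<rparr>) X"
    "\<not> comm_group (G\<lparr>carrier := K\<rparr>)"
    using assms by (auto simp: virtually_nonabelian_free_def)
  interpret K: group "G\<lparr>carrier := K\<rparr>" using subgroup_imp_group[OF K(1)] .
  have Kc: "a \<otimes> b \<in> K" "a \<in> carrier G" if "a \<in> K" "b \<in> K" for a b
    using that K(1) subgroup.m_closed subgroup.mem_carrier by metis+
  have "{(u \<otimes> u) \<otimes> (v \<otimes> v) \<otimes> inv\<^bsub>G\<lparr>carrier := K\<rparr>\<^esub> (u \<otimes> u) \<otimes> inv\<^bsub>G\<lparr>carrier := K\<rparr>\<^esub> (v \<otimes> v) | u v.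
      u \<in> K \<and> v \<in> K} \<subseteq> {(u \<otimes> u) \<otimes> (v \<otimes> v) \<otimes> inv (u \<otimes> u) \<otimes> inv (v \<otimes> v) | u v.
      u \<in> carrier G \<and> v \<in> carrier G}"
  proof clarify
    fix u v assume "u \<in> K" "v \<in> K"
    then have "u \<in> carrier G" "v \<in> carrier G"
      "inv\<^bsub>G\<lparr>carrier := K\<rparr>\<^esub> (u \<otimes> u) = inv (u \<otimes> u)" "inv\<^bsub>G\<lparr>carrier := K\<rparr>\<^esub> (v \<otimes> v) = inv (v \<otimes> v)"
      using m_inv_consistent[OF K(1)] Kc by auto
    then show "\<exists>u' v'. (u \<otimes> u) \<otimes> (v \<otimes> v) \<otimes> inv\<^bsub>G\<lparr>carrier := K\<rparr>\<^esub> (u \<otimes> u) \<otimes> inv\<^bsub>G\<lparr>carrier := K\<rparr>\<^esub> (v \<otimes> v)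
       = (u' \<otimes> u') \<otimes> (v' \<otimes> v') \<otimes> inv (u' \<otimes> u') \<otimes> inv (v' \<otimes> v') \<and> u' \<in> carrier G \<and> v' \<in> carrier G"
      by (intro exI[of _ u] exI[of _ v]) simp
  qed
  moreover have "infinite {(u \<otimes> u) \<otimes> (v \<otimes> v) \<otimes> inv\<^bsub>G\<lparr>carrier := K\<rparr>\<^esub> (u \<otimes> u) \<otimes> inv\<^bsub>G\<lparr>carrier := K\<rparr>\<^esub> (v \<otimes> v) | u v.
      u \<in> K \<and> v \<in> K}"
    using K.free_basis_infinite_commutators[OF K(2,3)] by simp
  ultimately show ?thesis using finite_subset by blast
qed

end

section \<open>Existence of invariant structures\<close>

lemma simplicial_structureD:
  assumes "simplicial_structure m V"
  shows "V \<subseteq> mspace m" "mspace m = V \<union> \<Union> (edges m V)"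
    "e \<in> edges m V \<Longrightarrow> e' \<in> edges m V \<Longrightarrow> e \<noteq> e' \<Longrightarrow> e \<inter> e' \<subseteq> V"
    "x \<in> mspace m \<Longrightarrow> y \<in> mspace m \<Longrightarrow> finite (V \<inter> seg m x y)"
  using assms by (simp_all only: simplicial_structure_def) blast+

context rtree
begin

lemma seg_through':
  assumes "x \<in> M" "y \<in> M" "w \<in> M" "z \<in> seg m x y"
  shows "z \<in> seg m x w \<or> z \<in> seg m y w"
  using seg_through[OF assms] seg_commute[of w y] by simp

text \<open>Three directions at x, expressed by three points that x separates pairwise. No vertex
  set is mentioned, so the set is preserved by every isometry of the tree.\<close>

definition branch_points :: "'a set" where
  "branch_points = {x \<in> M. \<exists>p\<in>M - {x}. \<exists>q\<in>M - {x}. \<exists>r\<in>M - {x}.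
     x \<in> seg m p q \<and> x \<in> seg m q r \<and> x \<in> seg m p r}"

lemma not_branchD:
  assumes "x \<notin> branch_points" "x \<in> seg m p q" "p \<in> M" "q \<in> M" "r \<in> M" "p \<noteq> x" "q \<noteq> x" "r \<noteq> x"
  shows "x \<notin> seg m p r \<or> x \<notin> seg m q r"
  using assms unfolding branch_points_def seg_def by blast

text \<open>Inside an edge from u to v there is no third direction. A point y slightly off the edge
  in such a direction would lie in another edge, with an end w that x does not separate from y; the
  segments from u and v to w would then be edges through x too, while distinct edges share only
  vertices. Of three points pairwise separated by x, at least two are separated from u and at least
  two from v, so one is separated from both and provides the third direction.\<close>

lemma branch_points_subset_vertices:
  assumes V: "simplicial_structure m V"
  shows "branch_points \<subseteq> V"
proof (rule ccontr)
  assume "\<not> ?thesis"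
  then obtain x where x: "x \<in> branch_points" "x \<notin> V" by blast
  note VM = simplicial_structureD(1)[OF V] and cover = simplicial_structureD(2)[OF V]
    and meet = simplicial_structureD(3)[OF V] and fin = simplicial_structureD(4)[OF V]
  have xM: "x \<in> M" using x by (simp add: branch_points_def)
  obtain u v where uv: "u \<in> V" "v \<in> V" "u \<noteq> v" "seg m u v \<inter> V = {u, v}" "x \<in> seg m u v"
  proof -
    have "x \<in> \<Union> (edges m V)" using cover xM x(2) by (metis UnE)
    then show thesis using that unfolding edges_def by blast
  qed
  have uvM: "u \<in> M" "v \<in> M" using uv VM by auto
  have sep: "x \<notin> seg m p u \<or> x \<notin> seg m p v" if p: "p \<in> M" "p \<noteq> x" for p
  proof (rule ccontr)
    assume "\<not> ?thesis"
    then have xp: "x \<in> seg m u p" "x \<in> seg m v p" by (auto simp: seg_commute)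
    \<comment> \<open>\<open>\<delta>\<close> is at most the distance from x to p and to each vertex
      on the way, so a step of half that size from x meets no vertex.\<close>
    define \<delta> where "\<delta> = Min (insert (d x p) (d x ` (V \<inter> seg m x p)))"
    have fin\<delta>: "finite (insert (d x p) (d x ` (V \<inter> seg m x p)))" using fin xM p by simp
    have \<delta>: "\<delta> \<le> d x p" "\<And>w. w \<in> V \<inter> seg m x p \<Longrightarrow> \<delta> \<le> d x w"
      unfolding \<delta>_def using fin\<delta> by auto
    have "\<delta> > 0" unfolding \<delta>_def using fin\<delta> x(2) xM p VM mdist_pos
      by (subst Min_gr_iff) auto
    then obtain y where y: "y \<in> seg m x p" "d x y = \<delta> / 2"
      using seg_point[of x p "\<delta> / 2"] xM p \<delta>(1) by auto
    have yM: "y \<in> M" using y by (simp add: seg_def)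
    have yx: "y \<noteq> x" using y(2) \<open>\<delta> > 0\<close> xM by auto
    have free: "seg m x y \<inter> V = {}"
    proof (rule ccontr)
      assume "seg m x y \<inter> V \<noteq> {}"
      then obtain w where w: "w \<in> seg m x y" "w \<in> V" by blast
      then have "w \<in> seg m x p" using seg_convex[of x p x y] xM p y by auto
      then have "\<delta> \<le> d x w" using \<delta>(2) w by blast
      moreover have "d x w \<le> d x y" using seg_le w by blast
      ultimately show False using y \<open>\<delta> > 0\<close> by simp
    qed
    then have yV: "y \<notin> V" using seg_ends(2)[OF xM yM] by blast
    obtain u' v' where uv': "u' \<in> V" "v' \<in> V" "u' \<noteq> v'" "seg m u' v' \<inter> V = {u', v'}" "y \<in> seg m u' v'"
    proof -
      have "y \<in> \<Union> (edges m V)" using cover yM yV by (metis UnE)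
      then show thesis using that unfolding edges_def by blast
    qed
    have uvM': "u' \<in> M" "v' \<in> M" using uv' VM by auto
    have xy: "x \<in> seg m u y" "x \<in> seg m v y"
      using seg_trans(2)[OF y(1) xp(1)] seg_trans(2)[OF y(1) xp(2)] uvM p by blast+
    \<comment> \<open>If x separated y from both ends of the edge containing y, that edge would have
      to pass through x twice.\<close>
    have "x \<notin> seg m y u' \<or> x \<notin> seg m y v'"
    proof (rule ccontr)
      assume "\<not> ?thesis"
      then have "d y u' = d y x + d x u'" "d y v' = d y x + d x v'" using seg_add by blast+
      moreover have "d u' v' = d u' y + d y v'" using seg_add uv' by blast
      moreover have "d u' v' \<le> d u' x + d x v'" using mdist_triangle[of u' m x v'] uvM' xM by simp
      ultimately have "d y x \<le> 0" by (simp add: mdist_commute)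
      then show False using mdist_pos[OF yM xM yx] by simp
    qed
    then obtain w where w: "w \<in> {u', v'}" "x \<notin> seg m y w" by blast
    have wV: "w \<in> V" "w \<in> M" using w uv' VM by auto
    have yw: "seg m y w \<inter> V \<subseteq> {w}"
    proof
      fix z assume z: "z \<in> seg m y w \<inter> V"
      have "seg m y w \<subseteq> seg m u' v'" using seg_convex[of u' v' y w] uvM' uv'(5) w by auto
      then have z': "z \<in> {u', v'}" using z uv'(4) by blast
      show "z \<in> {w}"
      proof (rule ccontr)
        assume "z \<notin> {w}"
        then have "seg m u' v' = seg m w z" using z' w seg_commute by auto
        then have "z = y" using seg_antisym[of z w y] z uv'(5) seg_commute by auto
        then show False using z yV by blast
      qed
    qed
    have key: "s = w \<or> seg m s w \<in> edges m V \<and> x \<in> seg m s w"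
      if s: "s \<in> {u, v}" for s
    proof (cases "s = w")
      case False
      obtain t where t: "{u, v} = {s, t}" "s \<noteq> t" "seg m u v = seg m s t" using s uv seg_commute by fastforce
      have sM: "s \<in> M" "s \<in> V" "t \<in> M" using s uv uvM t by auto
      have "x \<in> seg m s y" using s xy by blast
      then have xw: "x \<in> seg m s w" using seg_through[of s y w x] sM yM wV w seg_commute by blast
      have "seg m s w \<inter> V = {s, w}"
      proof
        show "{s, w} \<subseteq> seg m s w \<inter> V" using sM wV by auto
        show "seg m s w \<inter> V \<subseteq> {s, w}"
        proof
          fix z assume z: "z \<in> seg m s w \<inter> V"
          then consider "z \<in> seg m s x" | "z \<in> seg m x y" | "z \<in> seg m y w"
            using seg_through[of s w x z] seg_through[of x w y z] sM wV xM yM by blast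
          then show "z \<in> {s, w}"
          proof cases
            case 1
            have "seg m s x \<subseteq> seg m s t" using seg_convex[of s t s x] sM uv(5) t by auto
            then have "z \<in> {s, t}" using 1 z uv(4) t by blast
            moreover have "z \<noteq> t"
              using seg_antisym[of t s x] 1 uv(5) t x z by auto
            ultimately show ?thesis by blast
          next
            case 2 then show ?thesis using free z by blast
          next
            case 3 then show ?thesis using yw z by blast
          qed
        qed
      qed
      then show ?thesis using xw sM wV False unfolding edges_def by blast
    qed simp
    have e: "seg m u v \<in> edges m V" using uv unfolding edges_def by blast
    have "w \<in> {u, v}"
    proof (rule ccontr)
      assume "w \<notin> {u, v}"
      then have "seg m u w \<in> edges m V \<and> x \<in> seg m u w" using key[of u] by blast
      then have "seg m u w = seg m u v" using meet[OF e] uv(5) x(2) by blast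
      then have "w \<in> seg m u v" using uvM wV seg_ends by metis
      then show False using \<open>w \<notin> {u, v}\<close> uv(4) wV by blast
    qed
    moreover have "x \<notin> seg m w w" using wV x(2) seg_refl by auto
    ultimately show False
      using xy w seg_through[of w y w x] yM wV seg_commute by blast
  qed
  obtain p q r where pqr: "p \<in> M - {x}" "q \<in> M - {x}" "r \<in> M - {x}"
    "x \<in> seg m p q" "x \<in> seg m q r" "x \<in> seg m p r"
    using x(1) unfolding branch_points_def by blast
  have "x \<in> seg m p s \<or> x \<in> seg m q s" "x \<in> seg m q s \<or> x \<in> seg m r s" "x \<in> seg m p s \<or> x \<in> seg m r s"
    if "s \<in> M" for s
    using seg_through[of p q s x] seg_through[of q r s x] seg_through[of p r s x] pqr that seg_commute
    by blast+
  from this[of u] this[of v] show False using sep[of p] sep[of q] sep[of r] pqr uvM by blast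
qed

text \<open>The ends are the vertices nearest to x on the two sides; local finiteness makes the
  minima exist.\<close>

lemma adjacent_pair_around:
  assumes ab: "a \<in> V" "b \<in> V" "V \<subseteq> M" and x: "x \<in> seg m a b" "x \<notin> V"
    and fin: "finite (V \<inter> seg m a b)"
  obtains u v where "u \<in> V" "v \<in> V" "u \<noteq> v" "x \<in> seg m u v" "seg m u v \<inter> V = {u, v}"
    "seg m u v \<subseteq> seg m a b"
proof -
  have M: "a \<in> M" "b \<in> M" "x \<in> M" using ab x by (auto simp: seg_def)
  have sub: "seg m a x \<subseteq> seg m a b" "seg m x b \<subseteq> seg m a b"
    using seg_convex[of a b a x] seg_convex[of a b x b] M x by auto
  define u where "u = arg_min_on (d x) (V \<inter> seg m a x)"
  have "a \<in> V \<inter> seg m a x" using ab M by simp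
  then have "finite (V \<inter> seg m a x)" "V \<inter> seg m a x \<noteq> {}"
    using finite_subset[OF Int_mono[OF order_refl sub(1)] fin] by blast+
  then have u: "u \<in> V \<inter> seg m a x" "\<And>w. w \<in> V \<inter> seg m a x \<Longrightarrow> d x u \<le> d x w"
    unfolding u_def using arg_min_if_finite(1)[of "V \<inter> seg m a x" "d x"] arg_min_least[of "V \<inter> seg m a x" _ "d x"] by blast+
  define v where "v = arg_min_on (d x) (V \<inter> seg m x b)"
  have "b \<in> V \<inter> seg m x b" using ab M by simp
  then have "finite (V \<inter> seg m x b)" "V \<inter> seg m x b \<noteq> {}"
    using finite_subset[OF Int_mono[OF order_refl sub(2)] fin] by blast+
  then have v: "v \<in> V \<inter> seg m x b" "\<And>w. w \<in> V \<inter> seg m x b \<Longrightarrow> d x v \<le> d x w"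
    unfolding v_def using arg_min_if_finite(1)[of "V \<inter> seg m x b" "d x"] arg_min_least[of "V \<inter> seg m x b" _ "d x"] by blast+
  have uvM: "u \<in> M" "v \<in> M" using u v by (auto simp: seg_def)
  have "x \<in> seg m u b"
    using seg_trans(2)[of u x a b] u(1) x(1) M seg_commute by blast
  then have xuv: "x \<in> seg m u v"
    using seg_trans(2)[of v x b u] v(1) uvM M by blast
  have "u \<noteq> v" using xuv x(2) u(1) uvM by auto
  moreover have "seg m u v \<inter> V \<subseteq> {u, v}"
  proof
    fix w assume w: "w \<in> seg m u v \<inter> V"
    then have wM: "w \<in> M" by (auto simp: seg_def)
    have "w \<in> seg m u x \<or> w \<in> seg m x v" using seg_through uvM M w by blast
    then show "w \<in> {u, v}"
    proof
      assume w1: "w \<in> seg m u x"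
      then have "w \<in> seg m a x" using seg_convex[of a x u x] u(1) M by auto
      then have "d x u \<le> d x w" using u(2) w by blast
      moreover have "d u x = d u w + d w x" using seg_add w1 by blast
      ultimately have "d u w \<le> 0" using mdist_commute[of m] by (metis add_le_same_cancel2)
      then show ?thesis using mdist_pos[of u w] uvM wM by force
    next
      assume w1: "w \<in> seg m x v"
      then have "w \<in> seg m x b" using seg_convex[of x b x v] v(1) M by auto
      then have "d x v \<le> d x w" using v(2) w by blast
      moreover have "d x v = d x w + d w v" using seg_add w1 by blast
      ultimately have "d w v \<le> 0" by linarith
      then show ?thesis using mdist_pos[of w v] uvM wM by force
    qed
  qed
  moreover have "seg m u v \<subseteq> seg m a b" using seg_convex[of a b u v] M u(1) v(1) sub by blast
  moreover have "{u, v} \<subseteq> seg m u v \<inter> V" using u(1) v(1) uvM by auto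
  ultimately show thesis using that[of u v] xuv u(1) v(1) by (metis IntD1 subset_antisym)
qed

text \<open>Suppose that x does not separate an end s of one pair from an end w of the other. The
  median of x, s and w differs from x; it is s, w or a branch point, hence a vertex, and adjacency
  in both pairs forces it to equal s as well as w. As x is no branch point, each end of one pair is
  on the same side of x as some end of the other.\<close>

lemma adjacent_pair_unique:
  assumes B: "branch_points \<subseteq> V" "V \<subseteq> M" and x: "x \<notin> V"
    and uv: "u \<in> V" "v \<in> V" "x \<in> seg m u v" "seg m u v \<inter> V = {u, v}"
    and uv': "u' \<in> V" "v' \<in> V" "x \<in> seg m u' v'" "seg m u' v' \<inter> V = {u', v'}"
  shows "{u, v} = {u', v'}"
proof -
  have end_eq: "s = w"
    if h: "s \<in> V" "t \<in> V" "x \<in> seg m s t" "seg m s t \<inter> V = {s, t}"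
      "w \<in> V" "z \<in> V" "x \<in> seg m w z" "seg m w z \<inter> V = {w, z}" "x \<notin> seg m s w" for s t w z
  proof -
    have M: "s \<in> M" "t \<in> M" "w \<in> M" "z \<in> M" "x \<in> M" using h B by (auto simp: seg_def)
    obtain p where p: "p \<in> seg m x s" "p \<in> seg m x w" "p \<in> seg m s w"
      using median_exists M by metis
    have pM: "p \<in> M" using p by (simp add: seg_def)
    have p1: "p \<in> seg m s t" using seg_convex[of s t x s] M h p by auto
    have p2: "p \<in> seg m w z" using seg_convex[of w z x w] M h p by auto
    have px: "p \<noteq> x" using p(3) h by blast
    have "p \<in> V"
    proof (rule ccontr)
      assume "p \<notin> V"
      then have "p \<notin> branch_points" using B by blast
      moreover have "p \<noteq> s" "p \<noteq> w" using \<open>p \<notin> V\<close> h by auto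
      ultimately show False using not_branchD[of p x s w] p M px by blast
    qed
    have "p \<noteq> t" using seg_antisym[of t s x] p(1) h x seg_commute by blast
    moreover have "p \<noteq> z" using seg_antisym[of z w x] p(2) h x seg_commute by blast
    moreover have "p \<in> seg m s t \<inter> V" "p \<in> seg m w z \<inter> V" using p1 p2 \<open>p \<in> V\<close> by auto
    ultimately show ?thesis unfolding h(4,8) by auto
  qed
  have M: "u \<in> M" "v \<in> M" "u' \<in> M" "v' \<in> M" using uv uv' B by auto
  have nb: "x \<notin> branch_points" using x B by blast
  have "w = u \<or> w = v" if h: "w \<in> V" "z \<in> V" "x \<in> seg m w z" "seg m w z \<inter> V = {w, z}" for w z
  proof -
    have "x \<notin> seg m u w \<or> x \<notin> seg m v w"
      using not_branchD[OF nb uv(3), of w] M B h x uv by blast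
    then show ?thesis
    proof
      assume "x \<notin> seg m u w" then show ?thesis using end_eq[of u v w z] uv h by blast
    next
      assume "x \<notin> seg m v w" then show ?thesis
        using end_eq[of v u w z] uv h seg_commute by (metis insert_commute)
    qed
  qed
  from this[of u' v'] this[of v' u'] have "u' \<in> {u, v}" "v' \<in> {u, v}"
    using uv' seg_commute by (metis insert_commute insertI1 insertI2)+
  moreover have "u' \<noteq> v'" using uv'(1,3) x M(3) seg_refl by (metis singletonD)
  ultimately show ?thesis by blast
qed

text \<open>Existence of adjacent pairs makes the edges cover the tree, and their uniqueness makes
  distinct edges meet in vertices only. The point of the criterion is that it does not mention
  edges: its conditions are easily checked for unions and for invariant sets.\<close>

lemma simplicial_structureI:
  assumes V: "V \<subseteq> M" "branch_points \<subseteq> V" "seg_hull V = M"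
    and fin: "\<And>x y. x \<in> M \<Longrightarrow> y \<in> M \<Longrightarrow> finite (V \<inter> seg m x y)"
  shows "simplicial_structure m V"
proof -
  have "x \<in> V \<union> \<Union> (edges m V)" if x: "x \<in> M" for x
  proof (cases "x \<in> V")
    case False
    obtain a b where ab: "a \<in> V" "b \<in> V" "x \<in> seg m a b"
      using x V(3) unfolding seg_hull_def by blast
    then obtain u v where "u \<in> V" "v \<in> V" "u \<noteq> v" "x \<in> seg m u v" "seg m u v \<inter> V = {u, v}"
      using adjacent_pair_around[OF ab(1,2) V(1) ab(3) False fin] ab(1,2) V(1) by (metis subsetD)
    then show ?thesis unfolding edges_def by blast
  qed simp
  moreover have "\<Union> (edges m V) \<subseteq> M" by (auto simp: edges_def seg_def)
  moreover have "e \<inter> e' \<subseteq> V" if e: "e \<in> edges m V" "e' \<in> edges m V" "e \<noteq> e'" for e e'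
  proof
    fix x assume x: "x \<in> e \<inter> e'"
    obtain u v where uv: "e = seg m u v" "u \<in> V" "v \<in> V" "seg m u v \<inter> V = {u, v}"
      using e(1) unfolding edges_def by blast
    obtain u' v' where uv': "e' = seg m u' v'" "u' \<in> V" "v' \<in> V" "seg m u' v' \<inter> V = {u', v'}"
      using e(2) unfolding edges_def by blast
    have xs: "x \<in> seg m u v" "x \<in> seg m u' v'" using x uv(1) uv'(1) by auto
    show "x \<in> V"
    proof (rule ccontr)
      assume "x \<notin> V"
      then have "{u, v} = {u', v'}"
        using adjacent_pair_unique[OF V(2,1) _ uv(2,3) xs(1) uv(4) uv'(2,3) xs(2) uv'(4)] by simp
      then have "seg m u v = seg m u' v'" using seg_commute[of u v] by (auto simp: doubleton_eq_iff)
      then show False using e(3) uv(1) uv'(1) by simp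
    qed
  qed
  ultimately show ?thesis unfolding simplicial_structure_def using V(1) fin by (metis Un_subset_iff subsetI subset_antisym)
qed

end

section \<open>Trees without branch points, and midpoints of adjacent vertices\<close>

context rtree
begin

text \<open>\<open>\<phi>\<close> is the distance from \<open>x0\<close> with a sign, positive on
  the side of \<open>x1\<close>. Of two points on the same side, one lies between \<open>x0\<close>
  and the other, for otherwise their median with \<open>x0\<close> would be a branch point.\<close>

lemma collinear_signed_distance:
  assumes B: "branch_points = {}" and x0: "x0 \<in> M" and x1: "x1 \<in> M" "x0 \<noteq> x1"
  obtains \<phi> :: "'a \<Rightarrow> real" where "\<And>x y. x \<in> M \<Longrightarrow> y \<in> M \<Longrightarrow> \<bar>\<phi> x - \<phi> y\<bar> = d x y"
proof -
  define \<phi> where "\<phi> x = (if x0 \<in> seg m x x1 then - d x0 x else d x0 x)" for x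
  have same: "\<bar>d x0 x - d x0 y\<bar> = d x y" if xy: "x \<in> M" "y \<in> M" "x0 \<notin> seg m x y" for x y
  proof -
    obtain p where p: "p \<in> seg m x0 x" "p \<in> seg m x0 y" "p \<in> seg m x y"
      using median_exists x0 xy by metis
    have "p \<noteq> x0" using p xy by blast
    then have "p = x \<or> p = y"
      using not_branchD[of p x0 x y] B p xy x0 by blast
    then have "x \<in> seg m x0 y \<or> y \<in> seg m x0 x" using p by blast
    then show ?thesis using seg_add mdist_commute[of m] by (smt (verit) mdist_nonneg)
  qed
  have opp: "d x0 x + d x0 y = d x y" if "x0 \<in> seg m x y" for x y
    using seg_add[OF that] by (simp add: mdist_commute)
  have "\<bar>\<phi> x - \<phi> y\<bar> = d x y" if xy: "x \<in> M" "y \<in> M" for x y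
  proof -
    consider "x0 \<in> seg m x x1" "x0 \<in> seg m y x1" | "x0 \<in> seg m x x1" "x0 \<notin> seg m y x1"
      | "x0 \<notin> seg m x x1" "x0 \<in> seg m y x1" | "x0 \<notin> seg m x x1" "x0 \<notin> seg m y x1" by blast
    then show ?thesis
    proof cases
      case 1
      have "\<bar>d x0 x - d x0 y\<bar> = d x y"
      proof (cases "x = x0 \<or> y = x0")
        case True then show ?thesis using x0 xy by (auto simp: mdist_commute)
      next
        case False
        then have "x0 \<notin> seg m x y" using not_branchD[of x0 x x1 y] 1 B x0 x1 xy seg_commute
          by (metis empty_iff)
        then show ?thesis using same xy by blast
      qed
      then show ?thesis using 1 by (simp add: \<phi>_def)
    next
      case 2
      then have "x0 \<in> seg m x y" using seg_through[of x x1 y x0] xy x1 by blast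
      then show ?thesis using opp[of x y] 2 unfolding \<phi>_def by (smt (verit) mdist_nonneg)
    next
      case 3
      then have "x0 \<in> seg m x y" using seg_through[of y x1 x x0] xy x1 seg_commute by blast
      then show ?thesis using opp[of x y] 3 unfolding \<phi>_def by (smt (verit) mdist_nonneg)
    next
      case 4
      then have "x0 \<notin> seg m x y" using seg_through[of x y x1 x0] xy x1 seg_commute by blast
      then show ?thesis using same[of x y] xy 4 by (simp add: \<phi>_def)
    qed
  qed
  then show thesis using that by blast
qed

lemma midpoint_unique:
  assumes "u \<in> M" "v \<in> M" "z \<in> seg m u v" "z' \<in> seg m u v" "d u z = d z v" "d u z' = d z' v"
  shows "z = z'"
proof -
  have "d u z = d u z'" using seg_add[OF assms(3)] seg_add[OF assms(4)] assms by simp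
  then have "d z z' = 0" using seg_dist[OF assms(1-4)] by simp
  then show ?thesis using assms seg_subset by (metis mdist_zero subsetD)
qed

text \<open>The segment from x to y is enlarged to one with ends p, q in V. The adjacent pair around
  any of its points outside V then consists of members of the finite set W, and a pair has only one
  midpoint.\<close>

lemma finite_midpoints:
  assumes B: "branch_points \<subseteq> V" "V \<subseteq> M" "seg_hull V = M"
    and fin: "\<And>x y. x \<in> M \<Longrightarrow> y \<in> M \<Longrightarrow> finite (V \<inter> seg m x y)" and xy: "x \<in> M" "y \<in> M"
  shows "finite ({z. \<exists>u\<in>V. \<exists>v\<in>V. seg m u v \<inter> V = {u, v} \<and> z \<in> seg m u v \<and> d u z = d z v} \<inter> seg m x y)"
    (is "finite (?N \<inter> _)")
proof -
  have "x \<in> seg_hull V" "y \<in> seg_hull V" using B xy by auto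
  then obtain a b a' b' where ab: "a \<in> V" "b \<in> V" "x \<in> seg m a b"
    and ab': "a' \<in> V" "b' \<in> V" "y \<in> seg m a' b'"
    unfolding seg_hull_def by blast
  have "x \<in> seg m a y \<or> x \<in> seg m b y"
    using seg_through'[of a b y x] ab xy B by blast
  then obtain p where p: "p \<in> V" "x \<in> seg m p y" using ab by blast
  have "y \<in> seg m a' p \<or> y \<in> seg m b' p"
    using seg_through'[of a' b' p y] ab' p xy B by blast
  then obtain q where q: "q \<in> V" "y \<in> seg m p q" using ab' seg_commute by blast
  have pq: "p \<in> M" "q \<in> M" using p q B by auto
  have "x \<in> seg m p q" using seg_convex[of p q p y] pq p q by auto
  then have sub: "seg m x y \<subseteq> seg m p q" using seg_convex[of p q x y] pq q by blast
  define W where "W = V \<inter> seg m p q"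
  have W: "finite W" using fin pq by (simp add: W_def)
  define mid where "mid = (\<lambda>(u, v). {z \<in> seg m u v. d u z = d z v})"
  have mid: "finite (mid uv)" if "uv \<in> W \<times> W" for uv
  proof -
    obtain u v where uv: "uv = (u, v)" "u \<in> M" "v \<in> M" using \<open>uv \<in> W \<times> W\<close> B by (auto simp: W_def)
    show ?thesis
    proof (cases "mid uv = {}")
      case False
      then obtain z where "z \<in> mid uv" by blast
      then have "mid uv \<subseteq> {z}" using midpoint_unique[OF uv(2,3)] uv by (auto simp: mid_def)
      then show ?thesis by (rule finite_subset) simp
    qed simp
  qed
  \<comment> \<open>Pairs with u = v satisfy the defining condition too, so the points of V
    themselves occur among the midpoints; they are covered by W.\<close>
  have "?N \<inter> seg m p q \<subseteq> W \<union> (\<Union>uv\<in>W \<times> W. mid uv)"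
  proof
    fix z assume z: "z \<in> ?N \<inter> seg m p q"
    then obtain u v where uv: "u \<in> V" "v \<in> V" "seg m u v \<inter> V = {u, v}" "z \<in> seg m u v" "d u z = d z v"
      by blast
    have zs: "z \<in> seg m p q" using z by (rule IntD2)
    show "z \<in> W \<union> (\<Union>uv\<in>W \<times> W. mid uv)"
    proof (cases "z \<in> V")
      case True then show ?thesis using zs by (simp add: W_def)
    next
      case False
      obtain u' v' where uv': "u' \<in> V" "v' \<in> V" "z \<in> seg m u' v'" "seg m u' v' \<inter> V = {u', v'}"
        "seg m u' v' \<subseteq> seg m p q"
        using adjacent_pair_around[OF p(1) q(1) B(2) zs False fin[OF pq]] .
      have "{u, v} = {u', v'}"
        by (rule adjacent_pair_unique[OF B(1,2) False uv(1,2,4,3) uv'(1-4)])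
      moreover have "u' \<in> M" "v' \<in> M" using uv'(1,2) B(2) by auto
      moreover from this have "u' \<in> seg m u' v'" "v' \<in> seg m u' v'" by simp_all
      ultimately have "u \<in> seg m p q" "v \<in> seg m p q" using uv'(5) by (metis doubleton_eq_iff subsetD)+
      then have "(u, v) \<in> W \<times> W" using uv by (simp add: W_def)
      moreover have "z \<in> mid (u, v)" using uv by (simp add: mid_def)
      ultimately show ?thesis by blast
    qed
  qed
  moreover have "finite (W \<union> (\<Union>uv\<in>W \<times> W. mid uv))" using W mid by blast
  ultimately have "finite (?N \<inter> seg m p q)" by (rule finite_subset)
  then show ?thesis by (rule finite_subset[rotated]) (use sub in blast)
qed

end

section \<open>Construction of an invariant vertex set\<close>

context tree_action
begin

lemma branch_points_invariant:
  assumes g: "g \<in> carrier G" and x: "x \<in> branch_points"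
  shows "act T g x \<in> branch_points"
proof -
  obtain p q r where pqr: "p \<in> M - {x}" "q \<in> M - {x}" "r \<in> M - {x}" "x \<in> M"
    "x \<in> seg (metr T) p q" "x \<in> seg (metr T) q r" "x \<in> seg (metr T) p r"
    using x unfolding branch_points_def by blast
  have "act T g x \<in> seg (metr T) (act T g p) (act T g q)" "act T g x \<in> seg (metr T) (act T g q) (act T g r)"
    "act T g x \<in> seg (metr T) (act T g p) (act T g r)"
    using act_seg[OF g, of p q] act_seg[OF g, of q r] act_seg[OF g, of p r] pqr by blast+
  moreover have mem: "act T g s \<in> M - {act T g x}" if "s \<in> M - {x}" for s
    using that g pqr act_inj[of g s x] by auto
  moreover have "act T g x \<in> M" using g pqr(4) by simp
  ultimately show ?thesis unfolding branch_points_def mem_Collect_eq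
    by (intro conjI bexI[of _ "act T g p"] bexI[of _ "act T g q"] bexI[of _ "act T g r"] mem pqr(1-3))
qed

text \<open>Without branch points the tree is a line. Squares act on it by translations, so their
  commutators act trivially, and a virtually non-abelian free group has infinitely many of them.\<close>

lemma branch_points_nonempty:
  assumes vf: "virtually_nonabelian_free G" and stab: "\<And>x. x \<in> M \<Longrightarrow> finite (stabilizer G (act T) x)"
    and x0: "x0 \<in> M" and x1: "x1 \<in> M" "x0 \<noteq> x1"
  shows "branch_points \<noteq> {}"
proof
  assume B: "branch_points = {}"
  obtain \<phi> :: "'a \<Rightarrow> real" where \<phi>: "\<And>x y. x \<in> M \<Longrightarrow> y \<in> M \<Longrightarrow> \<bar>\<phi> x - \<phi> y\<bar> = d x y"
    using collinear_signed_distance[OF B x0 x1] by blast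
  have inj: "x = y" if "x \<in> M" "y \<in> M" "\<phi> x = \<phi> y" for x y
    using \<phi>[OF that(1,2)] that by simp
  define tr where "tr g \<longleftrightarrow> g \<in> carrier G \<and> (\<exists>c. \<forall>x\<in>M. \<phi> (act T g x) = \<phi> x + c)" for g
  \<comment> \<open>In the coordinate \<open>\<phi>\<close> an isometry has the form t -> s t + c
    with s = 1 or s = -1. The sign is read off from \<open>x0\<close> and \<open>x1\<close>; any
    further point is then determined by its distances to these two, compared through their
    squares.\<close>
  have affine: "\<exists>s c. (s = 1 \<or> s = -1) \<and> (\<forall>x\<in>M. \<phi> (act T g x) = s * \<phi> x + c)"
    if g: "g \<in> carrier G" for g
  proof -
    define D where "D = \<phi> x1 - \<phi> x0"
    have D: "D \<noteq> 0" using inj x0 x1 by (force simp: D_def)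
    define s where "s = (\<phi> (act T g x1) - \<phi> (act T g x0)) / D"
    have "\<bar>\<phi> (act T g x1) - \<phi> (act T g x0)\<bar> = \<bar>D\<bar>"
      using \<phi> g x0 x1 by (simp add: D_def)
    then have s: "s = 1 \<or> s = -1" using D by (auto simp: s_def abs_eq_iff field_simps)
    have sD: "\<phi> (act T g x1) - \<phi> (act T g x0) = s * D" using D by (simp add: s_def)
    have "\<phi> (act T g x) = s * \<phi> x + (\<phi> (act T g x0) - s * \<phi> x0)" if x: "x \<in> M" for x
    proof -
      define a where "a = \<phi> (act T g x) - \<phi> (act T g x0)"
      define b where "b = \<phi> x - \<phi> x0"
      have "\<bar>a\<bar> = \<bar>b\<bar>" using \<phi> g x x0 by (simp add: a_def b_def)
      then have 1: "a\<^sup>2 = b\<^sup>2" by (simp add: abs_eq_iff power2_eq_iff)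
      have "a - s * D = \<phi> (act T g x) - \<phi> (act T g x1)" "b - D = \<phi> x - \<phi> x1"
        using sD by (simp_all add: a_def b_def D_def)
      then have "\<bar>a - s * D\<bar> = \<bar>b - D\<bar>" using \<phi> g x x1 by simp
      then have "(a - s * D)\<^sup>2 = (b - D)\<^sup>2" by (simp add: abs_eq_iff power2_eq_iff)
      moreover have "(a - s * D)\<^sup>2 = a\<^sup>2 - 2 * (s * a * D) + (s * s) * D\<^sup>2" "(b - D)\<^sup>2 = b\<^sup>2 - 2 * (b * D) + D\<^sup>2"
        by (simp_all add: power2_eq_square algebra_simps)
      moreover have "s * s = 1" using s by auto
      ultimately have "s * a * D = b * D" using 1 by simp
      then have "s * a = b" using D by simp
      then have "a = s * b" using s by auto
      then show ?thesis by (simp add: a_def b_def algebra_simps)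
    qed
    then show ?thesis using s by blast
  qed
  have sq: "tr (g \<otimes> g)" if g: "g \<in> carrier G" for g
  proof -
    obtain s c where s: "s = 1 \<or> s = -1" and c: "\<And>x. x \<in> M \<Longrightarrow> \<phi> (act T g x) = s * \<phi> x + c"
      using affine[OF g] by blast
    have "\<phi> (act T (g \<otimes> g) x) = \<phi> x + (s * c + c)" if x: "x \<in> M" for x
      using g x c s by (auto simp: act_mult algebra_simps)
    then show ?thesis using g by (auto simp: tr_def)
  qed
  have comm: "act T (g \<otimes> h \<otimes> inv g \<otimes> inv h) x0 = x0" if gh: "tr g" "tr h" for g h
  proof -
    have G: "g \<in> carrier G" "h \<in> carrier G" using gh by (auto simp: tr_def)
    obtain c where c: "\<And>x. x \<in> M \<Longrightarrow> \<phi> (act T g x) = \<phi> x + c" using gh by (auto simp: tr_def)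
    obtain c' where c': "\<And>x. x \<in> M \<Longrightarrow> \<phi> (act T h x) = \<phi> x + c'" using gh by (auto simp: tr_def)
    have ic: "\<phi> (act T (inv g) x) = \<phi> x - c" if "x \<in> M" for x
      using c[of "act T (inv g) x"] that G by simp
    have ic': "\<phi> (act T (inv h) x) = \<phi> x - c'" if "x \<in> M" for x
      using c'[of "act T (inv h) x"] that G by simp
    have "\<phi> (act T (g \<otimes> h \<otimes> inv g \<otimes> inv h) x0) = \<phi> x0"
      using G x0 by (simp add: act_mult c c' ic ic')
    then show ?thesis using inj G x0 by simp
  qed
  have "{(u \<otimes> u) \<otimes> (v \<otimes> v) \<otimes> inv (u \<otimes> u) \<otimes> inv (v \<otimes> v) | u v. u \<in> carrier G \<and> v \<in> carrier G}
    \<subseteq> stabilizer G (act T) x0"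
    using comm sq by (auto simp: stabilizer_def)
  then show False using virtually_nonabelian_free_commutators[OF vf] stab[OF x0] finite_subset by blast
qed

lemma act_vertices_eq:
  assumes "V \<subseteq> M" "\<And>g x. g \<in> carrier G \<Longrightarrow> x \<in> V \<Longrightarrow> act T g x \<in> V" "g \<in> carrier G"
  shows "act T g ` V = V"
proof
  show "act T g ` V \<subseteq> V" using assms by blast
  show "V \<subseteq> act T g ` V"
  proof
    fix x assume x: "x \<in> V"
    then have "x = act T g (act T (inv g) x)" using assms by auto
    then show "x \<in> act T g ` V" using assms(2)[of "inv g" x] assms(3) x by blast
  qed
qed

lemma adjacent_invariant:
  assumes V: "V \<subseteq> M" "\<And>g x. g \<in> carrier G \<Longrightarrow> x \<in> V \<Longrightarrow> act T g x \<in> V" and g: "g \<in> carrier G"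
    and uv: "u \<in> V" "v \<in> V" "seg (metr T) u v \<inter> V = {u, v}"
  shows "seg (metr T) (act T g u) (act T g v) \<inter> V = {act T g u, act T g v}"
proof -
  have M: "u \<in> M" "v \<in> M" using uv V by auto
  have "act T g ` (seg (metr T) u v \<inter> V) = act T g ` seg (metr T) u v \<inter> act T g ` V"
    by (rule inj_on_image_Int[of _ M]) (use V g act_inj in \<open>auto simp: inj_on_def seg_def\<close>)
  then show ?thesis using act_seg[OF g M] act_vertices_eq[OF V g] uv by simp
qed

lemma inversion_fixes_midpoint:
  assumes g: "g \<in> carrier G" and M: "u \<in> M" "v \<in> M" and gu: "act T g u = v" "act T g v = u"
    and x: "x \<in> seg (metr T) u v" "d u x = d x v"
  shows "act T g x = x"
proof (rule midpoint_unique[OF M])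
  have xM: "x \<in> M" using x(1) seg_subset by blast
  have "act T g x \<in> seg (metr T) (act T g u) (act T g v)" using act_seg[OF g M] x(1) by blast
  then show "act T g x \<in> seg (metr T) u v" using gu seg_commute[of v u] by simp
  show "d u (act T g x) = d (act T g x) v"
    using act_dist[OF g M(2) xM] act_dist[OF g xM M(1)] gu x(2) by (simp add: mdist_commute)
qed (use x in auto)

text \<open>The vertices are the branch points and the midpoints of adjacent ones. Suppose that g
  inverts an edge from u to v. It fixes the midpoint x, which lies between adjacent branch points a
  and b, so g preserves {a, b}. It cannot swap them, since x would be their midpoint and so a
  vertex. If it fixes a, then u and v are equally far from a, although a is on the side of only one
  of them as seen from x.\<close>

lemma invariant_structure_exists:
  assumes min: "minimal_action G T" and V0: "simplicial_structure (metr T) V0"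
    and vf: "virtually_nonabelian_free G" and stab: "\<And>x. x \<in> M \<Longrightarrow> finite (stabilizer G (act T) x)"
  obtains V where "invariant_structure G T V"
proof (cases "\<exists>x\<in>M. \<exists>y\<in>M. x \<noteq> y")
  case False
  \<comment> \<open>A one-point tree has no branch points and is treated apart: its point is the
    only vertex.\<close>
  then have eq: "\<And>x y. x \<in> M \<Longrightarrow> y \<in> M \<Longrightarrow> x = y" by blast
  have "edges (metr T) M = {}" using eq by (auto simp: edges_def)
  moreover have "finite (M \<inter> seg (metr T) x y)" if "x \<in> M" for x y
    by (rule finite_subset[of _ "{x}"]) (use eq that in \<open>auto simp: seg_def\<close>)
  ultimately have "simplicial_structure (metr T) M" by (simp add: simplicial_structure_def)
  then have "invariant_structure G T M"
    using eq action.surj_prop unfolding invariant_structure_def by blast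
  then show thesis by (rule that)
next
  case True
  define B where "B = branch_points"
  have B: "B \<subseteq> M" "B \<noteq> {}" using branch_points_nonempty[OF vf stab] True
    unfolding B_def by (auto simp: branch_points_def)
  have Binv: "\<And>g x. g \<in> carrier G \<Longrightarrow> x \<in> B \<Longrightarrow> act T g x \<in> B"
    using branch_points_invariant unfolding B_def .
  have hull: "seg_hull B = M" by (rule seg_hull_invariant_eq[OF min B Binv])
  have "B \<subseteq> V0" using branch_points_subset_vertices[OF V0] by (simp add: B_def)
  then have finB: "finite (B \<inter> seg (metr T) x y)" if "x \<in> M" "y \<in> M" for x y
    using V0 that unfolding simplicial_structure_def by (meson Int_mono finite_subset order_refl)
  define N where "N = {z. \<exists>u\<in>B. \<exists>v\<in>B. seg (metr T) u v \<inter> B = {u, v} \<and> z \<in> seg (metr T) u v \<and> d u z = d z v}"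
  have finN: "finite (N \<inter> seg (metr T) x y)" if "x \<in> M" "y \<in> M" for x y
    unfolding N_def using finite_midpoints[of B] B hull finB that unfolding B_def by blast
  define V where "V = B \<union> N"
  have NM: "N \<subseteq> M" by (auto simp: N_def seg_def)
  have VM: "V \<subseteq> M" using NM B by (simp add: V_def)
  have Ninv: "act T g z \<in> N" if g: "g \<in> carrier G" and z: "z \<in> N" for g z
  proof -
    obtain u v where uv: "u \<in> B" "v \<in> B" "seg (metr T) u v \<inter> B = {u, v}" "z \<in> seg (metr T) u v" "d u z = d z v"
      using z by (auto simp: N_def)
    have M: "u \<in> M" "v \<in> M" "z \<in> M" using uv B by (auto simp: seg_def)
    have "act T g z \<in> seg (metr T) (act T g u) (act T g v)" using act_seg[OF g M(1,2)] uv by blast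
    moreover have "d (act T g u) (act T g z) = d (act T g z) (act T g v)" using M g uv by simp
    ultimately show ?thesis
      unfolding N_def using adjacent_invariant[OF B(1) Binv g uv(1-3)] Binv[OF g] uv by blast
  qed
  have Vinv: "\<And>g x. g \<in> carrier G \<Longrightarrow> x \<in> V \<Longrightarrow> act T g x \<in> V"
    using Binv Ninv by (auto simp: V_def)
  have "simplicial_structure (metr T) V"
  proof (rule simplicial_structureI)
    show "V \<subseteq> M" "branch_points \<subseteq> V" using VM by (auto simp: V_def B_def)
    show "seg_hull V = M"
      by (rule seg_hull_invariant_eq[OF min VM _ Vinv]) (use B in \<open>auto simp: V_def\<close>)
    show "finite (V \<inter> seg (metr T) x y)" if "x \<in> M" "y \<in> M" for x y
      using finB[OF that] finN[OF that] by (simp add: V_def Int_Un_distrib2)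
  qed
  moreover have "\<forall>g\<in>carrier G. act T g ` V = V" using act_vertices_eq[OF VM Vinv] by blast
  moreover have False
    if g: "g \<in> carrier G" and uv: "u \<in> V" "v \<in> V" "u \<noteq> v" and e: "seg (metr T) u v \<in> edges (metr T) V"
      and gu: "act T g u = v" and gv: "act T g v = u" for g u v
  proof -
    have uvM: "u \<in> M" "v \<in> M" using uv VM by auto
    obtain u1 v1 where uv1: "seg (metr T) u v = seg (metr T) u1 v1" "seg (metr T) u1 v1 \<inter> V = {u1, v1}"
      using e unfolding edges_def by blast
    then have adj: "seg (metr T) u v \<inter> V = {u, v}"
      using seg_ends[OF uvM] uv by (metis (no_types, lifting) IntI doubleton_eq_iff insertE singletonD)
    have dpos: "0 < d u v" using mdist_pos uvM uv by blast
    obtain x where x: "x \<in> seg (metr T) u v" "d u x = d u v / 2" "d x v = d u v - d u v / 2"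
      using seg_point[of u v "d u v / 2"] uvM dpos by auto
    have xM: "x \<in> M" using x by (simp add: seg_def)
    have "x \<noteq> u" "x \<noteq> v" using x dpos uvM by auto
    then have xV: "x \<notin> V" using adj x by blast
    then have xB: "x \<notin> B" by (simp add: V_def)
    have gx: "act T g x = x" by (rule inversion_fixes_midpoint[OF g uvM gu gv x(1)]) (use x in simp)
    have "x \<in> seg_hull B" using hull xM by simp
    then obtain p q where pq: "p \<in> B" "q \<in> B" "x \<in> seg (metr T) p q" unfolding seg_hull_def by blast
    then have pqM: "p \<in> M" "q \<in> M" using B by auto
    obtain a b where ab: "a \<in> B" "b \<in> B" "a \<noteq> b" "x \<in> seg (metr T) a b" "seg (metr T) a b \<inter> B = {a, b}"
      using adjacent_pair_around[OF pq(1,2) B(1) pq(3) xB finB[OF pqM]] .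
    have abM: "a \<in> M" "b \<in> M" using ab B by auto
    have "act T g x \<in> seg (metr T) (act T g a) (act T g b)" using act_seg[OF g abM] ab(4) by blast
    then have "x \<in> seg (metr T) (act T g a) (act T g b)" using gx by simp
    then have "{a, b} = {act T g a, act T g b}"
      by (intro adjacent_pair_unique[OF _ B(1) xB ab(1,2,4,5)] adjacent_invariant[OF B(1) Binv g ab(1,2,5)]
        Binv[OF g] ab(1,2)) (simp_all add: B_def)
    moreover have "act T g a \<noteq> b \<or> act T g b \<noteq> a"
    proof (rule ccontr)
      assume "\<not> ?thesis"
      then have "d a x = d x b" using act_dist[OF g abM(1) xM] gx by (simp add: mdist_commute)
      then have "x \<in> N" using ab unfolding N_def by blast
      then show False using xV by (simp add: V_def)
    qed
    ultimately have ga: "act T g a = a" by (metis doubleton_eq_iff)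
    have dau: "d a u = d a v" using act_dist[OF g abM(1) uvM(1)] ga gu by simp
    have "x \<noteq> a" "x \<notin> branch_points" using xB ab by (auto simp: B_def)
    then have "x \<notin> seg (metr T) u a \<or> x \<notin> seg (metr T) v a"
      using not_branchD[of x u v a] x uvM abM \<open>x \<noteq> u\<close> \<open>x \<noteq> v\<close> by blast
    moreover have "x \<in> seg (metr T) u a \<or> x \<in> seg (metr T) v a"
      using seg_through[OF uvM abM(1) x(1)] seg_commute by blast
    moreover have "d u x = d v x" using x by (simp add: mdist_commute)
    ultimately show False using dau xM by (auto simp: seg_def mdist_commute)
  qed
  ultimately have "invariant_structure G T V" unfolding invariant_structure_def by blast
  then show thesis by (rule that)
qed

end

section \<open>Orbit counting and volume\<close>

text \<open>The base B, a set of orbits in the applications, is not known to be finite. If it is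
  infinite, then so is A, and both sums are 0 by convention.\<close>

lemma sum_fibers:
  fixes f :: "'x \<Rightarrow> real"
  assumes surj: "p ` A = B" and fin: "\<And>b. b \<in> B \<Longrightarrow> finite {a \<in> A. p a = b}"
    and sum: "\<And>b. b \<in> B \<Longrightarrow> (\<Sum>a\<in>{a \<in> A. p a = b}. f a) = g b"
  shows "sum f A = sum g B"
proof (cases "finite B")
  case True
  have "A = (\<Union>b\<in>B. {a \<in> A. p a = b})" using surj by auto
  also have "finite \<dots>" using True fin by blast
  finally have "finite A" .
  then have "sum f A = (\<Sum>b\<in>B. \<Sum>a\<in>{a \<in> A. p a = b}. f a)"
    using True surj by (intro sum.group[symmetric]) auto
  also have "\<dots> = sum g B" using sum by simp
  finally show ?thesis .
next
  case False
  then have "infinite A" using surj by blast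
  with False show ?thesis by simp
qed

section \<open>Weighted orbit counts for an abstract action\<close>

definition orbit_count ::
    "('g, 'b) monoid_scheme \<Rightarrow> 'e set \<Rightarrow> ('g \<Rightarrow> 'e \<Rightarrow> 'e) \<Rightarrow> ('e \<Rightarrow> real) \<Rightarrow> real" where
  "orbit_count G E \<phi> w = (\<Sum>Q\<in>orbits G E \<phi>.
     let e = (SOME e. e \<in> Q) in w e / real (card (stabilizer G \<phi> e)))"

text \<open>\<open>group_action\<close> demands maps that are extensional on E, which the image maps
  on edges are not. Here only the values on E matter.\<close>

locale set_action = group G for G (structure) +
  fixes E :: "'e set" and \<phi> :: "'a \<Rightarrow> 'e \<Rightarrow> 'e"
  assumes closed: "g \<in> carrier G \<Longrightarrow> e \<in> E \<Longrightarrow> \<phi> g e \<in> E"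
    and one: "e \<in> E \<Longrightarrow> \<phi> \<one> e = e"
    and mult: "g \<in> carrier G \<Longrightarrow> h \<in> carrier G \<Longrightarrow> e \<in> E \<Longrightarrow> \<phi> (g \<otimes> h) e = \<phi> g (\<phi> h e)"
begin

lemma inverse [simp]:
  "g \<in> carrier G \<Longrightarrow> e \<in> E \<Longrightarrow> \<phi> (inv g) (\<phi> g e) = e"
  "g \<in> carrier G \<Longrightarrow> e \<in> E \<Longrightarrow> \<phi> g (\<phi> (inv g) e) = e"
  using mult[of "inv g" g e] mult[of g "inv g" e] one by auto

lemma orbit_self: "e \<in> E \<Longrightarrow> e \<in> orbit G \<phi> e"
  unfolding orbit_def using one[of e] by force

lemma orbit_subset: "e \<in> E \<Longrightarrow> orbit G \<phi> e \<subseteq> E"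
  unfolding orbit_def using closed by auto

lemma orbit_act:
  assumes e: "e \<in> E" and g: "g \<in> carrier G"
  shows "orbit G \<phi> (\<phi> g e) = orbit G \<phi> e"
proof (intro equalityI subsetI)
  fix f assume "f \<in> orbit G \<phi> (\<phi> g e)"
  then obtain h where h: "h \<in> carrier G" "f = \<phi> h (\<phi> g e)" by (auto simp: orbit_def)
  then have "f = \<phi> (h \<otimes> g) e" using e g by (simp add: mult)
  then show "f \<in> orbit G \<phi> e" unfolding orbit_def using h g by blast
next
  fix f assume "f \<in> orbit G \<phi> e"
  then obtain h where h: "h \<in> carrier G" "f = \<phi> h e" by (auto simp: orbit_def)
  then have "f = \<phi> (h \<otimes> inv g) (\<phi> g e)" using e g by (simp add: mult closed)
  moreover have "h \<otimes> inv g \<in> carrier G" using h g by simp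
  ultimately show "f \<in> orbit G \<phi> (\<phi> g e)" unfolding orbit_def by blast
qed

lemma orbit_eq:
  assumes "e \<in> E" "f \<in> orbit G \<phi> e" shows "orbit G \<phi> f = orbit G \<phi> e"
proof -
  obtain g where "g \<in> carrier G" "f = \<phi> g e" using assms by (auto simp: orbit_def)
  then show ?thesis using orbit_act assms by simp
qed

lemma card_stabilizer_act:
  assumes e: "e \<in> E" and g: "g \<in> carrier G"
  shows "card (stabilizer G \<phi> (\<phi> g e)) = card (stabilizer G \<phi> e)"
proof -
  have "bij_betw (\<lambda>h. g \<otimes> h \<otimes> inv g) (stabilizer G \<phi> e) (stabilizer G \<phi> (\<phi> g e))"
  proof (rule bij_betw_byWitness[where f' = "\<lambda>h. inv g \<otimes> h \<otimes> g"])
    show "\<forall>h\<in>stabilizer G \<phi> e. inv g \<otimes> (g \<otimes> h \<otimes> inv g) \<otimes> g = h"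
      using g by (auto simp: stabilizer_def m_assoc inv_solve_left')
    show "\<forall>h\<in>stabilizer G \<phi> (\<phi> g e). g \<otimes> (inv g \<otimes> h \<otimes> g) \<otimes> inv g = h"
      using g by (auto simp: stabilizer_def m_assoc) (simp add: m_assoc[symmetric])
    show "(\<lambda>h. g \<otimes> h \<otimes> inv g) ` stabilizer G \<phi> e \<subseteq> stabilizer G \<phi> (\<phi> g e)"
      using g e by (auto simp: stabilizer_def mult closed)
    show "(\<lambda>h. inv g \<otimes> h \<otimes> g) ` stabilizer G \<phi> (\<phi> g e) \<subseteq> stabilizer G \<phi> e"
      using g e by (auto simp: stabilizer_def mult closed)
  qed
  then show ?thesis by (simp add: bij_betw_same_card)
qed

text \<open>Weight and order of the stabilizer are constant along an orbit, so the representative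
  picked by \<open>SOME\<close> can be exchanged for any other.\<close>

lemma orbit_term:
  assumes w: "\<And>g e. g \<in> carrier G \<Longrightarrow> e \<in> E \<Longrightarrow> w (\<phi> g e) = w e" and e: "e \<in> E"
  shows "(let f = SOME f. f \<in> orbit G \<phi> e in w f / real (card (stabilizer G \<phi> f)))
    = w e / real (card (stabilizer G \<phi> e))"
proof -
  have "(SOME f. f \<in> orbit G \<phi> e) \<in> orbit G \<phi> e"
    by (rule someI[of _ e]) (rule orbit_self[OF e])
  then obtain g where "g \<in> carrier G" "(SOME f. f \<in> orbit G \<phi> e) = \<phi> g e" unfolding orbit_def by blast
  then show ?thesis using w e card_stabilizer_act by (simp add: Let_def)
qed

lemma restrict_set_action:
  assumes "subgroup H G" shows "set_action (G\<lparr>carrier := H\<rparr>) E \<phi>"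
proof -
  interpret H: subgroup H G by fact
  show ?thesis
    by (intro set_action.intro set_action_axioms.intro subgroup_imp_group[OF assms])
      (auto simp: closed one mult)
qed

lemma orbit_coset:
  assumes "subgroup H G" "g \<in> carrier G" "e \<in> E"
  shows "orbit (G\<lparr>carrier := H\<rparr>) \<phi> (\<phi> g e) = (\<lambda>c. \<phi> c e) ` (H #> g)"
proof -
  interpret H: subgroup H G by fact
  have "\<phi> h (\<phi> g e) = \<phi> (h \<otimes> g) e" if "h \<in> H" for h using that assms by (simp add: mult)
  then show ?thesis by (force simp: orbit_def r_coset_def)
qed

text \<open>The cosets \<open>Hg\<close> such that \<open>g e\<close> lies in a given \<open>H\<close>-orbit of \<open>e' = g0 e\<close> are the images of
  the elements of \<open>G\<close> that map \<open>e\<close> to \<open>e'\<close>, a coset of the stabilizer of \<open>e\<close>; each of them is hit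
  once for each element of the stabilizer of \<open>e'\<close> in \<open>H\<close>.\<close>

lemma card_cosets_into_orbit:
  assumes H: "subgroup H G" and e: "e \<in> E" and g0: "g0 \<in> carrier G"
    and fin: "finite (stabilizer G \<phi> e)"
  defines "C \<equiv> {c \<in> rcosets H. (\<lambda>g. \<phi> g e) ` c = orbit (G\<lparr>carrier := H\<rparr>) \<phi> (\<phi> g0 e)}"
  shows "card C * card (stabilizer (G\<lparr>carrier := H\<rparr>) \<phi> (\<phi> g0 e)) = card (stabilizer G \<phi> e)"
proof -
  interpret H: subgroup H G by fact
  interpret HA: set_action "G\<lparr>carrier := H\<rparr>" E \<phi> by (rule restrict_set_action[OF H])
  define S where "S = {g \<in> carrier G. \<phi> g e = \<phi> g0 e}"
  define e' where "e' = \<phi> g0 e"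
  have e': "e' \<in> E" using e g0 closed by (simp add: e'_def)
  have "bij_betw (\<lambda>h. g0 \<otimes> h) (stabilizer G \<phi> e) S"
  proof (rule bij_betw_byWitness[where f' = "\<lambda>h. inv g0 \<otimes> h"])
    show "\<forall>h\<in>stabilizer G \<phi> e. inv g0 \<otimes> (g0 \<otimes> h) = h"
      using g0 by (auto simp: stabilizer_def inv_solve_left')
    show "\<forall>h\<in>S. g0 \<otimes> (inv g0 \<otimes> h) = h"
      using g0 by (auto simp: S_def m_assoc[symmetric])
    show "(\<lambda>h. g0 \<otimes> h) ` stabilizer G \<phi> e \<subseteq> S"
      using g0 e by (auto simp: stabilizer_def S_def mult)
    show "(\<lambda>h. inv g0 \<otimes> h) ` S \<subseteq> stabilizer G \<phi> e"
      using g0 e by (auto simp: stabilizer_def S_def mult closed)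
  qed
  then have cardS: "card S = card (stabilizer G \<phi> e)" and finS: "finite S"
    using fin by (simp_all add: bij_betw_same_card bij_betw_finite)
  have SC: "(\<lambda>g. H #> g) ` S = C"
  proof (intro equalityI subsetI)
    fix c assume "c \<in> (\<lambda>g. H #> g) ` S"
    then obtain g where g: "g \<in> carrier G" "\<phi> g e = \<phi> g0 e" "c = H #> g" by (auto simp: S_def)
    then show "c \<in> C" unfolding C_def using orbit_coset[OF H g(1) e] by (auto simp: RCOSETS_def)
  next
    fix c assume c: "c \<in> C"
    then obtain g where g: "g \<in> carrier G" "c = H #> g" by (auto simp: C_def RCOSETS_def)
    have "orbit (G\<lparr>carrier := H\<rparr>) \<phi> (\<phi> g e) = orbit (G\<lparr>carrier := H\<rparr>) \<phi> e'"
      using c g orbit_coset[OF H g(1) e] by (simp add: C_def e'_def)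
    then have "e' \<in> orbit (G\<lparr>carrier := H\<rparr>) \<phi> (\<phi> g e)" using HA.orbit_self[OF e'] by simp
    then obtain h where h: "h \<in> H" "e' = \<phi> h (\<phi> g e)" by (auto simp: orbit_def)
    have "h \<in> carrier G" using h H.subset by blast
    then have "h \<otimes> g \<in> S" using h g e by (simp add: S_def mult e'_def)
    moreover have "H #> (h \<otimes> g) = c"
      using h g H.subset coset_mult_assoc[of H h g] H.rcos_const[OF is_group h(1)] by simp
    ultimately show "c \<in> (\<lambda>g. H #> g) ` S" by blast
  qed
  have "card {g \<in> S. H #> g = c} = card (stabilizer (G\<lparr>carrier := H\<rparr>) \<phi> e')" if c: "c \<in> C" for c
  proof -
    obtain g where g: "g \<in> S" "c = H #> g" using c SC by blast
    have gG: "g \<in> carrier G" "\<phi> g e = e'" using g by (auto simp: S_def e'_def)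
    have "bij_betw (\<lambda>h. h \<otimes> g) (stabilizer (G\<lparr>carrier := H\<rparr>) \<phi> e') {g' \<in> S. H #> g' = c}"
    proof (rule bij_betw_byWitness[where f' = "\<lambda>h. h \<otimes> inv g"])
      show "\<forall>h\<in>stabilizer (G\<lparr>carrier := H\<rparr>) \<phi> e'. h \<otimes> g \<otimes> inv g = h"
        using gG H.subset by (auto simp: stabilizer_def m_assoc)
      show "\<forall>h\<in>{g' \<in> S. H #> g' = c}. h \<otimes> inv g \<otimes> g = h"
        using gG by (auto simp: S_def m_assoc)
      show "(\<lambda>h. h \<otimes> g) ` stabilizer (G\<lparr>carrier := H\<rparr>) \<phi> e' \<subseteq> {g' \<in> S. H #> g' = c}"
      proof
        fix k assume "k \<in> (\<lambda>h. h \<otimes> g) ` stabilizer (G\<lparr>carrier := H\<rparr>) \<phi> e'"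
        then obtain h where h: "h \<in> H" "\<phi> h e' = e'" "k = h \<otimes> g" by (auto simp: stabilizer_def)
        have "h \<in> carrier G" using h H.subset by blast
        then have "k \<in> S" using h gG e by (simp add: S_def mult e'_def)
        moreover have "H #> k = c"
          using h g gG H.subset coset_mult_assoc[of H h g] H.rcos_const[OF is_group h(1)] \<open>h \<in> carrier G\<close> by simp
        ultimately show "k \<in> {g' \<in> S. H #> g' = c}" by simp
      qed
      show "(\<lambda>h. h \<otimes> inv g) ` {g' \<in> S. H #> g' = c} \<subseteq> stabilizer (G\<lparr>carrier := H\<rparr>) \<phi> e'"
      proof
        fix k assume "k \<in> (\<lambda>h. h \<otimes> inv g) ` {g' \<in> S. H #> g' = c}"
        then obtain g' where g': "g' \<in> S" "H #> g' = c" "k = g' \<otimes> inv g" by blast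
        have g'G: "g' \<in> carrier G" "\<phi> g' e = e'" using g' by (auto simp: S_def e'_def)
        have "g' \<in> H #> g" using rcos_self[OF g'G(1) H] g' g by simp
        then obtain h where h: "h \<in> H" "g' = h \<otimes> g" by (auto simp: r_coset_def)
        have hG: "h \<in> carrier G" using h H.subset by blast
        then have "k = h" using h g' gG by (simp add: m_assoc)
        moreover have "\<phi> h e' = e'" using h hG gG g'G e mult[of h g e] by simp
        ultimately show "k \<in> stabilizer (G\<lparr>carrier := H\<rparr>) \<phi> e'" using h by (simp add: stabilizer_def)
      qed
    qed
    then show ?thesis by (simp add: bij_betw_same_card)
  qed
  moreover have "card S = (\<Sum>c\<in>C. card {g \<in> S. H #> g = c})"
    using sum.group[of S C "\<lambda>g. H #> g" "\<lambda>_. 1 :: nat"] finS SC finite_imageI[OF finS, of "\<lambda>g. H #> g"] by simp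
  ultimately show ?thesis using cardS by (simp add: e'_def)
qed

text \<open>Inside the G-orbit of e, an H-orbit contributes w e divided by the order of a stabilizer
  in H. By \<open>card_cosets_into_orbit\<close> this is w e / |Stab e| times the number of cosets
  that carry e into that H-orbit. Every coset carries e into exactly one H-orbit, so these numbers
  add up to the index.\<close>

lemma orbit_count_subgroup:
  assumes H: "subgroup H G" and n: "finite (rcosets H)"
    and fin: "\<And>e. e \<in> E \<Longrightarrow> finite (stabilizer G \<phi> e)"
    and w: "\<And>g e. g \<in> carrier G \<Longrightarrow> e \<in> E \<Longrightarrow> w (\<phi> g e) = w e"
  shows "orbit_count (G\<lparr>carrier := H\<rparr>) E \<phi> w = real (card (rcosets H)) * orbit_count G E \<phi> w"
proof -
  interpret H: subgroup H G by fact
  interpret HA: set_action "G\<lparr>carrier := H\<rparr>" E \<phi> by (rule restrict_set_action[OF H])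
  let ?H = "G\<lparr>carrier := H\<rparr>"
  have wH: "\<And>g e. g \<in> carrier ?H \<Longrightarrow> e \<in> E \<Longrightarrow> w (\<phi> g e) = w e" using w by simp
  define p where "p Q = (\<Union>e\<in>Q. orbit G \<phi> e)" for Q
  have p: "p (orbit ?H \<phi> e) = orbit G \<phi> e" if e: "e \<in> E" for e
  proof -
    have "orbit G \<phi> f = orbit G \<phi> e" if f: "f \<in> orbit ?H \<phi> e" for f
    proof -
      obtain h where "h \<in> H" "f = \<phi> h e" using f by (auto simp: orbit_def)
      then show ?thesis using orbit_act[OF e] H.subset by auto
    qed
    then have "p (orbit ?H \<phi> e) = (\<Union>f\<in>orbit ?H \<phi> e. orbit G \<phi> e)"
      unfolding p_def by (intro SUP_cong refl)
    moreover have "orbit ?H \<phi> e \<noteq> {}" using HA.orbit_self[OF e] by blast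
    ultimately show ?thesis by simp
  qed
  have fiber: "{Q \<in> orbits ?H E \<phi>. p Q = orbit G \<phi> e} = (\<lambda>c. (\<lambda>g. \<phi> g e) ` c) ` (rcosets H)"
    if e: "e \<in> E" for e
  proof (intro equalityI subsetI)
    fix Q assume Q: "Q \<in> {Q \<in> orbits ?H E \<phi>. p Q = orbit G \<phi> e}"
    then obtain f where f: "f \<in> E" "Q = orbit ?H \<phi> f" by (auto simp: orbits_def)
    then have "f \<in> orbit G \<phi> e" using Q p orbit_self by auto
    then obtain g where g: "g \<in> carrier G" "f = \<phi> g e" by (auto simp: orbit_def)
    then have "Q = (\<lambda>g. \<phi> g e) ` (H #> g)" using f orbit_coset[OF H g(1) e] by simp
    then show "Q \<in> (\<lambda>c. (\<lambda>g. \<phi> g e) ` c) ` (rcosets H)" using g by (auto simp: RCOSETS_def)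
  next
    fix Q assume "Q \<in> (\<lambda>c. (\<lambda>g. \<phi> g e) ` c) ` (rcosets H)"
    then obtain g where g: "g \<in> carrier G" "Q = (\<lambda>g. \<phi> g e) ` (H #> g)" by (auto simp: RCOSETS_def)
    then have Q: "Q = orbit ?H \<phi> (\<phi> g e)" using orbit_coset[OF H g(1) e] by simp
    have ge: "\<phi> g e \<in> E" using g e closed by simp
    have "p Q = orbit G \<phi> e" using Q p[OF ge] orbit_act[OF e g(1)] by simp
    then show "Q \<in> {Q \<in> orbits ?H E \<phi>. p Q = orbit G \<phi> e}" using Q ge by (auto simp: orbits_def)
  qed
  define t where "t Q = (let e = (SOME e. e \<in> Q) in w e / real (card (stabilizer ?H \<phi> e)))" for Q
  define s where "s Q = real (card (rcosets H)) * (let e = (SOME e. e \<in> Q) in w e / real (card (stabilizer G \<phi> e)))" for Q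
  have "sum t (orbits ?H E \<phi>) = sum s (orbits G E \<phi>)"
  proof (rule sum_fibers)
    show "p ` orbits ?H E \<phi> = orbits G E \<phi>"
      using p by (force simp: orbits_def)
    fix Q assume "Q \<in> orbits G E \<phi>"
    then obtain e where e: "e \<in> E" "Q = orbit G \<phi> e" by (auto simp: orbits_def)
    define F where "F = {Q' \<in> orbits ?H E \<phi>. p Q' = Q}"
    have F: "F = (\<lambda>c. (\<lambda>g. \<phi> g e) ` c) ` (rcosets H)" using fiber[OF e(1)] e by (simp add: F_def)
    show "finite {Q' \<in> orbits ?H E \<phi>. p Q' = Q}" using F n by (simp add: F_def)
    have fc: "card (stabilizer G \<phi> e) > 0"
    proof -
      have "\<one> \<in> stabilizer G \<phi> e" using one e by (simp add: stabilizer_def)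
      then show ?thesis using fin[OF e(1)] card_gt_0_iff by blast
    qed
    have "t Q' = w e / real (card (stabilizer G \<phi> e)) *
        real (card {c \<in> rcosets H. (\<lambda>g. \<phi> g e) ` c = Q'})" if Q': "Q' \<in> F" for Q'
    proof -
      obtain g where g: "g \<in> carrier G" "Q' = (\<lambda>g. \<phi> g e) ` (H #> g)"
        using Q' F by (auto simp: RCOSETS_def)
      then have Oe: "Q' = orbit ?H \<phi> (\<phi> g e)" using orbit_coset[OF H g(1) e(1)] by simp
      have ge: "\<phi> g e \<in> E" using g e closed by simp
      have tQ: "t Q' = w e / real (card (stabilizer ?H \<phi> (\<phi> g e)))"
        unfolding t_def Oe using HA.orbit_term[OF wH ge] w[OF g(1) e(1)] by simp
      have k: "card {c \<in> rcosets H. (\<lambda>g. \<phi> g e) ` c = Q'} * card (stabilizer ?H \<phi> (\<phi> g e))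
          = card (stabilizer G \<phi> e)"
        using card_cosets_into_orbit[OF H e(1) g(1) fin[OF e(1)]] Oe by simp
      have eq: "x / b = x / c * a" if "c = a * b" "c > 0" for x a b c :: real
        using that by auto
      show ?thesis unfolding tQ
        by (rule eq) (use arg_cong[OF k, of real] fc in simp_all)
    qed
    then have "sum t F = (\<Sum>Q'\<in>F. w e / real (card (stabilizer G \<phi> e)) *
        real (card {c \<in> rcosets H. (\<lambda>g. \<phi> g e) ` c = Q'}))" by simp
    also have "\<dots> = w e / real (card (stabilizer G \<phi> e)) *
        real (\<Sum>Q'\<in>F. card {c \<in> rcosets H. (\<lambda>g. \<phi> g e) ` c = Q'})"
      by (simp add: sum_distrib_left)
    also have "(\<Sum>Q'\<in>F. card {c \<in> rcosets H. (\<lambda>g. \<phi> g e) ` c = Q'}) = card (rcosets H)"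
      using sum.group[of "rcosets H" F "\<lambda>c. (\<lambda>g. \<phi> g e) ` c" "\<lambda>_. 1 :: nat"] n F by simp
    also have "w e / real (card (stabilizer G \<phi> e)) * real (card (rcosets H)) = s Q"
      using orbit_term[OF w e(1)] e by (simp add: s_def)
    finally show "(\<Sum>a\<in>{Q' \<in> orbits ?H E \<phi>. p Q' = Q}. t a) = s Q" by (simp add: F_def)
  qed
  then show ?thesis unfolding orbit_count_def t_def s_def by (simp add: sum_distrib_left)
qed

end

text \<open>The intended \<pi> sends an edge of a subdivision to the edge containing it. By
  \<open>inj\<close> an element preserving e fixes each f over e. So the f over e lie in different
  orbits and all have the stabilizer of e; their terms have a common denominator and only the
  weights are added.\<close>

lemma orbit_count_refine:
  fixes G (structure)
  assumes A: "set_action G E \<phi>" and A': "set_action G E' \<phi>'"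
    and \<pi>: "\<And>f. f \<in> E' \<Longrightarrow> \<pi> f \<in> E"
    and eqv: "\<And>g f. g \<in> carrier G \<Longrightarrow> f \<in> E' \<Longrightarrow> \<pi> (\<phi>' g f) = \<phi> g (\<pi> f)"
    and inj: "\<And>g f. g \<in> carrier G \<Longrightarrow> f \<in> E' \<Longrightarrow> \<phi> g (\<pi> f) = \<pi> f \<Longrightarrow> \<phi>' g f = f"
    and fin: "\<And>e. e \<in> E \<Longrightarrow> finite {f \<in> E'. \<pi> f = e}" "\<And>e. e \<in> E \<Longrightarrow> {f \<in> E'. \<pi> f = e} \<noteq> {}"
    and sum: "\<And>e. e \<in> E \<Longrightarrow> (\<Sum>f\<in>{f \<in> E'. \<pi> f = e}. w' f) = w e"
    and w: "\<And>g e. g \<in> carrier G \<Longrightarrow> e \<in> E \<Longrightarrow> w (\<phi> g e) = w e"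
    and w': "\<And>g f. g \<in> carrier G \<Longrightarrow> f \<in> E' \<Longrightarrow> w' (\<phi>' g f) = w' f"
  shows "orbit_count G E' \<phi>' w' = orbit_count G E \<phi> w"
  unfolding orbit_count_def
proof (rule sum_fibers[where p = "\<lambda>Q. \<pi> ` Q"])
  interpret A: set_action G E \<phi> by fact
  interpret A': set_action G E' \<phi>' by fact
  have orb: "\<pi> ` orbit G \<phi>' f = orbit G \<phi> (\<pi> f)" if "f \<in> E'" for f
    using eqv that by (force simp: orbit_def)
  show "(\<lambda>Q. \<pi> ` Q) ` orbits G E' \<phi>' = orbits G E \<phi>"
  proof (intro equalityI subsetI)
    fix Q assume "Q \<in> (\<lambda>Q. \<pi> ` Q) ` orbits G E' \<phi>'"
    then show "Q \<in> orbits G E \<phi>" using orb \<pi> by (force simp: orbits_def)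
  next
    fix Q assume "Q \<in> orbits G E \<phi>"
    then obtain e where e: "e \<in> E" "Q = orbit G \<phi> e" by (auto simp: orbits_def)
    then obtain f where "f \<in> E'" "\<pi> f = e" using fin(2) by blast
    then have "orbit G \<phi>' f \<in> orbits G E' \<phi>'" "Q = \<pi> ` orbit G \<phi>' f"
      using orb e by (auto simp: orbits_def)
    then show "Q \<in> (\<lambda>Q. \<pi> ` Q) ` orbits G E' \<phi>'" by blast
  qed
  fix Q assume "Q \<in> orbits G E \<phi>"
  then obtain e where e: "e \<in> E" "Q = orbit G \<phi> e" by (auto simp: orbits_def)
  define P where "P = {f \<in> E'. \<pi> f = e}"
  have fiber: "{Q' \<in> orbits G E' \<phi>'. \<pi> ` Q' = Q} = orbit G \<phi>' ` P"
  proof (intro equalityI subsetI)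
    fix Q' assume Q': "Q' \<in> {Q' \<in> orbits G E' \<phi>'. \<pi> ` Q' = Q}"
    then obtain f where f: "f \<in> E'" "Q' = orbit G \<phi>' f" by (auto simp: orbits_def)
    have "e \<in> \<pi> ` Q'" using Q' A.orbit_self e by auto
    then obtain f' where f': "f' \<in> Q'" "\<pi> f' = e" by blast
    then have "f' \<in> P" using f A'.orbit_subset by (auto simp: P_def)
    moreover have "Q' = orbit G \<phi>' f'" using f f' A'.orbit_eq by auto
    ultimately show "Q' \<in> orbit G \<phi>' ` P" by blast
  next
    fix Q' assume "Q' \<in> orbit G \<phi>' ` P"
    then show "Q' \<in> {Q' \<in> orbits G E' \<phi>'. \<pi> ` Q' = Q}"
      using orb e by (auto simp: P_def orbits_def)
  qed
  show "finite {Q' \<in> orbits G E' \<phi>'. \<pi> ` Q' = Q}" unfolding fiber using fin e by (simp add: P_def)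
  have injP: "inj_on (orbit G \<phi>') P"
  proof (rule inj_onI)
    fix f f' assume f: "f \<in> P" "f' \<in> P" "orbit G \<phi>' f = orbit G \<phi>' f'"
    then have "f \<in> orbit G \<phi>' f'" using A'.orbit_self by (auto simp: P_def)
    then obtain g where g: "g \<in> carrier G" "f = \<phi>' g f'" by (auto simp: orbit_def)
    then have "\<phi> g (\<pi> f') = \<pi> f'" using f eqv by (auto simp: P_def)
    then show "f = f'" using inj g f by (simp add: P_def)
  qed
  have stab: "stabilizer G \<phi>' f = stabilizer G \<phi> e" if "f \<in> P" for f
    using that inj eqv by (fastforce simp: P_def stabilizer_def)
  let ?t = "\<lambda>Q. let e = (SOME e. e \<in> Q) in w' e / real (card (stabilizer G \<phi>' e))"
  have "(\<Sum>Q'\<in>orbit G \<phi>' ` P. ?t Q') = (\<Sum>f\<in>P. ?t (orbit G \<phi>' f))"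
    using sum.reindex[OF injP] by simp
  also have "\<dots> = (\<Sum>f\<in>P. w' f / real (card (stabilizer G \<phi> e)))"
    using A'.orbit_term[OF w'] stab by (intro sum.cong) (auto simp: P_def)
  also have "\<dots> = w e / real (card (stabilizer G \<phi> e))"
    using sum[OF e(1)] by (simp add: P_def sum_divide_distrib[symmetric])
  also have "\<dots> = (let e = (SOME e. e \<in> Q) in w e / real (card (stabilizer G \<phi> e)))"
    using A.orbit_term[OF w e(1)] e by simp
  finally show "(\<Sum>Q'\<in>{Q' \<in> orbits G E' \<phi>'. \<pi> ` Q' = Q}. ?t Q')
    = (let e = (SOME e. e \<in> Q) in w e / real (card (stabilizer G \<phi> e)))" unfolding fiber .
qed

section \<open>Edges of a simplicial structure and their subdivision\<close>

context rtree
begin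

lemma edgeE:
  assumes "e \<in> edges m V"
  obtains u v where "e = seg m u v" "u \<in> V" "v \<in> V" "u \<noteq> v" "seg m u v \<inter> V = {u, v}"
  using assms unfolding edges_def by blast

lemma edge_length_seg:
  assumes "x \<in> M" "y \<in> M" shows "edge_length m (seg m x y) = d x y"
  unfolding edge_length_def
proof (rule cSup_eq_maximum)
  show "d x y \<in> {d p q |p q. p \<in> seg m x y \<and> q \<in> seg m x y}"
    using seg_ends[OF assms] by blast
  fix r assume "r \<in> {d p q |p q. p \<in> seg m x y \<and> q \<in> seg m x y}"
  then obtain p q where pq: "r = d p q" "p \<in> seg m x y" "q \<in> seg m x y" by blast
  then show "r \<le> d x y"
    using seg_dist[OF assms pq(2,3)] seg_le(1)[OF pq(2)] seg_le(1)[OF pq(3)]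
      mdist_nonneg[of m x p] mdist_nonneg[of m x q] by linarith
qed

lemma edge_interior:
  assumes "e \<in> edges m V" "V \<subseteq> M"
  obtains x where "x \<in> e" "x \<in> M" "x \<notin> V"
proof -
  obtain u v where uv: "e = seg m u v" "u \<in> V" "v \<in> V" "u \<noteq> v" "seg m u v \<inter> V = {u, v}"
    using edgeE[OF assms(1)] .
  have M: "u \<in> M" "v \<in> M" using uv assms by auto
  have pos: "0 < d u v" using mdist_pos M uv by simp
  obtain x where x: "x \<in> seg m u v" "d u x = d u v / 2" "d x v = d u v - d u v / 2"
    using seg_point[of u v "d u v / 2"] M pos by auto
  have "x \<noteq> u" "x \<noteq> v" using x pos M by auto
  then have "x \<notin> V" using x(1) uv(5) by blast
  then show thesis using that x(1) uv(1) seg_subset by blast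
qed

text \<open>Induction on the number of vertices in the segment: an inner vertex p splits it into two
  segments with fewer vertices, and no edge straddles p because an edge contains no vertex besides
  its ends.\<close>

lemma edges_in_segment:
  assumes "V \<subseteq> M" "a \<in> V" "b \<in> V" "finite (V \<inter> seg m a b)"
  shows "finite {e \<in> edges m V. e \<subseteq> seg m a b} \<and>
    (\<Sum>e\<in>{e \<in> edges m V. e \<subseteq> seg m a b}. edge_length m e) = d a b"
  using assms
proof (induction "card (V \<inter> seg m a b)" arbitrary: a b rule: less_induct)
  case less
  have M: "a \<in> M" "b \<in> M" using less by auto
  have within: "u \<in> seg m x y \<inter> V \<and> v \<in> seg m x y \<inter> V"
    if "seg m u v \<subseteq> seg m x y" "u \<in> V" "v \<in> V" for u v x y
  proof -
    have "u \<in> M" "v \<in> M" using that less.prems(1) by auto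
    then show ?thesis using that seg_ends[of u v] by blast
  qed
  consider "a = b" | "a \<noteq> b" "V \<inter> seg m a b = {a, b}" | "\<exists>p. p \<in> V \<inter> seg m a b \<and> p \<noteq> a \<and> p \<noteq> b"
    using M less.prems(2,3) by force
  then show ?case
  proof cases
    case 1
    have emp: "{e \<in> edges m V. e \<subseteq> seg m a b} = {}"
    proof (rule ccontr)
      assume "\<not> ?thesis"
      then obtain e where e: "e \<in> edges m V" "e \<subseteq> seg m a b" by blast
      obtain u v where uv: "e = seg m u v" "u \<in> V" "v \<in> V" "u \<noteq> v" using edgeE[OF e(1)] by metis
      then show False using within[of u v a b] e(2) 1 M by auto
    qed
    have "d a b = 0" using 1 M by simp
    then show ?thesis unfolding emp by simp
  next
    case 2
    have "{e \<in> edges m V. e \<subseteq> seg m a b} = {seg m a b}"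
    proof (intro equalityI subsetI)
      fix e assume e: "e \<in> {e \<in> edges m V. e \<subseteq> seg m a b}"
      then have "e \<in> edges m V" by simp
      then obtain u v where uv: "e = seg m u v" "u \<in> V" "v \<in> V" "u \<noteq> v" by (rule edgeE)
      then have "u \<in> {a, b}" "v \<in> {a, b}" using within[of u v a b] e 2 by auto
      then show "e \<in> {seg m a b}" using uv(1,4) seg_commute[of a b] by auto
    next
      fix e assume "e \<in> {seg m a b}"
      moreover have "seg m a b \<inter> V = {a, b}" using 2 by (simp add: Int_commute)
      then have "seg m a b \<in> edges m V" using 2(1) less.prems(2,3) unfolding edges_def by blast
      ultimately show "e \<in> {e \<in> edges m V. e \<subseteq> seg m a b}" by simp
    qed
    then show ?thesis using edge_length_seg[OF M] by simp
  next
    case 3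
    then obtain p where p: "p \<in> V" "p \<in> seg m a b" "p \<noteq> a" "p \<noteq> b" by blast
    have pM: "p \<in> M" using p less.prems(1) by blast
    have sub: "seg m a p \<subseteq> seg m a b" "seg m p b \<subseteq> seg m a b"
      using seg_convex[of a b a p] seg_convex[of a b p b] M p by auto
    have "b \<notin> seg m a p" using seg_antisym[of b a p] p by blast
    moreover have "a \<notin> seg m p b" using seg_antisym[of a b p] p seg_commute[of b p] seg_commute[of a b] by auto
    moreover have "a \<in> seg m a b" "b \<in> seg m a b" using M by auto
    ultimately have "V \<inter> seg m a p \<subset> V \<inter> seg m a b" "V \<inter> seg m p b \<subset> V \<inter> seg m a b"
      using sub less.prems(2,3) by blast+
    then have lt: "card (V \<inter> seg m a p) < card (V \<inter> seg m a b)" "card (V \<inter> seg m p b) < card (V \<inter> seg m a b)"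
      and fin: "finite (V \<inter> seg m a p)" "finite (V \<inter> seg m p b)"
      using less.prems(4) psubset_card_mono by (blast, blast, meson finite_subset psubset_imp_subset, meson finite_subset psubset_imp_subset)
    define A where "A = {e \<in> edges m V. e \<subseteq> seg m a p}"
    define B where "B = {e \<in> edges m V. e \<subseteq> seg m p b}"
    have A: "finite A" "sum (edge_length m) A = d a p"
      using less.hyps[OF lt(1) less.prems(1,2) p(1) fin(1)] by (simp_all add: A_def)
    have B: "finite B" "sum (edge_length m) B = d p b"
      using less.hyps[OF lt(2) less.prems(1) p(1) less.prems(3) fin(2)] by (simp_all add: B_def)
    have "{e \<in> edges m V. e \<subseteq> seg m a b} = A \<union> B"
    proof (intro equalityI subsetI)
      fix e assume e: "e \<in> {e \<in> edges m V. e \<subseteq> seg m a b}"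
      then have "e \<in> edges m V" by simp
      then obtain u v where uv: "e = seg m u v" "u \<in> V" "v \<in> V" "u \<noteq> v" "seg m u v \<inter> V = {u, v}"
        by (rule edgeE)
      have uvM: "u \<in> M" "v \<in> M" using uv less.prems(1) by auto
      have uvs: "u \<in> seg m a b" "v \<in> seg m a b" using within[of u v a b] e uv by auto
      have split: "x \<in> seg m a p \<or> x \<in> seg m p b" if "x \<in> seg m a b" for x
        using seg_through[OF M pM that] .
      have conv: "seg m u v \<subseteq> seg m a p" if "u \<in> seg m a p" "v \<in> seg m a p"
        using seg_convex[OF M(1) pM that] .
      have conv': "seg m u v \<subseteq> seg m p b" if "u \<in> seg m p b" "v \<in> seg m p b"
        using seg_convex[OF pM M(2) that] .
      have between: "p \<in> seg m x y" if xy: "x \<in> seg m a p" "y \<in> seg m p b" for x y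
      proof -
        have "p \<in> seg m x b" using seg_trans'(2)[OF xy(1) p(2) M] .
        then show ?thesis using seg_trans'(2)[of y b p x] xy seg_commute M seg_subset
          by (metis subsetD)
      qed
      show "e \<in> A \<union> B"
      proof (cases "p \<in> {u, v}")
        case True
        then have "u \<in> seg m a p \<and> v \<in> seg m a p \<or> u \<in> seg m p b \<and> v \<in> seg m p b"
          using split[OF uvs(1)] split[OF uvs(2)] seg_ends(2)[OF M(1) pM] seg_ends(1)[OF pM M(2)] by blast
        then show ?thesis using conv conv' e uv(1) by (auto simp: A_def B_def)
      next
        case False
        then have "p \<notin> seg m u v" using uv(5) p(1) by blast
        moreover have "p \<notin> seg m v u" using calculation seg_commute[of u v] by simp
        ultimately have "u \<in> seg m a p \<and> v \<in> seg m a p \<or> u \<in> seg m p b \<and> v \<in> seg m p b"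
          using split[OF uvs(1)] split[OF uvs(2)] between by blast
        then show ?thesis using conv conv' e uv(1) by (auto simp: A_def B_def)
      qed
    next
      fix e assume "e \<in> A \<union> B"
      then show "e \<in> {e \<in> edges m V. e \<subseteq> seg m a b}" using sub by (auto simp: A_def B_def)
    qed
    moreover have "A \<inter> B = {}"
    proof (rule ccontr)
      assume "A \<inter> B \<noteq> {}"
      then obtain e where e: "e \<in> edges m V" "e \<subseteq> seg m a p" "e \<subseteq> seg m p b" by (auto simp: A_def B_def)
      obtain u v where uv: "e = seg m u v" "u \<in> V" "v \<in> V" "u \<noteq> v" using edgeE[OF e(1)] by metis
      have "x = p" if x: "x \<in> seg m a p" "x \<in> seg m p b" for x
        using seg_antisym[OF x(1)] seg_trans'(1)[of x p b a] seg_trans(2)[OF x(2) p(2) M] by blast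
      then have "u = p" "v = p" using within[of u v a p] within[of u v p b] uv e by blast+
      then show False using uv(4) by simp
    qed
    ultimately show ?thesis using A B seg_add[OF p(2)] by (simp add: sum.union_disjoint)
  qed
qed

text \<open>An inner point x of f belongs to an edge of V, whose ends are vertices of W too. The
  adjacent pair of W around x stays between these ends, and it bounds f.\<close>

lemma edge_within_unique:
  assumes V: "simplicial_structure m V" and W: "simplicial_structure m W" and VW: "V \<subseteq> W"
    and f: "f \<in> edges m W"
  shows "\<exists>!e. e \<in> edges m V \<and> f \<subseteq> e"
proof -
  have WM: "W \<subseteq> M" "V \<subseteq> M" using simplicial_structureD(1) V W by blast+
  obtain x where x: "x \<in> f" "x \<in> M" "x \<notin> W" using edge_interior[OF f WM(1)] .
  have "x \<in> \<Union> (edges m V)" using simplicial_structureD(2)[OF V] x VW by blast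
  then obtain e where e: "e \<in> edges m V" "x \<in> e" by blast
  obtain a b where ab: "e = seg m a b" "a \<in> V" "b \<in> V" using edgeE[OF e(1)] by metis
  have ab': "a \<in> W" "b \<in> W" "x \<in> seg m a b" "a \<in> M" "b \<in> M" using ab VW e WM by auto
  obtain u v where uv: "u \<in> W" "v \<in> W" "u \<noteq> v" "x \<in> seg m u v" "seg m u v \<inter> W = {u, v}"
    "seg m u v \<subseteq> seg m a b"
    using adjacent_pair_around[OF ab'(1,2) WM(1) ab'(3) x(3) simplicial_structureD(4)[OF W ab'(4,5)]] .
  have "seg m u v \<in> edges m W" using uv unfolding edges_def by blast
  then have "f = seg m u v" using simplicial_structureD(3)[OF W f] x uv(4) by blast
  then have fe: "f \<subseteq> e" using uv(6) ab(1) by simp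
  have uniq: "e' = e" if "e' \<in> edges m V" "f \<subseteq> e'" for e'
    using simplicial_structureD(3)[OF V that(1) e(1)] that(2) x e(2) VW by blast
  show ?thesis by (rule ex1I[of _ e]) (simp_all add: e(1) fe uniq)
qed

lemma seg_hull_simplicial:
  assumes "simplicial_structure m V" shows "seg_hull V = M"
proof (intro equalityI subsetI)
  fix x assume "x \<in> seg_hull V" then show "x \<in> M" by (auto simp: seg_hull_def seg_def)
next
  fix x assume x: "x \<in> M"
  have VM: "V \<subseteq> M" using simplicial_structureD(1)[OF assms] .
  show "x \<in> seg_hull V"
  proof (cases "x \<in> V")
    case True
    moreover have "x \<in> seg m x x" using x by simp
    ultimately show ?thesis unfolding seg_hull_def by blast
  next
    case False
    then have "x \<in> \<Union> (edges m V)" using simplicial_structureD(2)[OF assms] x by blast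
    then show ?thesis unfolding edges_def seg_hull_def by blast
  qed
qed

text \<open>Any vertex set contains the branch points, so \<open>simplicial_structureI\<close>
  applies and no edges of the two structures have to be compared.\<close>

lemma simplicial_structure_union:
  assumes V: "simplicial_structure m V" and W: "simplicial_structure m W"
  shows "simplicial_structure m (V \<union> W)"
proof (rule simplicial_structureI)
  show VW: "V \<union> W \<subseteq> M" using simplicial_structureD(1)[OF V] simplicial_structureD(1)[OF W] by blast
  show "branch_points \<subseteq> V \<union> W" using branch_points_subset_vertices[OF V] by blast
  have "seg_hull V \<subseteq> seg_hull (V \<union> W)" unfolding seg_hull_def by blast
  moreover have "seg_hull (V \<union> W) \<subseteq> M" by (auto simp: seg_hull_def seg_def)
  ultimately show "seg_hull (V \<union> W) = M" using seg_hull_simplicial[OF V] by simp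
  show "finite ((V \<union> W) \<inter> seg m x y)" if "x \<in> M" "y \<in> M" for x y
    using simplicial_structureD(4)[OF V that] simplicial_structureD(4)[OF W that] by (simp add: Int_Un_distrib2)
qed

end

lemma structure_volume_orbit_count:
  "structure_volume G T V = orbit_count G (edges (metr T) V) (\<lambda>g e. act T g ` e) (edge_length (metr T))"
  by (simp add: structure_volume_def orbit_count_def)

lemma invariant_structureD:
  assumes "invariant_structure G T V"
  shows "simplicial_structure (metr T) V" "g \<in> carrier G \<Longrightarrow> act T g ` V = V"
    "g \<in> carrier G \<Longrightarrow> u \<in> V \<Longrightarrow> v \<in> V \<Longrightarrow> u \<noteq> v \<Longrightarrow> seg (metr T) u v \<in> edges (metr T) V \<Longrightarrow>
      act T g u = v \<Longrightarrow> act T g v = u \<Longrightarrow> False"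
  using assms unfolding invariant_structure_def by blast+

lemma invariant_structure_restrict:
  assumes "invariant_structure G T V" "subgroup H G"
  shows "invariant_structure (G\<lparr>carrier := H\<rparr>) T V"
proof -
  have sub: "g \<in> carrier G" if "g \<in> carrier (G\<lparr>carrier := H\<rparr>)" for g
    using that subgroup.subset[OF assms(2)] by auto
  note D = invariant_structureD[OF assms(1)]
  show ?thesis unfolding invariant_structure_def
  proof (intro conjI ballI notI)
    show "act T g ` V = V" if "g \<in> carrier (G\<lparr>carrier := H\<rparr>)" for g using D(2)[OF sub[OF that]] .
    assume "\<exists>g\<in>carrier (G\<lparr>carrier := H\<rparr>). \<exists>u\<in>V. \<exists>v\<in>V. u \<noteq> v \<and>
      seg (metr T) u v \<in> edges (metr T) V \<and> act T g u = v \<and> act T g v = u"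
    then show False using D(3) sub by metis
  qed (rule D(1))
qed

section \<open>Volume of invariant structures\<close>

context tree_action
begin

lemma edges_set_action:
  assumes V: "invariant_structure G T V"
  shows "set_action G (edges (metr T) V) (\<lambda>g e. act T g ` e)"
proof (intro set_action.intro set_action_axioms.intro is_group)
  have VM: "V \<subseteq> M" using simplicial_structureD(1)[OF invariant_structureD(1)[OF V]] .
  have Vinv: "\<And>g x. g \<in> carrier G \<Longrightarrow> x \<in> V \<Longrightarrow> act T g x \<in> V" using invariant_structureD(2)[OF V] by blast
  have eM: "e \<subseteq> M" if "e \<in> edges (metr T) V" for e using edgeE[OF that] seg_subset by metis
  fix e assume e: "e \<in> edges (metr T) V"
  show "act T \<one> ` e = e"
    using eM[OF e] by (simp add: subset_iff cong: image_cong)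
  fix g assume g: "g \<in> carrier G"
  show "act T g ` e \<in> edges (metr T) V"
  proof -
    obtain u v where uv: "e = seg (metr T) u v" "u \<in> V" "v \<in> V" "u \<noteq> v" "seg (metr T) u v \<inter> V = {u, v}"
      using edgeE[OF e] .
    have M: "u \<in> M" "v \<in> M" using uv VM by auto
    have "act T g ` e = seg (metr T) (act T g u) (act T g v)" using act_seg[OF g M] uv(1) by simp
    moreover have "act T g u \<noteq> act T g v" using act_inj[OF g M] uv(4) by simp
    ultimately show ?thesis
      using adjacent_invariant[OF VM Vinv g uv(2,3,5)] Vinv[OF g uv(2)] Vinv[OF g uv(3)]
      unfolding edges_def by blast
  qed
  fix h assume h: "h \<in> carrier G"
  show "act T (g \<otimes> h) ` e = act T g ` act T h ` e"
    using eM[OF e] g h by (simp add: image_image subset_iff act_mult cong: image_cong)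
qed

lemma edge_length_act:
  assumes V: "invariant_structure G T V" and g: "g \<in> carrier G" and e: "e \<in> edges (metr T) V"
  shows "edge_length (metr T) (act T g ` e) = edge_length (metr T) e"
proof -
  have VM: "V \<subseteq> M" using simplicial_structureD(1)[OF invariant_structureD(1)[OF V]] .
  obtain u v where uv: "e = seg (metr T) u v" "u \<in> V" "v \<in> V" using edgeE[OF e] by metis
  have M: "u \<in> M" "v \<in> M" using uv VM by auto
  show ?thesis using act_seg[OF g M] uv(1) g M by (simp add: edge_length_seg)
qed

text \<open>As there are no inversions, g fixes both ends, and a point of a segment is determined by
  its distance from one end.\<close>

lemma edge_stabilizer_fixes:
  assumes V: "invariant_structure G T V" and g: "g \<in> carrier G" and e: "e \<in> edges (metr T) V"
    and ge: "act T g ` e = e" and x: "x \<in> e"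
  shows "act T g x = x"
proof -
  have VM: "V \<subseteq> M" using simplicial_structureD(1)[OF invariant_structureD(1)[OF V]] .
  obtain u v where uv: "e = seg (metr T) u v" "u \<in> V" "v \<in> V" "u \<noteq> v" "seg (metr T) u v \<inter> V = {u, v}"
    using edgeE[OF e] .
  have M: "u \<in> M" "v \<in> M" using uv VM by auto
  have xM: "x \<in> M" using x uv(1) seg_subset by blast
  have ends: "act T g w \<in> {u, v}" if "w \<in> {u, v}" for w
  proof -
    have "w \<in> e \<inter> V" using that uv(1,5) by simp
    then have "act T g w \<in> e \<inter> V" using ge invariant_structureD(2)[OF V g] by blast
    then show ?thesis using uv(1,5) by simp
  qed
  have ne: "act T g u \<noteq> act T g v" using act_inj[OF g M] uv(4) by simp
  have "\<not> (act T g u = v \<and> act T g v = u)"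
    using invariant_structureD(3)[OF V g uv(2,3,4)] e uv(1) by blast
  then have gu: "act T g u = u" using ends[of u] ends[of v] ne by auto
  have gx: "act T g x \<in> seg (metr T) u v" using ge x uv(1) by blast
  have xs: "x \<in> seg (metr T) u v" using x uv(1) by simp
  have "d u (act T g x) = d u x" using act_dist[OF g M(1) xM] gu by simp
  then have "d (act T g x) x = 0" using seg_dist[OF M gx xs] by simp
  then show ?thesis using xM act_closed[OF g xM] by simp
qed

lemma edge_stabilizer_finite:
  assumes V: "invariant_structure G T V" and e: "e \<in> edges (metr T) V"
    and stab: "\<And>x. x \<in> M \<Longrightarrow> finite (stabilizer G (act T) x)"
  shows "finite (stabilizer G (\<lambda>g e. act T g ` e) e)"
proof -
  have VM: "V \<subseteq> M" using simplicial_structureD(1)[OF invariant_structureD(1)[OF V]] .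
  obtain x where x: "x \<in> e" "x \<in> M" using edge_interior[OF e VM] by metis
  have "stabilizer G (\<lambda>g e. act T g ` e) e \<subseteq> stabilizer G (act T) x"
    using edge_stabilizer_fixes[OF V _ e _ x(1)] by (auto simp: stabilizer_def)
  then show ?thesis using stab[OF x(2)] finite_subset by blast
qed

text \<open>An edge of W is sent to the edge of V containing it. The exclusion of inversions enters
  through the stabilizer condition of \<open>orbit_count_refine\<close>: an element preserving an
  edge of V must preserve every piece of it.\<close>

lemma structure_volume_refine:
  assumes V: "invariant_structure G T V" and W: "invariant_structure G T W" and VW: "V \<subseteq> W"
  shows "structure_volume G T W = structure_volume G T V"
  unfolding structure_volume_orbit_count
proof (rule orbit_count_refine[where \<pi> = "\<lambda>f. THE e. e \<in> edges (metr T) V \<and> f \<subseteq> e"])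
  note sV = invariant_structureD(1)[OF V] and sW = invariant_structureD(1)[OF W]
  have VM: "V \<subseteq> M" "W \<subseteq> M" using simplicial_structureD(1) sV sW by blast+
  define p where "p f = (THE e. e \<in> edges (metr T) V \<and> f \<subseteq> e)" for f
  have p: "p f \<in> edges (metr T) V \<and> f \<subseteq> p f" if "f \<in> edges (metr T) W" for f
    unfolding p_def by (rule theI'[OF edge_within_unique[OF sV sW VW that]])
  have p_eq: "p f = e" if "f \<in> edges (metr T) W" "e \<in> edges (metr T) V" "f \<subseteq> e" for e f
    unfolding p_def by (rule the1_equality[OF edge_within_unique[OF sV sW VW that(1)]]) (use that in blast)
  interpret V: set_action G "edges (metr T) V" "\<lambda>g e. act T g ` e" by (rule edges_set_action[OF V])
  interpret W: set_action G "edges (metr T) W" "\<lambda>g e. act T g ` e" by (rule edges_set_action[OF W])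
  show "set_action G (edges (metr T) V) (\<lambda>g e. act T g ` e)" by (rule edges_set_action[OF V])
  show "set_action G (edges (metr T) W) (\<lambda>g e. act T g ` e)" by (rule edges_set_action[OF W])
  show "(THE e. e \<in> edges (metr T) V \<and> f \<subseteq> e) \<in> edges (metr T) V" if "f \<in> edges (metr T) W" for f
    using p[OF that] by (simp add: p_def)
  show "(THE e. e \<in> edges (metr T) V \<and> act T g ` f \<subseteq> e) = act T g ` (THE e. e \<in> edges (metr T) V \<and> f \<subseteq> e)"
    if g: "g \<in> carrier G" and f: "f \<in> edges (metr T) W" for g f
    unfolding p_def[symmetric]
    by (rule p_eq) (use V.closed[OF g] W.closed[OF g f] p[OF f] in \<open>auto intro: image_mono\<close>)
  show "act T g ` f = f"
    if g: "g \<in> carrier G" and f: "f \<in> edges (metr T) W"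
      and eq: "act T g ` (THE e. e \<in> edges (metr T) V \<and> f \<subseteq> e) = (THE e. e \<in> edges (metr T) V \<and> f \<subseteq> e)" for g f
  proof -
    have "act T g x = x" if "x \<in> f" for x
      by (rule edge_stabilizer_fixes[OF V g, of "p f"]) (use p[OF f] eq that in \<open>auto simp: p_def\<close>)
    then show ?thesis by simp
  qed
  fix e assume e: "e \<in> edges (metr T) V"
  have fib: "{f \<in> edges (metr T) W. (THE e. e \<in> edges (metr T) V \<and> f \<subseteq> e) = e} = {f \<in> edges (metr T) W. f \<subseteq> e}"
    unfolding p_def[symmetric] using p p_eq e by blast
  obtain a b where ab: "e = seg (metr T) a b" "a \<in> V" "b \<in> V" "a \<noteq> b" using edgeE[OF e] by metis
  have ab': "a \<in> W" "b \<in> W" "a \<in> M" "b \<in> M" using ab VW VM by auto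
  note sub = edges_in_segment[OF VM(2) ab'(1,2) simplicial_structureD(4)[OF sW ab'(3,4)]]
  show "finite {f \<in> edges (metr T) W. (THE e. e \<in> edges (metr T) V \<and> f \<subseteq> e) = e}"
    unfolding fib using sub ab(1) by simp
  show "(\<Sum>f\<in>{f \<in> edges (metr T) W. (THE e. e \<in> edges (metr T) V \<and> f \<subseteq> e) = e}. edge_length (metr T) f)
      = edge_length (metr T) e"
    unfolding fib using sub ab(1) edge_length_seg[OF ab'(3,4)] by simp
  show "{f \<in> edges (metr T) W. (THE e. e \<in> edges (metr T) V \<and> f \<subseteq> e) = e} \<noteq> {}"
  proof
    assume "{f \<in> edges (metr T) W. (THE e. e \<in> edges (metr T) V \<and> f \<subseteq> e) = e} = {}"
    then have "{f \<in> edges (metr T) W. f \<subseteq> e} = {}" using fib by simp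
    then have "d a b = 0" using sub unfolding ab(1) by (metis sum.empty)
    then show False using mdist_pos[OF ab'(3,4) ab(4)] by simp
  qed
qed (use edge_length_act[OF V] edge_length_act[OF W] in auto)

text \<open>An inversion of an edge of the union fixes its midpoint x, which lies inside an edge e
  of V. Since e and its image share x, they coincide; hence g fixes e pointwise, including the ends
  of the smaller edge that it was to swap.\<close>

lemma invariant_structure_union:
  assumes V: "invariant_structure G T V" and W: "invariant_structure G T W"
  shows "invariant_structure G T (V \<union> W)"
  unfolding invariant_structure_def
proof (intro conjI ballI notI)
  note sV = invariant_structureD(1)[OF V] and sW = invariant_structureD(1)[OF W]
  show sVW: "simplicial_structure (metr T) (V \<union> W)" by (rule simplicial_structure_union[OF sV sW])
  have VM: "V \<subseteq> M" "V \<union> W \<subseteq> M" using simplicial_structureD(1) sV sVW by blast+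
  show "act T g ` (V \<union> W) = V \<union> W" if "g \<in> carrier G" for g
    using invariant_structureD(2)[OF V that] invariant_structureD(2)[OF W that] by (simp add: image_Un)
  assume "\<exists>g\<in>carrier G. \<exists>u\<in>V \<union> W. \<exists>v\<in>V \<union> W. u \<noteq> v \<and>
    seg (metr T) u v \<in> edges (metr T) (V \<union> W) \<and> act T g u = v \<and> act T g v = u"
  then obtain g u v where g: "g \<in> carrier G" and uv: "u \<in> V \<union> W" "v \<in> V \<union> W" "u \<noteq> v"
    and f: "seg (metr T) u v \<in> edges (metr T) (V \<union> W)" and gu: "act T g u = v" "act T g v = u" by blast
  have M: "u \<in> M" "v \<in> M" using uv VM by auto
  obtain e where e: "e \<in> edges (metr T) V" "seg (metr T) u v \<subseteq> e"
    using edge_within_unique[OF sV sVW _ f] by blast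
  obtain x where x: "x \<in> seg (metr T) u v" "d u x = d u v / 2" "d x v = d u v - d u v / 2"
    using seg_point[of u v "d u v / 2"] M by auto
  have xM: "x \<in> M" using x seg_subset by blast
  have "d u v > 0" using mdist_pos M uv(3) by blast
  then have xuv: "x \<noteq> u" "x \<noteq> v" using x M by auto
  have gx: "act T g x = x" by (rule inversion_fixes_midpoint[OF g M gu x(1)]) (use x in simp)
  have "x \<notin> V \<union> W"
  proof -
    obtain u' v' where u': "seg (metr T) u v = seg (metr T) u' v'" "seg (metr T) u' v' \<inter> (V \<union> W) = {u', v'}"
      using edgeE[OF f] by metis
    have "u \<in> {u', v'}" "v \<in> {u', v'}" using seg_ends[OF M] uv(1,2) u' by auto
    then have "{u', v'} = {u, v}" using uv(3) by auto
    then show ?thesis using x(1) xuv u' by auto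
  qed
  then have xV: "x \<notin> V" by blast
  interpret V: set_action G "edges (metr T) V" "\<lambda>g e. act T g ` e" by (rule edges_set_action[OF V])
  have xe: "x \<in> e" using x e by blast
  then have "act T g x \<in> act T g ` e" by blast
  then have "act T g ` e = e" using gx xe xV simplicial_structureD(3)[OF sV V.closed[OF g e(1)] e(1)] by auto
  moreover have "u \<in> e" using e(2) seg_ends[OF M] by blast
  ultimately have "act T g u = u" using edge_stabilizer_fixes[OF V g e(1)] by blast
  then show False using gu uv(3) by simp
qed

lemma structure_volume_unique:
  assumes "invariant_structure G T V" "invariant_structure G T W"
  shows "structure_volume G T V = structure_volume G T W"
  using structure_volume_refine[OF assms(1) invariant_structure_union[OF assms]]
    structure_volume_refine[OF assms(2) invariant_structure_union[OF assms]] by simp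

lemma vol_eq:
  assumes "invariant_structure G T V" shows "vol G T = structure_volume G T V"
  unfolding vol_def using structure_volume_unique[OF someI[of "invariant_structure G T", OF assms] assms] .

lemma structure_volume_restrict:
  assumes V: "invariant_structure G T V" and H: "subgroup H G" "finite (rcosets H)"
    and stab: "\<And>x. x \<in> M \<Longrightarrow> finite (stabilizer G (act T) x)"
  shows "structure_volume (G\<lparr>carrier := H\<rparr>) T V = real (card (rcosets H)) * structure_volume G T V"
  unfolding structure_volume_orbit_count
proof (rule set_action.orbit_count_subgroup[OF edges_set_action[OF V] H])
  show "finite (stabilizer G (\<lambda>g e. act T g ` e) e)" if "e \<in> edges (metr T) V" for e
    using edge_stabilizer_finite[OF V that stab] .
  show "edge_length (metr T) (act T g ` e) = edge_length (metr T) e"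
    if "g \<in> carrier G" "e \<in> edges (metr T) V" for g e using edge_length_act[OF V that] .
qed

end

section \<open>Rescaling and the Lipschitz metric\<close>

text \<open>A relation between metrics rather than an operation, so that it can be reversed: with
  \<open>rescaling_sym\<close> an implication such as \<open>rescaling_geodesic_segment\<close>
  becomes an equivalence.\<close>

definition rescaling :: "real \<Rightarrow> 'a metric \<Rightarrow> 'a metric \<Rightarrow> bool" where
  "rescaling c m m' \<longleftrightarrow> 0 < c \<and> mspace m' = mspace m \<and> mdist m' = (\<lambda>x y. c * mdist m x y)"

text \<open>\<open>metric\<close> is known to return the given distance only for a genuine metric,
  so the axioms come before any computation with \<open>gscale\<close>.\<close>

lemma rescaling_gscale:
  assumes "0 < c" shows "rescaling c (metr T) (metr (gscale c T))"
proof -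
  interpret Metric_space "points T" "\<lambda>x y. c * mdist (metr T) x y"
  proof
    show "0 \<le> c * mdist (metr T) x y" for x y using assms by simp
    show "c * mdist (metr T) x y = c * mdist (metr T) y x" for x y by (simp add: mdist_commute)
    show "c * mdist (metr T) x y = 0 \<longleftrightarrow> x = y" if "x \<in> points T" "y \<in> points T" for x y
      using assms that by simp
    show "c * mdist (metr T) x z \<le> c * mdist (metr T) x y + c * mdist (metr T) y z"
      if "x \<in> points T" "y \<in> points T" "z \<in> points T" for x y z
      using mult_left_mono[OF mdist_triangle[OF that], of c] assms by (simp add: distrib_left)
  qed
  show ?thesis using assms by (simp add: rescaling_def gscale_def)
qed

lemma act_gscale [simp]: "act (gscale c T) = act T"
  by (simp add: gscale_def)

lemma points_gscale [simp]: "0 < c \<Longrightarrow> points (gscale c T) = points T"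
  using rescaling_gscale[of c T] by (simp add: rescaling_def)

lemma mdist_gscale [simp]: "0 < c \<Longrightarrow> mdist (metr (gscale c T)) x y = c * mdist (metr T) x y"
  using rescaling_gscale[of c T] by (simp add: rescaling_def)

text \<open>Serves to interchange the factor 1/n with the factor that normalizes the volume of a
  folded tree.\<close>

lemma gscale_commute:
  assumes "0 < c" "0 < k" shows "gscale c (gscale k T) = gscale k (gscale c T)"
proof -
  have eq: "gscale a (gscale b T) = T\<lparr>metr := metric (points T, \<lambda>x y. a * (b * mdist (metr T) x y))\<rparr>"
    if "0 < b" for a b
  proof -
    have "gscale a (gscale b T) =
      (gscale b T)\<lparr>metr := metric (points (gscale b T), \<lambda>x y. a * mdist (metr (gscale b T)) x y)\<rparr>"
      by (rule gscale_def)
    also have "\<dots> = (gscale b T)\<lparr>metr := metric (points T, \<lambda>x y. a * (b * mdist (metr T) x y))\<rparr>"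
      using that by simp
    finally show ?thesis by (simp add: gscale_def)
  qed
  show ?thesis using assms by (simp add: eq mult.left_commute)
qed

lemma rescaling_sym: "rescaling c m m' \<Longrightarrow> rescaling (1 / c) m' m"
  by (auto simp: rescaling_def)

lemma rescaling_seg:
  assumes "rescaling c m m'" shows "seg m' = seg m"
proof (intro ext)
  fix x y
  have c: "0 < c" and eq: "mspace m' = mspace m" "\<And>x y. mdist m' x y = c * mdist m x y"
    using assms by (auto simp: rescaling_def)
  have "c * a + c * b = c * e \<longleftrightarrow> a + b = e" for a b e using c by (simp add: distrib_left[symmetric])
  then show "seg m' x y = seg m x y" by (simp add: seg_def eq)
qed

lemma rescaling_edges: "rescaling c m m' \<Longrightarrow> edges m' = edges m"
  by (intro ext) (simp add: edges_def rescaling_seg)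

lemma rescaling_geodesic_segment:
  assumes "rescaling c m m'" "geodesic_segment m S x y" shows "geodesic_segment m' S x y"
proof -
  have c: "0 < c" and eq: "mspace m' = mspace m" "\<And>x y. mdist m' x y = c * mdist m x y"
    using assms by (auto simp: rescaling_def)
  obtain g where g: "g 0 = x" "g (mdist m x y) = y" "S = g ` {0..mdist m x y}" "S \<subseteq> mspace m"
    "\<forall>s\<in>{0..mdist m x y}. \<forall>t\<in>{0..mdist m x y}. mdist m (g s) (g t) = \<bar>s - t\<bar>"
    using assms(2) unfolding geodesic_segment_def by (elim exE conjE)
  have im: "(\<lambda>s. s / c) ` {0..c * mdist m x y} = {0..mdist m x y}"
  proof (intro equalityI subsetI)
    fix s assume "s \<in> {0..mdist m x y}"
    then have "c * s \<in> {0..c * mdist m x y}" "s = c * s / c" using c by auto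
    then show "s \<in> (\<lambda>s. s / c) ` {0..c * mdist m x y}" by blast
  qed (use c in \<open>auto simp: field_simps\<close>)
  have d: "mdist m' (g (s / c)) (g (t / c)) = \<bar>s - t\<bar>"
    if "s \<in> {0..c * mdist m x y}" "t \<in> {0..c * mdist m x y}" for s t
  proof -
    have "mdist m (g (s / c)) (g (t / c)) = \<bar>s / c - t / c\<bar>" using im that by (intro g(5)[rule_format]) blast+
    then show ?thesis using c by (simp add: eq abs_divide diff_divide_distrib[symmetric])
  qed
  have "S = (\<lambda>s. g (s / c)) ` {0..c * mdist m x y}" using im g(3) by (metis image_image)
  then show ?thesis unfolding geodesic_segment_def eq
    using g(1,2,4) c d by (intro exI[of _ "\<lambda>s. g (s / c)"]) (simp add: eq)
qed

lemma rescaling_geodesic_segment_iff: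
  assumes "rescaling c m m'" shows "geodesic_segment m' = geodesic_segment m"
  using rescaling_geodesic_segment[OF assms] rescaling_geodesic_segment[OF rescaling_sym[OF assms]]
  by (intro ext iffI) metis+

lemma rescaling_real_tree:
  assumes "rescaling c m m'" "real_tree m" shows "real_tree m'"
  using assms(2) rescaling_geodesic_segment_iff[OF assms(1)] assms(1)
  by (simp add: real_tree_def rescaling_def)

lemma rescaling_simplicial_structure:
  assumes "rescaling c m m'" shows "simplicial_structure m' V \<longleftrightarrow> simplicial_structure m V"
  using assms rescaling_edges[OF assms] rescaling_seg[OF assms]
  by (simp add: simplicial_structure_def rescaling_def)

lemma rescaling_simplicial_tree:
  assumes "rescaling c m m'" "simplicial_tree m" shows "simplicial_tree m'"
  using assms rescaling_real_tree[OF assms(1)] rescaling_simplicial_structure[OF assms(1)]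
  by (simp add: simplicial_tree_def rescaling_def)

lemma outer_tree_gscale:
  assumes c: "0 < c" and T: "outer_tree G T" shows "outer_tree G (gscale c T)"
proof -
  note r = rescaling_gscale[OF c, of T]
  have "simplicial_tree (metr (gscale c T))"
    using rescaling_simplicial_tree[OF r] T by (simp add: outer_tree_def)
  then show ?thesis
    using T c rescaling_seg[OF r]
    by (simp add: outer_tree_def isometric_action_def minimal_action_def)
qed

lemma invariant_structure_gscale:
  assumes c: "0 < c" shows "invariant_structure G (gscale c T) V \<longleftrightarrow> invariant_structure G T V"
  using rescaling_simplicial_structure[OF rescaling_gscale[OF c, of T]]
    rescaling_seg[OF rescaling_gscale[OF c, of T]] rescaling_edges[OF rescaling_gscale[OF c, of T]]
  by (simp add: invariant_structure_def)

lemma equivariant_gscale: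
  "0 < c \<Longrightarrow> 0 < k \<Longrightarrow> equivariant G (gscale c T) (gscale k T') f \<longleftrightarrow> equivariant G T T' f"
  by (simp add: equivariant_def)

lemma equivariantly_isometric_gscale:
  assumes "0 < c" "equivariantly_isometric G T T'"
  shows "equivariantly_isometric G (gscale c T) (gscale c T')"
  using assms by (auto simp: equivariantly_isometric_def equivariant_gscale)

section \<open>Equivariant isometries\<close>

lemma equivariantly_isometric_trans:
  assumes "equivariantly_isometric G T T'" "equivariantly_isometric G T' T''"
  shows "equivariantly_isometric G T T''"
proof -
  obtain h where h: "equivariant G T T' h" "bij_betw h (points T) (points T')"
    "\<And>x y. x \<in> points T \<Longrightarrow> y \<in> points T \<Longrightarrow> mdist (metr T') (h x) (h y) = mdist (metr T) x y"
    using assms(1) by (auto simp: equivariantly_isometric_def)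
  obtain k where k: "equivariant G T' T'' k" "bij_betw k (points T') (points T'')"
    "\<And>x y. x \<in> points T' \<Longrightarrow> y \<in> points T' \<Longrightarrow> mdist (metr T'') (k x) (k y) = mdist (metr T') x y"
    using assms(2) by (auto simp: equivariantly_isometric_def)
  have hT: "h x \<in> points T'" if "x \<in> points T" for x using h(1) that by (auto simp: equivariant_def)
  show ?thesis unfolding equivariantly_isometric_def
  proof (intro exI[of _ "k \<circ> h"] conjI ballI)
    show "equivariant G T T'' (k \<circ> h)" using h(1) k(1) hT by (auto simp: equivariant_def)
    show "bij_betw (k \<circ> h) (points T) (points T'')" using h(2) k(2) by (rule bij_betw_trans)
    show "mdist (metr T'') ((k \<circ> h) x) ((k \<circ> h) y) = mdist (metr T) x y"
      if "x \<in> points T" "y \<in> points T" for x y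
      using h(3)[OF that] k(3)[OF hT hT] that by simp
  qed
qed

lemma equivariantly_isometric_refl: "equivariantly_isometric G T T"
  unfolding equivariantly_isometric_def by (intro exI[of _ "\<lambda>x. x"]) (auto simp: equivariant_def bij_betw_def)

lemma isometric_action_closed:
  assumes "isometric_action G T" "g \<in> carrier G" "x \<in> points T" shows "act T g x \<in> points T"
  using assms group_action.element_image unfolding isometric_action_def by metis

lemma equivariantly_isometric_sym:
  assumes T: "isometric_action G T" and iso: "equivariantly_isometric G T T'"
  shows "equivariantly_isometric G T' T"
proof -
  obtain h where h: "equivariant G T T' h" "bij_betw h (points T) (points T')"
    "\<And>x y. x \<in> points T \<Longrightarrow> y \<in> points T \<Longrightarrow> mdist (metr T') (h x) (h y) = mdist (metr T) x y"
    using iso by (auto simp: equivariantly_isometric_def)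
  define k where "k = inv_into (points T) h"
  have kh: "k (h x) = x" if "x \<in> points T" for x
    using h(2) that by (simp add: k_def bij_betw_inv_into_left)
  have ex: "\<exists>x\<in>points T. y = h x" if "y \<in> points T'" for y
    using h(2) that by (auto simp: bij_betw_def)
  have ga: "h (act T g x) = act T' g (h x)" if "g \<in> carrier G" "x \<in> points T" for g x
    using h(1) that by (auto simp: equivariant_def)
  show ?thesis unfolding equivariantly_isometric_def
  proof (intro exI[of _ k] conjI ballI)
    have "k y \<in> points T" if "y \<in> points T'" for y using ex[OF that] kh by auto
    moreover have "k (act T' g y) = act T g (k y)" if g: "g \<in> carrier G" and "y \<in> points T'" for g y
    proof -
      obtain x where x: "x \<in> points T" "y = h x" using ex \<open>y \<in> points T'\<close> by blast
      have "k (act T' g y) = k (h (act T g x))" using ga[OF g x(1)] x(2) by simp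
      then show ?thesis using kh x isometric_action_closed[OF T g x(1)] by simp
    qed
    ultimately show "equivariant G T' T k" by (auto simp: equivariant_def)
    show "bij_betw k (points T') (points T)" using h(2) unfolding k_def by (rule bij_betw_inv_into)
    fix y y' assume "y \<in> points T'" "y' \<in> points T'"
    then obtain x x' where "x \<in> points T" "y = h x" "x' \<in> points T" "y' = h x'" using ex by meson
    then show "mdist (metr T) (k y) (k y') = mdist (metr T') y y'" using kh h(3) by simp
  qed
qed

section \<open>Lipschitz constants and their infimum over equivariant maps\<close>

lemma lip_const_nonneg:
  assumes "Lipschitz_continuous_map m m' f" shows "0 \<le> lip_const m m' f"
proof -
  obtain B where B: "B > 0" "\<And>x y. x \<in> mspace m \<Longrightarrow> y \<in> mspace m \<Longrightarrow> mdist m' (f x) (f y) \<le> B * mdist m x y"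
    using assms by (auto simp: Lipschitz_continuous_map_pos)
  then have "B \<in> {L. 0 \<le> L \<and> (\<forall>x\<in>mspace m. \<forall>y\<in>mspace m. mdist m' (f x) (f y) \<le> L * mdist m x y)}" by auto
  then show ?thesis unfolding lip_const_def by (intro cInf_greatest) auto
qed

lemma lip_const_le:
  assumes "0 \<le> L" "\<And>x y. x \<in> mspace m \<Longrightarrow> y \<in> mspace m \<Longrightarrow> mdist m' (f x) (f y) \<le> L * mdist m x y"
  shows "lip_const m m' f \<le> L"
  unfolding lip_const_def by (rule cInf_lower) (use assms in \<open>auto intro!: bdd_belowI[of _ 0]\<close>)

text \<open>The infimum is attained: for points at positive distance the quotient of the distances
  is a lower bound of all admissible constants. At distance 0 any Lipschitz bound will do.\<close>

lemma lip_const_bound: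
  assumes "Lipschitz_continuous_map m m' f" "x \<in> mspace m" "y \<in> mspace m"
  shows "mdist m' (f x) (f y) \<le> lip_const m m' f * mdist m x y"
proof (cases "mdist m x y = 0")
  case True
  obtain B where "\<And>x y. x \<in> mspace m \<Longrightarrow> y \<in> mspace m \<Longrightarrow> mdist m' (f x) (f y) \<le> B * mdist m x y"
    using assms(1) by (auto simp: Lipschitz_continuous_map_pos)
  from this[OF assms(2,3)] show ?thesis using True by simp
next
  case False
  then have pos: "0 < mdist m x y" using mdist_nonneg[of m x y] by linarith
  obtain B where B: "B > 0" "\<And>x y. x \<in> mspace m \<Longrightarrow> y \<in> mspace m \<Longrightarrow> mdist m' (f x) (f y) \<le> B * mdist m x y"
    using assms(1) by (auto simp: Lipschitz_continuous_map_pos)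
  then have "B \<in> {L. 0 \<le> L \<and> (\<forall>x\<in>mspace m. \<forall>y\<in>mspace m. mdist m' (f x) (f y) \<le> L * mdist m x y)}" by auto
  then have "mdist m' (f x) (f y) / mdist m x y \<le> lip_const m m' f"
    unfolding lip_const_def
    by (intro cInf_greatest) (use pos assms in \<open>auto simp: divide_le_eq\<close>)
  then show ?thesis using pos by (simp add: divide_le_eq)
qed

lemma rescaling_lip_const:
  assumes "rescaling c m1 m1'" "rescaling c m2 m2'"
  shows "lip_const m1' m2' f = lip_const m1 m2 f"
proof -
  have "c * a \<le> L * (c * b) \<longleftrightarrow> a \<le> L * b" for a b L :: real
    using assms by (simp add: rescaling_def mult.left_commute[of L])
  then show ?thesis using assms by (simp add: lip_const_def rescaling_def)
qed

lemma rescaling_Lipschitz: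
  assumes "rescaling c m1 m1'" "rescaling c m2 m2'"
  shows "Lipschitz_continuous_map m1' m2' f \<longleftrightarrow> Lipschitz_continuous_map m1 m2 f"
proof -
  have "c * a \<le> L * (c * b) \<longleftrightarrow> a \<le> L * b" for a b L :: real
    using assms by (simp add: rescaling_def mult.left_commute[of L])
  then show ?thesis using assms by (simp add: Lipschitz_continuous_map_def rescaling_def)
qed

lemma Lip_gscale:
  assumes "0 < c" shows "Lip G (gscale c T) (gscale c T') = Lip G T T'"
  using assms rescaling_lip_const[OF rescaling_gscale rescaling_gscale, OF assms assms, of T T']
    rescaling_Lipschitz[OF rescaling_gscale rescaling_gscale, OF assms assms, of T T']
  by (simp add: Lip_def equivariant_gscale)

lemma outer_tree_action: "outer_tree G T \<Longrightarrow> tree_action T G"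
  by (simp add: tree_action_def tree_action_axioms_def rtree_def outer_tree_def simplicial_tree_def)

lemma Lip_restrict:
  assumes T: "outer_tree G T" and T': "outer_tree G T'"
    and H: "subgroup H G" "finite (rcosets\<^bsub>G\<^esub> H)"
  shows "Lip (G\<lparr>carrier := H\<rparr>) T T' = Lip G T T'"
proof -
  let ?H = "G\<lparr>carrier := H\<rparr>"
  define S where "S K = {lip_const (metr T) (metr T') f | f.
    equivariant K T T' f \<and> Lipschitz_continuous_map (metr T) (metr T') f}" for K :: "('a, 'b) monoid_scheme"
  have sub: "S G \<subseteq> S ?H"
    using subgroup.subset[OF H(1)] by (auto simp: S_def equivariant_def) blast
  have bdd: "bdd_below (S ?H)" "bdd_below (S G)"
    unfolding S_def using lip_const_nonneg by (auto intro!: bdd_belowI[of _ 0])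
  have dom: "\<exists>r\<in>S G. r \<le> s" if s: "s \<in> S ?H" for s
  proof -
    obtain f where f: "s = lip_const (metr T) (metr T') f" "equivariant ?H T T' f"
      "Lipschitz_continuous_map (metr T) (metr T') f" using s by (auto simp: S_def)
    obtain f' where f': "equivariant G T T' f'"
      "\<And>x y. x \<in> points T \<Longrightarrow> y \<in> points T \<Longrightarrow> mdist (metr T') (f' x) (f' y) \<le> s * mdist (metr T) x y"
      using equivariant_average[OF outer_tree_action[OF T] outer_tree_action[OF T'] H f(2), of s]
        lip_const_bound[OF f(3)] f(1) by blast
    have "f' \<in> points T \<rightarrow> points T'" using f'(1) by (simp add: equivariant_def)
    then have "Lipschitz_continuous_map (metr T) (metr T') f'"
      using f'(2) by (auto simp: Lipschitz_continuous_map_def)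
    then have "lip_const (metr T) (metr T') f' \<in> S G" using f'(1) by (auto simp: S_def)
    moreover have "lip_const (metr T) (metr T') f' \<le> s"
      by (rule lip_const_le) (use lip_const_nonneg[OF f(3)] f(1) f'(2) in auto)
    ultimately show ?thesis by blast
  qed
  \<comment> \<open>No equivariant Lipschitz map has been constructed. If there is none for G, then
    by averaging there is none for H, and both infima are that of the empty set.\<close>
  have "Inf (S ?H) = Inf (S G)"
  proof (cases "S G = {}")
    case True
    then have "S ?H = {}" using dom by blast
    with True show ?thesis by simp
  next
    case False
    show ?thesis
    proof (rule antisym)
      show "Inf (S ?H) \<le> Inf (S G)" by (rule cInf_superset_mono[OF False bdd(1) sub])
      show "Inf (S G) \<le> Inf (S ?H)"
        by (rule cInf_mono) (use False sub bdd dom in auto)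
    qed
  qed
  then show ?thesis by (simp add: Lip_def S_def)
qed

lemma Lip_isometric_subset:
  assumes T1: "equivariantly_isometric G T1 T" and T': "equivariantly_isometric G T' T1'"
  shows "{lip_const (metr T) (metr T') f | f.
      equivariant G T T' f \<and> Lipschitz_continuous_map (metr T) (metr T') f}
    \<subseteq> {lip_const (metr T1) (metr T1') f | f.
      equivariant G T1 T1' f \<and> Lipschitz_continuous_map (metr T1) (metr T1') f}"
proof
  fix r assume "r \<in> {lip_const (metr T) (metr T') f | f.
      equivariant G T T' f \<and> Lipschitz_continuous_map (metr T) (metr T') f}"
  then obtain f where f: "r = lip_const (metr T) (metr T') f" "equivariant G T T' f"
    "Lipschitz_continuous_map (metr T) (metr T') f" by blast
  obtain k where k: "equivariant G T1 T k" "bij_betw k (points T1) (points T)"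
    "\<And>x y. x \<in> points T1 \<Longrightarrow> y \<in> points T1 \<Longrightarrow> mdist (metr T) (k x) (k y) = mdist (metr T1) x y"
    using T1 by (auto simp: equivariantly_isometric_def)
  obtain h where h: "equivariant G T' T1' h"
    "\<And>x y. x \<in> points T' \<Longrightarrow> y \<in> points T' \<Longrightarrow> mdist (metr T1') (h x) (h y) = mdist (metr T') x y"
    using T' by (auto simp: equivariantly_isometric_def)
  define f1 where "f1 = (\<lambda>x. h (f (k x)))"
  have kp: "k x \<in> points T" if "x \<in> points T1" for x using k(1) that by (auto simp: equivariant_def)
  have fp: "f x \<in> points T'" if "x \<in> points T" for x using f(2) that by (auto simp: equivariant_def)
  have hp: "h x \<in> points T1'" if "x \<in> points T'" for x using h(1) that by (auto simp: equivariant_def)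
  have f1: "equivariant G T1 T1' f1"
    using k(1) f(2) h(1) kp fp hp by (auto simp: equivariant_def f1_def)
  have d: "mdist (metr T1') (f1 x) (f1 y) = mdist (metr T') (f (k x)) (f (k y))"
    if "x \<in> points T1" "y \<in> points T1" for x y
    using that h(2) kp fp by (simp add: f1_def)
  have im: "k ` points T1 = points T" using k(2) by (simp add: bij_betw_def)
  have iff: "(\<forall>x\<in>points T1. \<forall>y\<in>points T1. mdist (metr T1') (f1 x) (f1 y) \<le> L * mdist (metr T1) x y)
    \<longleftrightarrow> (\<forall>x\<in>points T. \<forall>y\<in>points T. mdist (metr T') (f x) (f y) \<le> L * mdist (metr T) x y)" for L
    unfolding im[symmetric] using d k(3) by simp
  have "lip_const (metr T1) (metr T1') f1 = r" using iff by (simp add: lip_const_def f(1))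
  moreover have "Lipschitz_continuous_map (metr T1) (metr T1') f1"
    using f(3) iff kp fp hp by (auto simp: Lipschitz_continuous_map_def f1_def)
  ultimately show "r \<in> {lip_const (metr T1) (metr T1') f | f.
      equivariant G T1 T1' f \<and> Lipschitz_continuous_map (metr T1) (metr T1') f}"
    using f1 by blast
qed

lemma Lip_isometric:
  assumes "isometric_action G T" "isometric_action G T'"
    and T1: "equivariantly_isometric G T T1" and T1': "equivariantly_isometric G T' T1'"
  shows "Lip G T1 T1' = Lip G T T'"
  unfolding Lip_def
  using Lip_isometric_subset[OF T1 equivariantly_isometric_sym[OF assms(2) T1']]
    Lip_isometric_subset[OF equivariantly_isometric_sym[OF assms(1) T1] T1']
  by (intro arg_cong[where f = Inf] equalityI)

lemma unit_tree_action: "T \<in> unit_trees G \<Longrightarrow> isometric_action G T"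
  by (simp add: unit_trees_def outer_tree_def)

section \<open>Isometry classes and the distance between them\<close>

lemma isometry_rel_class:
  assumes "T \<in> unit_trees G"
  shows "isometry_rel G `` {T} = {S \<in> unit_trees G. equivariantly_isometric G T S}"
  using assms by (auto simp: isometry_rel_def)

lemma isometry_rel_class_eq:
  assumes "T \<in> unit_trees G" "S \<in> isometry_rel G `` {T}"
  shows "isometry_rel G `` {S} = isometry_rel G `` {T}"
proof -
  have S: "S \<in> unit_trees G" "equivariantly_isometric G T S" using assms isometry_rel_class by blast+
  have S': "equivariantly_isometric G S T"
    using equivariantly_isometric_sym[OF unit_tree_action[OF assms(1)] S(2)] .
  show ?thesis unfolding isometry_rel_class[OF assms(1)] isometry_rel_class[OF S(1)]
    using equivariantly_isometric_trans[OF S(2)] equivariantly_isometric_trans[OF S'] by blast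
qed

text \<open>\<open>Lip\<close> takes the same value on all representatives, so the description by
  \<open>THE\<close> has exactly one candidate.\<close>

lemma outer_dist_class:
  assumes T: "T \<in> unit_trees G" and T': "T' \<in> unit_trees G"
  shows "outer_dist G (isometry_rel G `` {T}) (isometry_rel G `` {T'}) = ln (Lip G T T')"
  unfolding outer_dist_def
proof (rule the_equality)
  show "\<exists>S\<in>isometry_rel G `` {T}. \<exists>S'\<in>isometry_rel G `` {T'}. ln (Lip G T T') = ln (Lip G S S')"
    using T T' equivariantly_isometric_refl[of G T] equivariantly_isometric_refl[of G T']
      isometry_rel_class by blast
  fix r assume "\<exists>S\<in>isometry_rel G `` {T}. \<exists>S'\<in>isometry_rel G `` {T'}. r = ln (Lip G S S')"
  then obtain S S' where S: "S \<in> isometry_rel G `` {T}" "S' \<in> isometry_rel G `` {T'}" "r = ln (Lip G S S')"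
    by (elim bexE)
  have "Lip G S S' = Lip G T T'"
    by (rule Lip_isometric[OF unit_tree_action[OF T] unit_tree_action[OF T']])
      (use S(1,2) in \<open>simp_all add: isometry_rel_def\<close>)
  then show "r = ln (Lip G T T')" using S(3) by simp
qed

section \<open>Folded trees and folding paths\<close>

lemma Inf_scale:
  fixes S :: "real set"
  assumes "0 < c" "S \<noteq> {}" "bdd_below S"
  shows "Inf ((*) c ` S) = c * Inf S"
proof (rule antisym)
  have bdd: "bdd_below ((*) c ` S)"
    using assms(1) bdd_below_image_mono[of "(*) c" S] assms(3) by (simp add: mono_def)
  have "Inf ((*) c ` S) / c \<le> Inf S"
  proof (rule cInf_greatest[OF assms(2)])
    fix s assume "s \<in> S"
    then have "Inf ((*) c ` S) \<le> c * s" using bdd by (intro cInf_lower) auto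
    then show "Inf ((*) c ` S) / c \<le> s" using assms(1) by (simp add: divide_le_eq mult.commute)
  qed
  then show "Inf ((*) c ` S) \<le> c * Inf S" using assms(1) by (simp add: divide_le_eq mult.commute)
  show "c * Inf S \<le> Inf ((*) c ` S)"
    using assms by (intro cInf_greatest) (auto intro!: mult_left_mono cInf_lower)
qed

definition chain_lengths :: "'a metric \<Rightarrow> ('a \<times> 'a) set \<Rightarrow> 'a set \<Rightarrow> 'a set \<Rightarrow> real set" where
  "chain_lengths m R A B = {sum_list (map (\<lambda>(p, q). mdist m p q) ps) | ps.
     ps \<noteq> [] \<and> set ps \<subseteq> mspace m \<times> mspace m \<and> fst (hd ps) \<in> A \<and> snd (last ps) \<in> B \<and>
     successively (\<lambda>(p, q) (p', q'). (q, p') \<in> R) ps}"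

lemma quotient_dist_eq:
  "quotient_dist m R A B =
    (if A \<in> mspace m // R \<and> B \<in> mspace m // R then Inf (chain_lengths m R A B) else 0)"
  by (simp add: quotient_dist_def chain_lengths_def)

lemma chain_lengths_nonneg:
  assumes "r \<in> chain_lengths m R A B" shows "0 \<le> r"
  using assms unfolding chain_lengths_def by (auto intro!: sum_list_nonneg)

lemma chain_lengths_bdd: "bdd_below (chain_lengths m R A B)"
  using chain_lengths_nonneg by (auto intro!: bdd_belowI[of _ 0])

lemma chain_lengths_pair:
  assumes "a \<in> A" "b \<in> B" "a \<in> mspace m" "b \<in> mspace m"
  shows "mdist m a b \<in> chain_lengths m R A B"
  unfolding chain_lengths_def using assms by (intro CollectI exI[of _ "[(a, b)]"]) auto

lemma chain_lengths_commute_subset: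
  assumes "sym R" shows "chain_lengths m R A B \<subseteq> chain_lengths m R B A"
proof
  fix r assume "r \<in> chain_lengths m R A B"
  then obtain ps where ps: "r = sum_list (map (\<lambda>(p, q). mdist m p q) ps)" "ps \<noteq> []"
    "set ps \<subseteq> mspace m \<times> mspace m" "fst (hd ps) \<in> A" "snd (last ps) \<in> B"
    "successively (\<lambda>(p, q) (p', q'). (q, p') \<in> R) ps" unfolding chain_lengths_def by auto
  define qs where "qs = rev (map (\<lambda>(p, q). (q, p)) ps)"
  have "map (\<lambda>(p, q). mdist m p q) qs = rev (map (\<lambda>(p, q). mdist m p q) ps)"
    unfolding qs_def by (auto simp: rev_map mdist_commute)
  then have "r = sum_list (map (\<lambda>(p, q). mdist m p q) qs)" using ps(1) by (simp add: sum_list_rev)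
  moreover have "qs \<noteq> []" "set qs \<subseteq> mspace m \<times> mspace m" using ps(2,3) by (auto simp: qs_def)
  moreover have "fst (hd qs) \<in> B" "snd (last qs) \<in> A"
    using ps(2,4,5) by (auto simp: qs_def hd_rev last_rev last_map hd_map split: prod.splits)
  moreover have "successively (\<lambda>(p, q) (p', q'). (q, p') \<in> R) qs"
    unfolding qs_def successively_rev successively_map
    by (rule successively_mono[OF ps(6)]) (use assms in \<open>auto dest: symD\<close>)
  ultimately show "r \<in> chain_lengths m R B A" unfolding chain_lengths_def by blast
qed

text \<open>Chains are concatenated across B: the end of the first and the start of the second are
  related as members of one class. This is the source of the triangle inequality.\<close>

lemma chain_lengths_add:
  assumes r: "r \<in> chain_lengths m R A B" and s: "s \<in> chain_lengths m R B C"
    and B: "\<And>x y. x \<in> B \<Longrightarrow> y \<in> B \<Longrightarrow> (x, y) \<in> R"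
  shows "r + s \<in> chain_lengths m R A C"
proof -
  obtain ps where ps: "r = sum_list (map (\<lambda>(p, q). mdist m p q) ps)" "ps \<noteq> []"
    "set ps \<subseteq> mspace m \<times> mspace m" "fst (hd ps) \<in> A" "snd (last ps) \<in> B"
    "successively (\<lambda>(p, q) (p', q'). (q, p') \<in> R) ps" using r unfolding chain_lengths_def by auto
  obtain qs where qs: "s = sum_list (map (\<lambda>(p, q). mdist m p q) qs)" "qs \<noteq> []"
    "set qs \<subseteq> mspace m \<times> mspace m" "fst (hd qs) \<in> B" "snd (last qs) \<in> C"
    "successively (\<lambda>(p, q) (p', q'). (q, p') \<in> R) qs" using s unfolding chain_lengths_def by auto
  have "successively (\<lambda>(p, q) (p', q'). (q, p') \<in> R) (ps @ qs)"
    using ps(5,6) qs(4,6) B by (auto simp: successively_append_iff split: prod.splits)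
  then show ?thesis unfolding chain_lengths_def
    using ps(1-4) qs(1-3,5) by (intro CollectI exI[of _ "ps @ qs"]) auto
qed

section \<open>The folding relation and its quotient metric\<close>

context rtree
begin

text \<open>Transitivity is where the tree matters: the segment from x to z is covered by those from
  y to x and to z, and the balls have the common center f x = f y = f z.\<close>

lemma fold_rel_equiv:
  assumes f: "f ` M \<subseteq> mspace m'" and t: "0 \<le> t"
  shows "equiv M (fold_rel m m' f t)"
proof (rule equivI)
  show "fold_rel m m' f t \<subseteq> M \<times> M" by (auto simp: fold_rel_def)
  show "refl_on M (fold_rel m m' f t)"
  proof (rule refl_onI)
    fix x assume x: "x \<in> M"
    then have "f x \<in> mspace m'" using f by blast
    then have "mdist m' (f x) (f x) = 0" by simp
    then have "mdist m' (f x) (f x) \<le> t" using t by linarith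
    with \<open>f x \<in> mspace m'\<close> show "(x, x) \<in> fold_rel m m' f t" using x t by (simp add: fold_rel_def)
  qed
  show "sym (fold_rel m m' f t)"
    by (rule symI) (auto simp: fold_rel_def seg_commute)
  show "trans (fold_rel m m' f t)"
  proof (rule transI)
    fix x y z assume xy: "(x, y) \<in> fold_rel m m' f t" and yz: "(y, z) \<in> fold_rel m m' f t"
    have M: "x \<in> M" "y \<in> M" "z \<in> M" and e: "f x = f y" "f y = f z"
      using xy yz by (auto simp: fold_rel_def)
    have "seg m x z \<subseteq> seg m x y \<union> seg m y z" using seg_through[OF M(1,3,2)] by blast
    then show "(x, z) \<in> fold_rel m m' f t"
      using xy yz M e unfolding fold_rel_def by (simp add: image_subset_iff) blast
  qed
qed

text \<open>A chain of length \<open>l\<close> between \<open>x\<close> and \<open>y\<close> shows that \<open>f\<close> maps the segment between them into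
  the ball of radius \<open>t + K l\<close>. So classes at distance zero coincide.\<close>

lemma fold_chain_image:
  assumes L: "\<And>x y. x \<in> M \<Longrightarrow> y \<in> M \<Longrightarrow> mdist m' (f x) (f y) \<le> K * d x y"
    and f: "f ` M \<subseteq> mspace m'" and t: "0 \<le> t" and K: "0 \<le> K"
    and ps: "ps \<noteq> []" "set ps \<subseteq> M \<times> M" "successively (\<lambda>(p, q) (p', q'). (q, p') \<in> fold_rel m m' f t) ps"
  shows "mdist m' (f (fst (hd ps))) (f (snd (last ps))) \<le> K * sum_list (map (\<lambda>(p, q). d p q) ps) \<and>
    (\<forall>z\<in>seg m (fst (hd ps)) (snd (last ps)).
      mdist m' (f (fst (hd ps))) (f z) \<le> t + K * sum_list (map (\<lambda>(p, q). d p q) ps))"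
  using ps
proof (induction ps rule: list_nonempty_induct)
  case (single x)
  obtain p q where x: "x = (p, q)" by (cases x)
  have M: "p \<in> M" "q \<in> M" using single x by auto
  have "mdist m' (f p) (f z) \<le> t + K * d p q" if z: "z \<in> seg m p q" for z
  proof -
    have "mdist m' (f p) (f z) \<le> K * d p z" using L M z seg_subset by blast
    also have "\<dots> \<le> K * d p q" using seg_le(1)[OF z] K by (rule mult_left_mono)
    finally show ?thesis using t by simp
  qed
  then show ?case using L[OF M] x by simp
next
  case (cons x xs)
  obtain p q where x: "x = (p, q)" by (cases x)
  define p' where "p' = fst (hd xs)"
  define y where "y = snd (last xs)"
  define l where "l = sum_list (map (\<lambda>(p, q). d p q) xs)"
  have M: "p \<in> M" "q \<in> M" using cons.prems x by auto
  have "hd xs \<in> M \<times> M" "last xs \<in> M \<times> M" using cons.hyps cons.prems hd_in_set last_in_set by fastforce+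
  then have M': "p' \<in> M" "y \<in> M" by (auto simp: p'_def y_def)
  have suc: "(q, p') \<in> fold_rel m m' f t" "successively (\<lambda>(p, q) (p', q'). (q, p') \<in> fold_rel m m' f t) xs"
    using cons.prems cons.hyps x by (auto simp: successively_Cons p'_def split: prod.splits)
  have IH: "mdist m' (f p') (f y) \<le> K * l" "\<And>z. z \<in> seg m p' y \<Longrightarrow> mdist m' (f p') (f z) \<le> t + K * l"
    using cons.IH cons.prems suc(2) by (auto simp: p'_def y_def l_def)
  have fq: "f q = f p'" "\<And>z. z \<in> seg m q p' \<Longrightarrow> mdist m' (f q) (f z) \<le> t"
    using suc(1) by (auto simp: fold_rel_def)
  have fM: "f w \<in> mspace m'" if "w \<in> M" for w using f that by blast
  have l0: "0 \<le> K * l" using K by (auto simp: l_def intro!: mult_nonneg_nonneg sum_list_nonneg)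
  have Kpq: "0 \<le> K * d p q" using K by simp
  have tri: "mdist m' (f p) (f w) \<le> K * d p q + mdist m' (f q) (f w)" if "w \<in> M" for w
    using mdist_triangle[OF fM[OF M(1)] fM[OF M(2)] fM[OF that]] L[OF M] by linarith
  have 1: "mdist m' (f p) (f y) \<le> K * (d p q + l)"
    using tri[OF M'(2)] fq(1) IH(1) by (simp add: distrib_left)
  have 2: "mdist m' (f p) (f z) \<le> t + K * (d p q + l)" if z: "z \<in> seg m p y" for z
  proof -
    have zM: "z \<in> M" using z seg_subset by blast
    \<comment> \<open>The three pieces are the first link, the jump from q to p' and the rest of the
      chain. The bound t does not accumulate over the jumps: f q = f p', so a jump returns to its
      starting point in the target, and z has to be estimated on one piece only.\<close>
    consider "z \<in> seg m p q" | "z \<in> seg m q p'" | "z \<in> seg m p' y"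
      using seg_through[OF M(1) M'(2) M(2) z] seg_through[OF M(2) M'(2) M'(1)] by blast
    then have "mdist m' (f p) (f z) \<le> t + (K * d p q + K * l)"
    proof cases
      case 1
      have "mdist m' (f p) (f z) \<le> K * d p z" using L M zM by blast
      also have "\<dots> \<le> K * d p q" using seg_le(1)[OF 1] K by (rule mult_left_mono)
      finally show ?thesis using t l0 by simp
    next
      case 2 then show ?thesis using tri[OF zM] fq(2)[OF 2] l0 by linarith
    next
      case 3 then show ?thesis using tri[OF zM] IH(2)[OF 3] fq(1) by simp
    qed
    then show ?thesis by (simp add: distrib_left)
  qed
  show ?case using 1 2 x cons.hyps by (simp add: p'_def y_def l_def)
qed

text \<open>Gives \<open>metric\<close> in \<open>quotient_tree\<close> its intended meaning. Only
  definiteness needs geometry: if there are arbitrarily short chains between the classes of a and b,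
  then \<open>fold_chain_image\<close> yields f a = f b and puts the image of the segment from a to
  b into the ball of radius t + e for every e > 0, hence into that of radius t.\<close>

lemma quotient_dist_Metric_space:
  assumes L: "\<And>x y. x \<in> M \<Longrightarrow> y \<in> M \<Longrightarrow> mdist m' (f x) (f y) \<le> K * d x y"
    and f: "f ` M \<subseteq> mspace m'" and t: "0 \<le> t" and K: "0 \<le> K"
  defines "R \<equiv> fold_rel m m' f t"
  shows "Metric_space (M // R) (quotient_dist m R)"
proof
  have eq: "equiv M R" unfolding R_def by (rule fold_rel_equiv[OF f t])
  have symR: "sym R" using eq by (rule equivE)
  have cls: "\<exists>a. a \<in> A" "A \<subseteq> M" if "A \<in> M // R" for A
    using that in_quotient_imp_non_empty[OF eq] in_quotient_imp_subset[OF eq] by blast+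
  have rel: "(x, y) \<in> R" if "A \<in> M // R" "x \<in> A" "y \<in> A" for A x y
    using in_quotient_imp_in_rel[OF eq that(1)] that(2,3) by blast
  have ne: "chain_lengths m R A B \<noteq> {}" if "A \<in> M // R" "B \<in> M // R" for A B
    using chain_lengths_pair[of _ A _ B m R] cls[OF that(1)] cls[OF that(2)] by blast
  show nonneg: "0 \<le> quotient_dist m R A B" for A B
    unfolding quotient_dist_eq using chain_lengths_nonneg ne by (auto intro!: cInf_greatest)
  show "quotient_dist m R A B = quotient_dist m R B A" for A B
    unfolding quotient_dist_eq
    using chain_lengths_commute_subset[OF symR, of m A B] chain_lengths_commute_subset[OF symR, of m B A]
    by (simp add: conj_commute subset_antisym)
  show "quotient_dist m R A C \<le> quotient_dist m R A B + quotient_dist m R B C"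
    if "A \<in> M // R" "B \<in> M // R" "C \<in> M // R" for A B C
  proof -
    have le: "Inf (chain_lengths m R A C) \<le> r + s"
      if "r \<in> chain_lengths m R A B" "s \<in> chain_lengths m R B C" for r s
      using chain_lengths_add[OF that rel[OF \<open>B \<in> M // R\<close>]] chain_lengths_bdd by (intro cInf_lower)
    have "Inf (chain_lengths m R A C) - s \<le> Inf (chain_lengths m R A B)"
      if "s \<in> chain_lengths m R B C" for s
      by (rule cInf_greatest[OF ne]) (use le that \<open>A \<in> M // R\<close> \<open>B \<in> M // R\<close> in \<open>force simp: algebra_simps\<close>)+
    then have "Inf (chain_lengths m R A C) - Inf (chain_lengths m R A B) \<le> s"
      if "s \<in> chain_lengths m R B C" for s
      using that by (force simp: algebra_simps)
    then have "Inf (chain_lengths m R A C) - Inf (chain_lengths m R A B) \<le> Inf (chain_lengths m R B C)"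
      by (rule cInf_greatest[OF ne[OF that(2,3)]])
    then show ?thesis using that by (simp add: quotient_dist_eq)
  qed
  show "quotient_dist m R A B = 0 \<longleftrightarrow> A = B" if AB: "A \<in> M // R" "B \<in> M // R" for A B
  proof
    assume "A = B"
    obtain a where a: "a \<in> A" using cls(1)[OF AB(1)] by blast
    have "a \<in> M" using a cls(2)[OF AB(1)] by blast
    then have "0 \<in> chain_lengths m R A B"
      using chain_lengths_pair[OF a _ \<open>a \<in> M\<close> \<open>a \<in> M\<close>, of B R] a \<open>A = B\<close> by simp
    then have "quotient_dist m R A B \<le> 0"
      unfolding quotient_dist_eq using AB cInf_lower[OF _ chain_lengths_bdd] by simp
    then show "quotient_dist m R A B = 0" using nonneg[of A B] by simp
  next
    assume zero: "quotient_dist m R A B = 0"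
    obtain a where a: "a \<in> A" "a \<in> M" using cls[OF AB(1)] by blast
    obtain b where b: "b \<in> B" "b \<in> M" using cls[OF AB(2)] by blast
    have fab: "f a \<in> mspace m'" "f b \<in> mspace m'" using f a b by auto
    have small: "mdist m' (f a) (f b) \<le> e \<and> (\<forall>z\<in>seg m a b. mdist m' (f a) (f z) \<le> t + e)" if e: "0 < e" for e
    proof -
      \<comment> \<open>K + 1 in place of K, because K may be 0.\<close>
      have pos: "0 < e / (K + 1)" using e K by simp
      have "Inf (chain_lengths m R A B) < e / (K + 1)" using zero AB pos by (simp add: quotient_dist_eq)
      then obtain r where r: "r \<in> chain_lengths m R A B" "r < e / (K + 1)"
        using cInf_lessD[OF ne[OF AB]] by blast
      obtain ps where ps: "r = sum_list (map (\<lambda>(p, q). d p q) ps)" "ps \<noteq> []"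
        "set ps \<subseteq> M \<times> M" "fst (hd ps) \<in> A" "snd (last ps) \<in> B"
        "successively (\<lambda>(p, q) (p', q'). (q, p') \<in> R) ps" using r(1) unfolding chain_lengths_def by auto
      \<comment> \<open>The constant links at both ends have length 0; they make the chain run from
        a to b themselves, not only between their classes.\<close>
      define qs where "qs = (a, a) # ps @ [(b, b)]"
      have qs: "qs \<noteq> []" "set qs \<subseteq> M \<times> M" "fst (hd qs) = a" "snd (last qs) = b"
        using ps(3) a b by (auto simp: qs_def)
      have sum: "sum_list (map (\<lambda>(p, q). d p q) qs) = r" using ps(1) a b by (simp add: qs_def)
      have "successively (\<lambda>(p, q) (p', q'). (q, p') \<in> R) qs"
        using ps(2,4,5,6) rel[OF AB(1) a(1)] rel[OF AB(2) _ b(1)]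
        by (auto simp: qs_def successively_Cons successively_append_iff hd_append split: prod.splits)
      then have "mdist m' (f a) (f b) \<le> K * r \<and> (\<forall>z\<in>seg m a b. mdist m' (f a) (f z) \<le> t + K * r)"
        using fold_chain_image[OF L f t K qs(1,2)] qs(3,4) sum unfolding R_def by simp
      moreover have "K * r \<le> e"
      proof -
        have r0: "0 \<le> r" using chain_lengths_nonneg[OF r(1)] .
        have "r * (K + 1) < e" using r(2) K by (simp add: pos_less_divide_eq)
        then show ?thesis using r0 by (simp add: algebra_simps)
      qed
      ultimately show ?thesis by force
    qed
    have "mdist m' (f a) (f b) \<le> 0"
      by (rule field_le_epsilon) (use small in simp)
    then have "f a = f b" using fab mdist_nonneg[of m' "f a" "f b"] by (metis mdist_zero order_antisym)
    moreover have "mdist m' (f a) (f z) \<le> t" if "z \<in> seg m a b" for z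
      by (rule field_le_epsilon) (use small that in simp)
    ultimately have "(a, b) \<in> R"
      using a b f seg_subset by (auto simp: R_def fold_rel_def image_subset_iff subset_iff)
    then show "A = B" using quotient_eqI[OF eq AB a(1) b(1)] by simp
  qed
qed

end

lemma quotient_dist_rescaling:
  assumes r: "rescaling c m m'" and R: "equiv (mspace m) R"
  shows "quotient_dist m' R = (\<lambda>A B. c * quotient_dist m R A B)"
proof (intro ext)
  fix A B
  have c: "0 < c" and eq: "mspace m' = mspace m" "mdist m' = (\<lambda>x y. c * mdist m x y)"
    using r by (simp_all add: rescaling_def)
  have sum: "sum_list (map (\<lambda>(p, q). c * mdist m p q) ps) = c * sum_list (map (\<lambda>(p, q). mdist m p q) ps)" for ps
    by (induction ps) (auto simp: distrib_left)
  have im: "chain_lengths m' R A B = (*) c ` chain_lengths m R A B"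
    unfolding chain_lengths_def eq sum by blast
  show "quotient_dist m' R A B = c * quotient_dist m R A B"
  proof (cases "A \<in> mspace m // R \<and> B \<in> mspace m // R")
    case True
    then obtain a b where ab: "a \<in> A" "b \<in> B" "a \<in> mspace m" "b \<in> mspace m"
      using in_quotient_imp_non_empty[OF R] in_quotient_imp_subset[OF R] by (metis ex_in_conv subsetD)
    then have "chain_lengths m R A B \<noteq> {}" using chain_lengths_pair[OF ab, of R] by blast
    then show ?thesis
      using True Inf_scale[OF c _ chain_lengths_bdd, of m R A B] by (simp add: quotient_dist_eq im eq(1))
  next
    case False
    then show ?thesis by (auto simp: quotient_dist_eq eq(1))
  qed
qed

text \<open>Scaling both trees by c leaves the Lipschitz constant of f unchanged, and a ball of
  radius t in the new target is one of radius t / c in the old. So the folding relation is the old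
  one at time t / c, and only the quotient distance is multiplied by c. Positivity of the Lipschitz
  constant matters because \<open>fold_tree\<close> divides by it.\<close>

lemma fold_tree_gscale:
  assumes T: "rtree (metr T)" and f: "Lipschitz_continuous_map (metr T) (metr T') f"
    and pos: "0 < lip_const (metr T) (metr T') f" and t: "0 \<le> t" and c: "0 < c"
  shows "fold_tree (gscale c T) (gscale c T') f t = gscale c (fold_tree T T' f (t / c))"
proof -
  interpret rtree "metr T" by (rule T)
  let ?l = "lip_const (metr T) (metr T') f"
  note rT = rescaling_gscale[OF c, of T] and rT' = rescaling_gscale[OF c, of T']
  have l: "0 < 1 / ?l" using pos by simp
  have lc: "lip_const (metr (gscale c T)) (metr (gscale c T')) f = ?l" by (rule rescaling_lip_const[OF rT rT'])
  define R where "R = fold_rel (metr T) (metr (gscale (1 / ?l) T')) f (t / c)"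
  have fM: "f ` M \<subseteq> points (gscale (1 / ?l) T')"
    using f l by (auto simp: Lipschitz_continuous_map_def)
  have tc: "0 \<le> t / c" using t c by simp
  have eqR: "equiv M R" unfolding R_def by (rule fold_rel_equiv[OF fM tc])
  have fr: "fold_rel (metr (gscale c T)) (metr (gscale (1 / ?l) (gscale c T'))) f t = R"
  proof -
    have "1 / ?l * (c * a) \<le> t \<longleftrightarrow> 1 / ?l * a \<le> t / c" for a
      using c by (simp add: pos_le_divide_eq ac_simps)
    then show ?thesis using c l
      by (simp add: R_def fold_rel_def image_subset_iff rescaling_seg[OF rT])
  qed
  \<comment> \<open>In the target divided by the Lipschitz constant, f is 1-Lipschitz; so
    \<open>quotient_dist_Metric_space\<close> applies with K = 1.\<close>
  have bound: "mdist (metr (gscale (1 / ?l) T')) (f x) (f y) \<le> 1 * d x y" if "x \<in> M" "y \<in> M" for x y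
    using lip_const_bound[OF f that] l pos by (simp add: divide_le_eq mult.commute)
  interpret Q: Metric_space "M // R" "quotient_dist (metr T) R"
    unfolding R_def by (rule quotient_dist_Metric_space[OF bound fM tc]) auto
  have ft: "fold_tree T T' f (t / c) = quotient_tree T R"
    by (simp add: fold_tree_def R_def Let_def)
  have pts: "points (quotient_tree T R) = M // R" by (simp add: quotient_tree_def)
  have ds: "mdist (metr (quotient_tree T R)) = quotient_dist (metr T) R" by (simp add: quotient_tree_def)
  have "fold_tree (gscale c T) (gscale c T') f t = quotient_tree (gscale c T) R"
    by (simp add: fold_tree_def Let_def lc fr)
  also have "\<dots> = \<lparr>metr = metric (M // R, \<lambda>A B. c * quotient_dist (metr T) R A B),
      act = (\<lambda>g. \<lambda>C \<in> M // R. act T g ` C)\<rparr>"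
    using c quotient_dist_rescaling[OF rT eqR] by (simp add: quotient_tree_def)
  also have "\<dots> = gscale c (quotient_tree T R)"
    unfolding gscale_def pts ds by (simp add: quotient_tree_def)
  finally show ?thesis by (simp add: ft)
qed

section \<open>Folding maps under rescaling and restriction\<close>

lemma rescaling_gates:
  assumes r: "rescaling c m1 m1'" "rescaling c m2 m2'"
  shows "gates m1' D m2' f x = gates m1 D m2 f x"
proof -
  have M: "mspace m1' = mspace m1" "mspace m2' = mspace m2" using r by (auto simp: rescaling_def)
  have dir: "directions_in m' D x = directions_in m D x" if "rescaling c m m'" for m m' :: "'x metric" and D x
    using that by (simp add: directions_in_def direction_def rescaling_seg[OF that] rescaling_def)
  have "sends_direction m1' m2' f x d1 d2 = sends_direction m1 m2 f x d1 d2" for d1 d2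
    by (simp add: sends_direction_def dir[OF r(2)] M rescaling_seg[OF r(1)])
  then show ?thesis by (simp add: gates_def dir[OF r(1)])
qed

lemma rescaling_piecewise_linear:
  assumes r: "rescaling c m1 m1'" "rescaling c m2 m2'"
  shows "piecewise_linear m1' V m2' f \<longleftrightarrow> piecewise_linear m1 V m2 f"
    and "tension_forest m1' V m2' f = tension_forest m1 V m2 f"
proof -
  have "c * a = k * (c * b) \<longleftrightarrow> a = k * b" for a b k :: real
    using r by (simp add: rescaling_def mult.left_commute[of k])
  then have iff: "mdist m2' (f x) (f y) = k * mdist m1' x y \<longleftrightarrow> mdist m2 (f x) (f y) = k * mdist m1 x y" for x y k
    using r by (simp add: rescaling_def)
  show "piecewise_linear m1' V m2' f \<longleftrightarrow> piecewise_linear m1 V m2 f"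
    by (simp add: piecewise_linear_def iff rescaling_edges[OF r(1)])
  have "slope m1' m2' f e = slope m1 m2 f e" for e by (simp add: slope_def iff)
  then show "tension_forest m1' V m2' f = tension_forest m1 V m2 f"
    by (simp add: tension_forest_def rescaling_edges[OF r(1)])
qed

lemma equivariant_restrict:
  "subgroup H G \<Longrightarrow> equivariant G T T' f \<Longrightarrow> equivariant (G\<lparr>carrier := H\<rparr>) T T' f"
  using subgroup.subset[of H G] by (auto simp: equivariant_def subset_iff)

lemma equivariantly_isometric_restrict:
  "subgroup H G \<Longrightarrow> equivariantly_isometric G T T' \<Longrightarrow> equivariantly_isometric (G\<lparr>carrier := H\<rparr>) T T'"
  unfolding equivariantly_isometric_def by (metis equivariant_restrict)

text \<open>Slopes, tension forest and gates do not involve the group and survive a common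
  rescaling. The group enters through invariance and equivariance, which pass to subgroups, and
  through the minimality of the Lipschitz constant, which is kept by
  \<open>Lip_restrict\<close>.\<close>

lemma folding_map_restrict_gscale:
  assumes T: "outer_tree G T" and T': "outer_tree G T'"
    and H: "subgroup H G" "finite (rcosets\<^bsub>G\<^esub> H)" and c: "0 < c" and f: "folding_map G T T' f"
  shows "folding_map (G\<lparr>carrier := H\<rparr>) (gscale c T) (gscale c T') f"
proof -
  note r = rescaling_gscale[OF c, of T] rescaling_gscale[OF c, of T']
  obtain V where V: "optimal_map G T V T' f" "tension_forest (metr T) V (metr T') f = points T"
    using f unfolding folding_map_def by blast
  have "optimal_map (G\<lparr>carrier := H\<rparr>) (gscale c T) V (gscale c T') f"
    using V(1) c Lip_restrict[OF T T' H]
    by (simp add: optimal_map_def invariant_structure_restrict[OF _ H(1)] equivariant_restrict[OF H(1)] invariant_structure_gscale equivariant_gscale Lip_gscale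
        rescaling_piecewise_linear[OF r] rescaling_Lipschitz[OF r] rescaling_lip_const[OF r] rescaling_gates[OF r])
  then show ?thesis
    unfolding folding_map_def using V(2) c rescaling_piecewise_linear(2)[OF r] by auto
qed

section \<open>Unit volume and isometry classes under restriction\<close>

lemma outer_tree_invariant_structure:
  assumes "outer_tree G T" "virtually_nonabelian_free G"
  obtains V where "invariant_structure G T V"
proof -
  interpret tree_action T G by (rule outer_tree_action[OF assms(1)])
  obtain V0 where "simplicial_structure (metr T) V0"
    using assms(1) by (auto simp: outer_tree_def simplicial_tree_def)
  moreover have "minimal_action G T" "\<And>x. x \<in> M \<Longrightarrow> finite (stabilizer G (act T) x)"
    using assms(1) by (simp_all add: outer_tree_def)
  ultimately show thesis using invariant_structure_exists[OF _ _ assms(2)] that by blast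
qed

lemma structure_volume_gscale:
  assumes T: "outer_tree G T" and V: "invariant_structure G T V" and c: "0 < c"
  shows "structure_volume G (gscale c T) V = c * structure_volume G T V"
proof -
  note r = rescaling_gscale[OF c, of T]
  interpret tree_action T G by (rule outer_tree_action[OF T])
  interpret T': rtree "metr (gscale c T)"
    using rescaling_real_tree[OF r real_tree] by (simp add: rtree_def)
  interpret E: set_action G "edges (metr T) V" "\<lambda>g e. act T g ` e" by (rule edges_set_action[OF V])
  have VM: "V \<subseteq> M" using simplicial_structureD(1)[OF invariant_structureD(1)[OF V]] .
  have len: "edge_length (metr (gscale c T)) e = c * edge_length (metr T) e" if e: "e \<in> edges (metr T) V" for e
  proof -
    obtain u v where uv: "e = seg (metr T) u v" "u \<in> V" "v \<in> V" using edgeE[OF e] by metis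
    have "u \<in> M" "v \<in> M" using uv VM by auto
    then show ?thesis
      using edge_length_seg[of u v] T'.edge_length_seg[of u v] c uv(1) rescaling_seg[OF r] by simp
  qed
  have some: "(SOME e. e \<in> Q) \<in> edges (metr T) V" if Q: "Q \<in> orbits G (edges (metr T) V) (\<lambda>g e. act T g ` e)" for Q
  proof -
    obtain e where e: "e \<in> edges (metr T) V" "Q = orbit G (\<lambda>g e. act T g ` e) e" using Q by (auto simp: orbits_def)
    have "e \<in> Q" using E.orbit_self[OF e(1)] e(2) by simp
    then have "(SOME e. e \<in> Q) \<in> Q" by (rule someI)
    then show ?thesis using E.orbit_subset[OF e(1)] e(2) by blast
  qed
  show ?thesis unfolding structure_volume_def sum_distrib_left rescaling_edges[OF r] act_gscale
    by (rule sum.cong[OF refl]) (simp add: Let_def len[OF some])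
qed

text \<open>One vertex set V, invariant under G, serves for both groups and for both scales. All
  volumes are computed with V, and the factor n from the restriction cancels 1/n.\<close>

lemma unit_trees_restrict:
  assumes vf: "virtually_nonabelian_free G" and H: "subgroup H G" "finite (rcosets\<^bsub>G\<^esub> H)"
    and n: "n = card (rcosets\<^bsub>G\<^esub> H)" "0 < n" and T: "T \<in> unit_trees G"
  shows "gscale (1 / real n) T \<in> unit_trees (G\<lparr>carrier := H\<rparr>)"
proof -
  let ?H = "G\<lparr>carrier := H\<rparr>"
  have c: "0 < 1 / real n" using n by simp
  have oT: "outer_tree G T" and vT: "vol G T = 1" using T by (auto simp: unit_trees_def)
  interpret tree_action T G by (rule outer_tree_action[OF oT])
  have stab: "finite (stabilizer G (act T) x)" if "x \<in> M" for x using oT that by (simp add: outer_tree_def)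
  have "stabilizer ?H (act T) x \<subseteq> stabilizer G (act T) x" for x
    using subgroup.subset[OF H(1)] by (auto simp: stabilizer_def)
  then have stabH: "finite (stabilizer ?H (act T) x)" if "x \<in> M" for x
    using stab[OF that] finite_subset by blast
  have oH: "outer_tree ?H T"
    unfolding outer_tree_def
    using oT isometric_action_restrict[OF isometric H(1)] minimal_restrict[OF _ H] stabH
    by (simp add: outer_tree_def)
  note oH' = outer_tree_gscale[OF c oH]
  interpret H': tree_action "gscale (1 / real n) T" ?H by (rule outer_tree_action[OF oH'])
  obtain V where V: "invariant_structure G T V" using outer_tree_invariant_structure[OF oT vf] .
  have VH: "invariant_structure ?H T V" using invariant_structure_restrict[OF V H(1)] .
  have VH': "invariant_structure ?H (gscale (1 / real n) T) V" using VH invariant_structure_gscale[OF c] by blast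
  have "vol ?H (gscale (1 / real n) T) = structure_volume ?H (gscale (1 / real n) T) V"
    by (rule H'.vol_eq[OF VH'])
  also have "\<dots> = 1 / real n * structure_volume ?H T V" by (rule structure_volume_gscale[OF oH VH c])
  also have "\<dots> = structure_volume G T V"
    using structure_volume_restrict[OF V H stab] n by simp
  also have "\<dots> = 1" using vol_eq[OF V] vT by simp
  finally show ?thesis using oH' by (simp add: unit_trees_def)
qed

text \<open>Isometric trees have isometric multiples, also over H, so the union over the whole class
  in \<open>restrict_class\<close> collapses to the class of one tree.\<close>

lemma restrict_class_eq:
  assumes vf: "virtually_nonabelian_free G" and H: "subgroup H G" "finite (rcosets\<^bsub>G\<^esub> H)"
    and n: "n = card (rcosets\<^bsub>G\<^esub> H)" "0 < n" and T: "T \<in> unit_trees G"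
  shows "restrict_class G H n (isometry_rel G `` {T}) =
    isometry_rel (G\<lparr>carrier := H\<rparr>) `` {gscale (1 / real n) T}"
proof -
  let ?H = "G\<lparr>carrier := H\<rparr>"
  have c: "0 < 1 / real n" using n by simp
  have T1: "gscale (1 / real n) T \<in> unit_trees ?H" by (rule unit_trees_restrict[OF vf H n T])
  have cls: "isometry_rel ?H `` {gscale (1 / real n) S} = isometry_rel ?H `` {gscale (1 / real n) T}"
    if S: "S \<in> isometry_rel G `` {T}" for S
  proof (rule isometry_rel_class_eq[OF T1])
    have "S \<in> unit_trees G" "equivariantly_isometric G T S" using S by (simp_all add: isometry_rel_def)
    then show "gscale (1 / real n) S \<in> isometry_rel ?H `` {gscale (1 / real n) T}"
      unfolding isometry_rel_class[OF T1]
      by (simp add: unit_trees_restrict[OF vf H n] equivariantly_isometric_gscale[OF c]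
          equivariantly_isometric_restrict[OF H(1)])
  qed
  have "restrict_class G H n (isometry_rel G `` {T}) =
      (\<Union>S\<in>isometry_rel G `` {T}. isometry_rel ?H `` {gscale (1 / real n) S})"
    unfolding restrict_class_def by blast
  also have "\<dots> = (\<Union>S\<in>isometry_rel G `` {T}. isometry_rel ?H `` {gscale (1 / real n) T})"
    by (intro SUP_cong refl cls)
  also have "\<dots> = isometry_rel ?H `` {gscale (1 / real n) T}"
  proof -
    have "T \<in> isometry_rel G `` {T}"
      using T by (simp add: isometry_rel_def equivariantly_isometric_refl)
    then have "isometry_rel G `` {T} \<noteq> {}" by blast
    then show ?thesis by simp
  qed
  finally show ?thesis .
qed

text \<open>A map with Lipschitz constant 0 is constant, and its value is fixed by the whole group.
  By minimality T' would be that point; it would have no edges, and its volume would be 0 instead of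
  1.\<close>

lemma lip_const_pos:
  assumes vf: "virtually_nonabelian_free G" and T: "T \<in> unit_trees G" and T': "T' \<in> unit_trees G"
    and f: "equivariant G T T' f" "Lipschitz_continuous_map (metr T) (metr T') f"
  shows "0 < lip_const (metr T) (metr T') f"
proof (rule ccontr)
  assume "\<not> ?thesis"
  then have zero: "lip_const (metr T) (metr T') f = 0" using lip_const_nonneg[OF f(2)] by linarith
  have oT: "outer_tree G T" "outer_tree G T'" "vol G T' = 1" using T T' by (auto simp: unit_trees_def)
  interpret T: tree_action T G by (rule outer_tree_action[OF oT(1)])
  interpret T': tree_action T' G by (rule outer_tree_action[OF oT(2)])
  have "T.M \<noteq> {}" using oT(1) by (simp add: outer_tree_def simplicial_tree_def)
  then obtain x0 where x0: "x0 \<in> T.M" by blast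
  have fM: "f x \<in> T'.M" if "x \<in> T.M" for x using f(1) that by (auto simp: equivariant_def)
  have const: "f x = f x0" if "x \<in> T.M" for x
    using lip_const_bound[OF f(2) that x0] zero fM[OF that] fM[OF x0]
      mdist_nonneg[of "metr T'" "f x" "f x0"] by (simp add: order_antisym)
  have fixed: "act T' g (f x0) = f x0" if g: "g \<in> carrier G" for g
  proof -
    have "act T' g (f x0) = f (act T g x0)" using f(1) g x0 by (simp add: equivariant_def)
    then show ?thesis using const[OF T.act_closed[OF g x0]] by simp
  qed
  have min: "minimal_action G T'" using oT(2) by (simp add: outer_tree_def)
  have "{f x0} = T'.M"
    by (rule T'.minimalD[OF min]) (use fM[OF x0] fixed in auto)
  then have one: "T'.M = {f x0}" by simp
  obtain V where V: "invariant_structure G T' V" using outer_tree_invariant_structure[OF oT(2) vf] .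
  have "V \<subseteq> {f x0}" using simplicial_structureD(1)[OF invariant_structureD(1)[OF V]] one by simp
  then have "edges (metr T') V = {}" unfolding edges_def by blast
  then have "structure_volume G T' V = 0" by (simp add: structure_volume_def orbits_def)
  then show False using T'.vol_eq[OF V] oT(3) by simp
qed

lemma folding_path_restrict:
  fixes G :: "('g, 'b) monoid_scheme" and \<gamma> :: "real \<Rightarrow> ('g, 'a) gtree set"
  assumes vf: "virtually_nonabelian_free G" and H: "subgroup H G" "finite (rcosets\<^bsub>G\<^esub> H)"
    and n: "n = card (rcosets\<^bsub>G\<^esub> H)" "0 < n" and \<gamma>: "folding_path G L \<gamma>"
    and cl: "(restrict_class G H n :: ('g, 'a) gtree set \<Rightarrow> _) \<in> outer_space G \<rightarrow> outer_space (G\<lparr>carrier := H\<rparr>)"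
    and dist: "\<And>X Y :: ('g, 'a) gtree set. X \<in> outer_space G \<Longrightarrow> Y \<in> outer_space G \<Longrightarrow>
      outer_dist (G\<lparr>carrier := H\<rparr>) (restrict_class G H n X) (restrict_class G H n Y) = outer_dist G X Y"
  shows "folding_path (G\<lparr>carrier := H\<rparr>) L (restrict_class G H n \<circ> \<gamma>)"
proof -
  let ?H = "G\<lparr>carrier := H\<rparr>"
  let ?i = "restrict_class G H n"
  let ?c = "1 / real n"
  have c: "0 < ?c" using n by simp
  obtain T T' f u where T: "T \<in> unit_trees G" and T': "T' \<in> unit_trees G"
    and f: "folding_map G T T' f"
    and L: "L = outer_dist G (isometry_rel G `` {T}) (isometry_rel G `` {T'})"
    and \<gamma>X: "\<gamma> \<in> {0..L} \<rightarrow> outer_space G"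
    and ends: "\<gamma> 0 = isometry_rel G `` {T}" "\<gamma> L = isometry_rel G `` {T'}"
    and u: "mono_on {0..} u" "u ` {0..} = {0..L}"
    and fold: "\<forall>t\<ge>0. \<exists>c>0. \<forall>S\<in>\<gamma> (u t). equivariantly_isometric G S (gscale c (fold_tree T T' f t))"
    and arc: "\<forall>s t. 0 \<le> s \<and> s \<le> t \<and> t \<le> L \<longrightarrow> outer_dist G (\<gamma> s) (\<gamma> t) = t - s"
    using \<gamma> unfolding folding_path_def by (elim bexE exE conjE)
  have oT: "outer_tree G T" "outer_tree G T'" using T T' by (simp_all add: unit_trees_def)
  have fl: "equivariant G T T' f" "Lipschitz_continuous_map (metr T) (metr T') f"
    using f by (auto simp: folding_map_def optimal_map_def)
  note pos = lip_const_pos[OF vf T T' fl]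
  have rt: "rtree (metr T)" using outer_tree_action[OF oT(1)] by (simp add: tree_action_def)
  have clT: "isometry_rel G `` {T} \<in> outer_space G" "isometry_rel G `` {T'} \<in> outer_space G"
    using T T' by (auto simp: outer_space_def quotientI)
  \<comment> \<open>By \<open>fold_tree_gscale\<close>, folding the multiples up to time t
    corresponds to folding the original trees up to time n t. The arc length parameter is kept,
    since distances are preserved.\<close>
  define u1 where "u1 t = u (real n * t)" for t
  have im: "(\<lambda>t. real n * t) ` {0..} = {0..}"
  proof (intro equalityI subsetI)
    fix t :: real assume "t \<in> {0..}"
    then have "t = real n * (t / real n)" "t / real n \<in> {0..}" using n by auto
    then show "t \<in> (\<lambda>t. real n * t) ` {0..}" by blast
  qed auto
  show ?thesis unfolding folding_path_def
  proof (rule bexI[of _ "gscale ?c T"], rule bexI[of _ "gscale ?c T'"], rule exI[of _ f], rule exI[of _ u1],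
      intro conjI allI impI)
    show "gscale ?c T \<in> unit_trees ?H" "gscale ?c T' \<in> unit_trees ?H"
      using unit_trees_restrict[OF vf H n] T T' by auto
    show "folding_map ?H (gscale ?c T) (gscale ?c T') f"
      by (rule folding_map_restrict_gscale[OF oT H c f])
    show "L = outer_dist ?H (isometry_rel ?H `` {gscale ?c T}) (isometry_rel ?H `` {gscale ?c T'})"
      using dist[OF clT] L restrict_class_eq[OF vf H n T] restrict_class_eq[OF vf H n T'] by simp
    show "?i \<circ> \<gamma> \<in> {0..L} \<rightarrow> outer_space ?H" using \<gamma>X cl by auto
    show "(?i \<circ> \<gamma>) 0 = isometry_rel ?H `` {gscale ?c T}" "(?i \<circ> \<gamma>) L = isometry_rel ?H `` {gscale ?c T'}"
      using ends restrict_class_eq[OF vf H n T] restrict_class_eq[OF vf H n T'] by simp_all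
    show "mono_on {0..} u1"
      using u(1) by (auto simp: u1_def mono_on_def mult_left_mono)
    have "u1 ` {0..} = u ` (\<lambda>t. real n * t) ` {0..}" by (simp add: u1_def image_image)
    then show "u1 ` {0..} = {0..L}" using im u(2) by simp
  next
    fix t :: real assume t: "0 \<le> t"
    then have nt: "0 \<le> real n * t" by simp
    obtain k where k: "0 < k" "\<forall>S\<in>\<gamma> (u (real n * t)).
        equivariantly_isometric G S (gscale k (fold_tree T T' f (real n * t)))"
      using fold[rule_format, OF nt] by (elim exE conjE)
    have "u (real n * t) \<in> {0..L}" using u(2) nt by blast
    then have "\<gamma> (u1 t) \<in> outer_space G" using \<gamma>X by (auto simp: u1_def)
    \<comment> \<open>Every member of the restricted class is isometric over H to the multiple of
      one representative \<open>S0\<close>, so only that multiple has to be compared with the folded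
      tree.\<close>
    then obtain S0 where S0: "S0 \<in> unit_trees G" "\<gamma> (u1 t) = isometry_rel G `` {S0}"
      by (auto simp: outer_space_def elim: quotientE)
    have "S0 \<in> \<gamma> (u (real n * t))"
      using S0 by (simp add: u1_def isometry_rel_def equivariantly_isometric_refl)
    then have "equivariantly_isometric ?H S0 (gscale k (fold_tree T T' f (real n * t)))"
      using equivariantly_isometric_restrict[OF H(1) bspec[OF k(2)]] by blast
    then have "equivariantly_isometric ?H (gscale ?c S0) (gscale ?c (gscale k (fold_tree T T' f (real n * t))))"
      by (rule equivariantly_isometric_gscale[OF c])
    also have "gscale ?c (gscale k (fold_tree T T' f (real n * t)))
        = gscale k (gscale ?c (fold_tree T T' f (real n * t)))"
      by (rule gscale_commute[OF c k(1)])
    also have "gscale ?c (fold_tree T T' f (real n * t)) = fold_tree (gscale ?c T) (gscale ?c T') f t"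
      using fold_tree_gscale[OF rt fl(2) pos t c] by (simp add: mult.commute)
    finally have iso: "equivariantly_isometric ?H (gscale ?c S0) (gscale k (fold_tree (gscale ?c T) (gscale ?c T') f t))" .
    have S1: "gscale ?c S0 \<in> unit_trees ?H" by (rule unit_trees_restrict[OF vf H n S0(1)])
    have "equivariantly_isometric ?H S (gscale k (fold_tree (gscale ?c T) (gscale ?c T') f t))"
      if S: "S \<in> (?i \<circ> \<gamma>) (u1 t)" for S
    proof -
      have "equivariantly_isometric ?H (gscale ?c S0) S"
        using S S0 restrict_class_eq[OF vf H n S0(1)] by (simp add: isometry_rel_def)
      then show ?thesis
        using equivariantly_isometric_trans[OF equivariantly_isometric_sym[OF unit_tree_action[OF S1]] iso] by blast
    qed
    then show "\<exists>c>0. \<forall>S\<in>(?i \<circ> \<gamma>) (u1 t).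
        equivariantly_isometric ?H S (gscale c (fold_tree (gscale ?c T) (gscale ?c T') f t))"
      using k(1) by blast
  next
    fix s t assume st: "0 \<le> s \<and> s \<le> t \<and> t \<le> L"
    then have "\<gamma> s \<in> outer_space G" "\<gamma> t \<in> outer_space G" using \<gamma>X by auto
    then show "outer_dist ?H ((?i \<circ> \<gamma>) s) ((?i \<circ> \<gamma>) t) = t - s" using dist arc st by simp
  qed
qed

theorem theorem1:
  fixes F :: "('g, 'b) monoid_scheme" and H :: "'g set" and n :: nat
  defines "i \<equiv> (restrict_class F H n :: ('g, 'a) gtree set \<Rightarrow> ('g, 'a) gtree set)"
  assumes "group F"
    and "finitely_generated_group F"
    and "virtually_nonabelian_free F"
    and "subgroup H F"
    and "finite (rcosets\<^bsub>F\<^esub> H)"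
    and "card (rcosets\<^bsub>F\<^esub> H) = n"
  shows "i \<in> outer_space F \<rightarrow> outer_space (F\<lparr>carrier := H\<rparr>) \<and>
    (\<forall>X\<in>outer_space F. \<forall>Y\<in>outer_space F.
       outer_dist (F\<lparr>carrier := H\<rparr>) (i X) (i Y) = outer_dist F X Y) \<and>
    (\<forall>L \<gamma>. folding_path F L \<gamma> \<longrightarrow> folding_path (F\<lparr>carrier := H\<rparr>) L (i \<circ> \<gamma>))"
proof -
  note vf = \<open>virtually_nonabelian_free F\<close> and H = \<open>subgroup H F\<close> \<open>finite (rcosets\<^bsub>F\<^esub> H)\<close>
  let ?H = "F\<lparr>carrier := H\<rparr>"
  have n: "n = card (rcosets\<^bsub>F\<^esub> H)" using \<open>card (rcosets\<^bsub>F\<^esub> H) = n\<close> by simp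
  \<comment> \<open>H is one of its own cosets, so n is positive and 1/n is an admissible scaling
    factor.\<close>
  have "H \<in> rcosets\<^bsub>F\<^esub> H"
    using subgroup.subgroup_in_rcosets[OF H(1) \<open>group F\<close>] .
  then have n0: "0 < n" unfolding n using H(2) card_gt_0_iff by blast
  have c: "0 < 1 / real n" using n0 by simp
  have rep: "\<exists>T\<in>unit_trees F. X = isometry_rel F `` {T} \<and>
      i X = isometry_rel ?H `` {gscale (1 / real n) T}"
    if "X \<in> outer_space F" for X
    using that restrict_class_eq[OF vf H n n0] unfolding outer_space_def i_def by (metis quotientE)
  have cl: "i \<in> outer_space F \<rightarrow> outer_space ?H"
    using rep unit_trees_restrict[OF vf H n n0] unfolding outer_space_def by (metis Pi_I quotientI)
  have dist: "outer_dist ?H (i X) (i Y) = outer_dist F X Y"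
    if XY: "X \<in> outer_space F" "Y \<in> outer_space F" for X Y
  proof -
    obtain T where T: "T \<in> unit_trees F" "X = isometry_rel F `` {T}"
      "i X = isometry_rel ?H `` {gscale (1 / real n) T}" using rep[OF XY(1)] by blast
    obtain T' where T': "T' \<in> unit_trees F" "Y = isometry_rel F `` {T'}"
      "i Y = isometry_rel ?H `` {gscale (1 / real n) T'}" using rep[OF XY(2)] by blast
    have o: "outer_tree F T" "outer_tree F T'" using T T' by (simp_all add: unit_trees_def)
    show ?thesis unfolding T(3) T'(3) unfolding T(2) T'(2)
      by (simp add: outer_dist_class T(1) T'(1) unit_trees_restrict[OF vf H n n0] Lip_gscale[OF c] Lip_restrict[OF o H])
  qed
  show ?thesis
    using cl dist folding_path_restrict[OF vf H n n0] unfolding i_def by blast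
qed

end
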